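(* Let $\{A'_{n,m}\}$ be a fixed admissible family and let $k\ge0$ (all terms are defined in the context). Then \[ H_{k}\big(\mathrm{cell}(\bullet,2);\mathbb{Q}\big)=\bigoplus_{C'} M^{\mathrm{FI}_{S(C')+1}}(\mathbb{Q} C'), \] where the direct sum ranges over all $k$-barrier sets $C'$; that is, for every $n$ the $S_n$-representation $H_{k}(\mathrm{cell}(n,2);\mathbb{Q})$ is the internal direct sum of the subrepresentations $M^{\mathrm{FI}_{S(C')+1}}(\mathbb{Q} C')_n$.
   Context: Cells. A symbol on a finite set $S$ of positive integers (labels) is a sequence $\alpha_1|\cdots|\alpha_r$ of nonempty blocks, each a string of labels, with every element of $S$ occurring exactly once. $\mathrm{cell}(S)$ is the polyhedral cell complex with one cell of dimension $|S|-r$ for each symbol on $S$ with $r$ blocks; $f$ is a face of $g$ iff the symbol of $g$ is obtained from that of $f$ by deleting bars and shuffling the merged blocks (keeping the internal order of each original block). $\mathrm{cell}(S,2)$ is the subcomplex of cells all of whose blocks have at most $2$ elements; $\mathrm{cell}(n)=\mathrm{cell}([n])$, $\mathrm{cell}(n,2)=\mathrm{cell}([n],2)$, $[n]=\{1,\dots,n\}$. The boundary of a one-block cell $g$ is $\sum \pm\,\alpha|\beta$ over all ways to split $g$ into two complementary nonempty subwords $\alpha,\beta$, the sign being that of the permutation taking the word $g$ to the word $\alpha\beta$; and $\partial(g_1|g_2)=\partial g_1|g_2+(-1)^{b(g_1)}g_1|\partial g_2$ with $b$ the number of blocks. $S_n$ acts by permuting labels, so $H_k(\mathrm{cell}(n,2);\mathbb{Q})$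 is an $S_n$-representation. The concatenation product $z_1|z_2$ of cycles on disjoint label sets is the bilinear extension of concatenation of symbols; it is well defined on homology classes. Basis. A singleton is a one-element block; a block is a follower if the preceding block is a singleton whose element is less than every element of the block. A symbol $e$ on $[n]$ is critical if its blocks have at most $2$ elements, every two consecutive singletons are in decreasing order, and every $2$-element block with decreasing elements is a follower. Put $z(i)=i$; $z(a\,b)=a\,b+b\,a$ for $a<b$; and for $a<b<c$ let $z(a|c\,b)$ be the image, under the order-preserving relabeling $1,2,3\mapsto a,b,c$, of $z(1|3\,2):=\partial(3\,2\,1)$ (boundary taken in $\mathrm{cell}(3)$). A critical symbol is uniquely a concatenation of pieces $i$; $a\,b$ ($a<b$); $a|c\,b$ ($a<b<c$), and $z(e)$ is the concatenation product of the corresponding cycles. By a theorem of Alpert the classes $z(e)$, $e$ critical with exactly $k$ two-element blocks, form a basis of $H_k(\mathrm{cell}(n,2);\mathbb{Q})$. Sets. For $n\ge3$, $1\le m\le n-2$, $A_{n,m}$ is the set of basis elements $z(e)$ of $H_1(\mathrm{cell}(n,2);\mathbb{Q})$ with $e=i_{1}|\cdots|i_{m}|i_{m+1}\,i_{m+2}|i_{m+3}|\cdots|i_{n}$, the $i_j$ a permutation of $[n]$, $i_1>\cdots>i_m$, $i_{m+3}>\cdots>i_n$, $i_{m+1}>i_{m+2}>i_m$. For $n\ge2$, $0\le m\le n-2$, $B_{n,m}$ is the set of those with $e$ of the same shape, $i_1>\cdots>i_m$, $i_{m+3}>\cdots>i_n$, $i_{m+2}>i_{m+1}$. $B_2=B_{2,0}=\{z(1\,2)\}$.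 High insertion. The barriers of a critical $e$ are its pieces of type $a\,b$ and $a|c\,b$; for $0\le j\le k$ ($k$ the number of barriers) $\iota_j(e)$ is the critical symbol obtained by inserting the singleton block $n+1$ immediately after the $j$-th barrier (at the far left if $j=0$), and $[\iota_j]:H_k(\mathrm{cell}(n,2);\mathbb{Q})\to H_k(\mathrm{cell}(n+1,2);\mathbb{Q})$ is linear with $z(e)\mapsto z(\iota_j(e))$. $\mathrm{FI}_d$. $\mathrm{FI}_d$ has objects $[n]$ and morphisms $(f,g)$ with $f$ an injection and $g$ a $d$-coloring of the complement of the image of $f$; composition is $(f,g)\circ(f',g')=(f\circ f',h)$, $h(x)=g(x)$ if $x\notin\mathrm{im} f$, $h(x)=g'(f^{-1}(x))$ otherwise. An $\mathrm{FI}_d$-module over $\mathbb{Q}$ is a functor from $\mathrm{FI}_d$ to $\mathbb{Q}$-vector spaces; it is free if it is isomorphic to some $\bigoplus_m \mathbb{Q}[\mathrm{Hom}_{\mathrm{FI}_d}([m],\bullet)]\otimes_{\mathbb{Q}[S_m]}U_m$ with $U_m$ an $S_m$-representation. By work of Alpert, $H_k(\mathrm{cell}(\bullet,2);\mathbb{Q})$ with any $d$ of the maps $[\iota_j]$ is an $\mathrm{FI}_d$-module (each chosen map is induced by the standard inclusion $[n]\to[n+1]$ with $n+1$ given the corresponding color). The submodule generated by a subspace and chosen maps is the smallest sequence of $S_n$-subrepresentations containing it and closed under the chosen maps. Admissible family. A family of finite sets $A'_{n,m}\subset H_1(\mathrm{cell}(n,2);\mathbb{Q})$, $n\ge3$,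 $1\le m\le n-2$, is admissible if for all $n,m$: (1) the elements of $A'_{n,m}$ are linearly independent and $|A'_{n,m}|=|A_{n,m}|$; (2) the spans of $B_{n,0}\cup\bigcup_{1\le l\le m}(A'_{n,l}\cup B_{n,l})$ and $B_{n,0}\cup\bigcup_{1\le l\le m}(A_{n,l}\cup B_{n,l})$ are equal; (3) the span of $A'_{n,m}$ is the degree $n$ term of the $\mathrm{FI}_1$-submodule of $H_1(\mathrm{cell}(\bullet,2);\mathbb{Q})$ generated by the span of $A'_{m+2,m}$ and $[\iota_1]$, and this submodule is free; (4) the span of $A'_{m+2,m}$ is isomorphic to $\bigwedge^2\mathrm{Std}_{m+2}$ ($\mathrm{Std}$ the standard representation) as an $S_{m+2}$-representation and lies in the degree $m+2$ term of the $\mathrm{FI}_1$-submodule generated by the span of $A'_{3,1}$ and $[\iota_0]$. $k$-barrier sets. A properly ordered injected cycle arising from a cycle on labels $[r]$ is its image under the relabeling by an order-preserving bijection $[r]\to S$, $S$ a set of $r$ labels. Given a $k$-tuple $(C'_1,\dots,C'_k)$, each $C'_j$ being $B_2$ or some $A'_{m+2,m}$ ($m\ge1$), put $D(B_2)=2$, $D(A'_{m+2,m})=m+2$, $N=\sum_jD(C'_j)$. The associated $k$-barrier set $C'$ is the set of all classes $z'_1|\cdots|z'_k\in H_k(\mathrm{cell}(N,2);\mathbb{Q})$ with $z'_j$ a properly ordered injected cycle arising from an element of $C'_j$, all $N$ labels being used. $S(C')$ is the number of $j$ with $C'_j=B_2$. $M^{\mathrm{FI}_{S(C')+1}}(\mathbb{Q}C')$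 is the $\mathrm{FI}_{S(C')+1}$-submodule of $H_k(\mathrm{cell}(\bullet,2);\mathbb{Q})$ generated by the span of $C'$ and the maps $[\iota_{j-1}]$ for those $j$ with $C'_j=B_2$, together with $[\iota_k]$ (this submodule is free); a subscript $n$ denotes its degree $n$ term. *)

theory Defs
  imports Complex_Main "HOL-Library.Poly_Mapping" "HOL-Library.FuncSet"
    "HOL-Library.Disjoint_Sets" "HOL-Combinatorics.Permutations"
begin

section \<open>Formal rational linear combinations\<close>

definition pscale :: "rat \<Rightarrow> ('a \<Rightarrow>\<^sub>0 rat) \<Rightarrow> ('a \<Rightarrow>\<^sub>0 rat)"
  where "pscale c x = Poly_Mapping.map ((*) c) x"

lemma lookup_pscale [simp]:
  "Poly_Mapping.lookup (pscale c x) i = c * Poly_Mapping.lookup x i"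
  by (simp add: pscale_def map.rep_eq when_def)

global_interpretation FV: vector_space pscale
  by unfold_locales (auto intro!: poly_mapping_eqI simp: lookup_add algebra_simps)

lemma keys_pscale: "Poly_Mapping.keys (pscale c x) \<subseteq> Poly_Mapping.keys x"
  by (auto simp: in_keys_iff)

definition lin_ext :: "('a \<Rightarrow> 'b \<Rightarrow>\<^sub>0 rat) \<Rightarrow> ('a \<Rightarrow>\<^sub>0 rat) \<Rightarrow> ('b \<Rightarrow>\<^sub>0 rat)"
  where "lin_ext g x = (\<Sum>i\<in>Poly_Mapping.keys x. pscale (Poly_Mapping.lookup x i) (g i))"

lemma lin_ext_superset:
  assumes "finite A" "Poly_Mapping.keys x \<subseteq> A"
  shows "lin_ext g x = (\<Sum>i\<in>A. pscale (Poly_Mapping.lookup x i) (g i))"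
  unfolding lin_ext_def
  using assms by (intro sum.mono_neutral_left) (auto simp: in_keys_iff)

lemma lin_ext_add: "lin_ext g (x + y) = lin_ext g x + lin_ext g y"
proof -
  let ?A = "Poly_Mapping.keys x \<union> Poly_Mapping.keys y"
  have k: "Poly_Mapping.keys (x + y) \<subseteq> ?A" by (rule keys_add)
  show ?thesis
    using k by (simp add: lin_ext_superset[of ?A] lookup_add FV.scale_left_distrib sum.distrib)
qed

lemma lin_ext_scale: "lin_ext g (pscale c x) = pscale c (lin_ext g x)"
  using keys_pscale[of c x]
  by (simp add: lin_ext_superset[of "Poly_Mapping.keys x"] FV.scale_sum_right)

lemma lin_ext_0 [simp]: "lin_ext g 0 = 0"
  by (simp add: lin_ext_def)

lemma lin_ext_zero_fun [simp]: "lin_ext (\<lambda>i. 0) x = 0"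
  by (simp add: lin_ext_def)

lemma lin_ext_uminus: "lin_ext g (- x) = - lin_ext g x"
  using lin_ext_scale[of g "-1" x] by simp

lemma lin_ext_diff: "lin_ext g (x - y) = lin_ext g x - lin_ext g y"
  using lin_ext_add[of g x "- y"] by (simp add: lin_ext_uminus)

lemma lin_ext_sum: "lin_ext g (\<Sum>i\<in>A. h i) = (\<Sum>i\<in>A. lin_ext g (h i))"
  by (induct A rule: infinite_finite_induct) (auto simp: lin_ext_add)

lemma lin_ext_single [simp]: "lin_ext g (Poly_Mapping.single i c) = pscale c (g i)"
  by (cases "c = 0") (auto simp: lin_ext_def)

lemma lin_ext_cong:
  "(\<And>i. i \<in> Poly_Mapping.keys x \<Longrightarrow> g i = h i) \<Longrightarrow> lin_ext g x = lin_ext h x"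
  by (simp add: lin_ext_def)

lemma lin_ext_lin_ext: "lin_ext g (lin_ext h x) = lin_ext (\<lambda>i. lin_ext g (h i)) x"
  by (simp add: lin_ext_def[of h] lin_ext_def[of "\<lambda>i. lin_ext g (h i)"] lin_ext_sum lin_ext_scale)

lemma lin_ext_fun_add: "lin_ext (\<lambda>i. g i + h i) x = lin_ext g x + lin_ext h x"
  by (simp add: lin_ext_def FV.scale_right_distrib sum.distrib)

lemma lin_ext_fun_scale: "lin_ext (\<lambda>i. pscale c (g i)) x = pscale c (lin_ext g x)"
  by (simp add: lin_ext_def FV.scale_sum_right mult.commute)

lemma lin_ext_fun_uminus: "lin_ext (\<lambda>i. - g i) x = - lin_ext g x"
  using lin_ext_fun_scale[of "-1" g x] by simp

lemma lin_ext_fun_diff: "lin_ext (\<lambda>i. g i - h i) x = lin_ext g x - lin_ext h x"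
  by (simp add: lin_ext_def FV.scale_right_diff_distrib sum_subtractf)

lemma keys_lin_ext:
  assumes "\<And>i. i \<in> Poly_Mapping.keys x \<Longrightarrow> Poly_Mapping.keys (g i) \<subseteq> A"
  shows "Poly_Mapping.keys (lin_ext g x) \<subseteq> A"
proof -
  have "Poly_Mapping.keys (lin_ext g x)
      \<subseteq> (\<Union>i\<in>Poly_Mapping.keys x. Poly_Mapping.keys (pscale (Poly_Mapping.lookup x i) (g i)))"
    unfolding lin_ext_def by (rule Poly_Mapping.keys_sum)
  then show ?thesis using assms keys_pscale by fast
qed

lemma keys_diff_subset:
  fixes x y :: "'a \<Rightarrow>\<^sub>0 rat"
  shows "Poly_Mapping.keys (x - y) \<subseteq> Poly_Mapping.keys x \<union> Poly_Mapping.keys y"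
  by (auto simp: in_keys_iff lookup_minus)

lemma pscale_single [simp]: "pscale c (Poly_Mapping.single i d) = Poly_Mapping.single i (c * d)"
  by (rule poly_mapping_eqI) (simp add: lookup_single when_def)


section \<open>Cells and the cellular chain complex\<close>

type_synonym symbol = "nat list list"
type_synonym chain = "symbol \<Rightarrow>\<^sub>0 rat"

abbreviation bvec :: "'a \<Rightarrow> 'a \<Rightarrow>\<^sub>0 rat"
  where "bvec e \<equiv> Poly_Mapping.single e 1"

definition labels :: "symbol \<Rightarrow> nat set"
  where "labels e = set (concat e)"

definition cells :: "nat set \<Rightarrow> symbol set"
  where "cells S = {e. [] \<notin> set e \<and> distinct (concat e) \<and> labels e = S}"

definition cells2 :: "nat set \<Rightarrow> symbol set"
  where "cells2 S = {e \<in> cells S. \<forall>b\<in>set e. length b \<le> 2}"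

definition cdim :: "symbol \<Rightarrow> nat"
  where "cdim e = length (concat e) - length e"

definition word_sign :: "nat list \<Rightarrow> nat list \<Rightarrow> int"
  where "word_sign g w = sign (THE p. p permutes {..<length g} \<and> permute_list p g = w)"

text \<open>The ways of splitting a word \<open>g\<close> (with distinct letters) into two complementary nonempty
  subwords are the pairs of nonempty words having \<open>g\<close> as a shuffle.\<close>

definition splits :: "nat list \<Rightarrow> (nat list \<times> nat list) set"
  where "splits g = {(u, v). u \<noteq> [] \<and> v \<noteq> [] \<and> g \<in> shuffles u v}"

definition bd_block :: "nat list \<Rightarrow> chain"
  where "bd_block g =
    (\<Sum>(u, v)\<in>splits g. Poly_Mapping.single [u, v] (of_int (word_sign g (u @ v))))"

fun bd_symbol :: "symbol \<Rightarrow> chain"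
  where
    "bd_symbol [] = 0"
  | "bd_symbol (g # e) =
       lin_ext (\<lambda>s. bvec (s @ e)) (bd_block g) - lin_ext (\<lambda>s. bvec (g # s)) (bd_symbol e)"

definition bd :: "chain \<Rightarrow> chain"
  where "bd = lin_ext bd_symbol"

definition chains2 :: "nat set \<Rightarrow> nat \<Rightarrow> chain set"
  where "chains2 S k = {c. Poly_Mapping.keys c \<subseteq> {e \<in> cells2 S. cdim e = k}}"

definition cycles2 :: "nat set \<Rightarrow> nat \<Rightarrow> chain set"
  where "cycles2 S k = {c \<in> chains2 S k. bd c = 0}"

definition boundaries2 :: "nat set \<Rightarrow> nat \<Rightarrow> chain set"
  where "boundaries2 S k = bd ` chains2 S (Suc k)"

text \<open>Relabeling is the linear extension of the obvious map on symbols; a symbol on whose labels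
  \<open>f\<close> is not injective is sent to 0, which makes relabeling a chain map for every \<open>f\<close>.\<close>

definition relabel :: "(nat \<Rightarrow> nat) \<Rightarrow> chain \<Rightarrow> chain"
  where "relabel f =
    lin_ext (\<lambda>e. if inj_on f (labels e) then bvec (map (map f) e) else 0)"

text \<open>Concatenation is only meaningful for disjoint label sets; the other products of symbols are
  set to 0.\<close>

definition conc :: "chain \<Rightarrow> chain \<Rightarrow> chain"
  where "conc x y = lin_ext (\<lambda>e. lin_ext
    (\<lambda>e'. if labels e \<inter> labels e' = {} then bvec (e @ e') else 0) y) x"


subsection \<open>Properties of the boundary\<close>

lemma finite_splits [simp, intro]: "finite (splits g)"
proof -
  have "splits g \<subseteq> {u. set u \<subseteq> set g \<and> length u \<le> length g} \<times> {u. set u \<subseteq> set g \<and> length u \<le> length g}"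
    by (auto simp: splits_def dest: set_shuffles length_shuffles)
  then show ?thesis
    by (rule finite_subset) (auto intro: finite_lists_length_le)
qed

lemma keys_bd_block: "Poly_Mapping.keys (bd_block g) \<subseteq> (\<lambda>(u, v). [u, v]) ` splits g"
proof -
  have "Poly_Mapping.keys (bd_block g) \<subseteq> (\<Union>p\<in>splits g. Poly_Mapping.keys
      (case p of (u, v) \<Rightarrow> Poly_Mapping.single [u, v] (of_int (word_sign g (u @ v)) :: rat)))"
    unfolding bd_block_def by (rule Poly_Mapping.keys_sum)
  also have "\<dots> \<subseteq> (\<lambda>(u, v). [u, v]) ` splits g"
    by (auto split: if_splits prod.splits)
  finally show ?thesis .
qed

lemma bd_symbol_keys:
  assumes "s \<in> Poly_Mapping.keys (bd_symbol e)"
  shows "labels s = labels e" "length s = Suc (length e)"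
    "length (concat s) = length (concat e)"
    "distinct (concat e) \<Longrightarrow> distinct (concat s)"
    "[] \<notin> set e \<Longrightarrow> [] \<notin> set s"
    "\<forall>b\<in>set e. length b \<le> l \<Longrightarrow> \<forall>b\<in>set s. length b \<le> l"
proof -
  have "labels s = labels e \<and> length s = Suc (length e) \<and> length (concat s) = length (concat e)
    \<and> (distinct (concat e) \<longrightarrow> distinct (concat s)) \<and> ([] \<notin> set e \<longrightarrow> [] \<notin> set s)
    \<and> ((\<forall>b\<in>set e. length b \<le> l) \<longrightarrow> (\<forall>b\<in>set s. length b \<le> l))"
    using assms
  proof (induction e arbitrary: s)
    case Nil
    then show ?case by simp
  next
    case (Cons g e)
    have "Poly_Mapping.keys (lin_ext (\<lambda>s. bvec (s @ e)) (bd_block g))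
        \<subseteq> (\<lambda>(u, v). [u, v] @ e) ` splits g"
      by (rule keys_lin_ext) (use keys_bd_block in fastforce)
    moreover have "Poly_Mapping.keys (lin_ext (\<lambda>s. bvec (g # s)) (bd_symbol e))
        \<subseteq> (\<lambda>s. g # s) ` Poly_Mapping.keys (bd_symbol e)"
      by (rule keys_lin_ext) auto
    moreover have "s \<in> Poly_Mapping.keys (lin_ext (\<lambda>s. bvec (s @ e)) (bd_block g))
        \<union> Poly_Mapping.keys (lin_ext (\<lambda>s. bvec (g # s)) (bd_symbol e))"
      using Cons.prems keys_diff_subset by fastforce
    ultimately have "s \<in> (\<lambda>(u, v). [u, v] @ e) ` splits g
        \<or> s \<in> (\<lambda>s. g # s) ` Poly_Mapping.keys (bd_symbol e)"
      by blast
    then consider (a) u v where "(u, v) \<in> splits g" "s = [u, v] @ e"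
      | (b) s' where "s' \<in> Poly_Mapping.keys (bd_symbol e)" "s = g # s'"
      by auto
    then show ?case
    proof cases
      case a
      then have uv: "u \<noteq> []" "v \<noteq> []" "g \<in> shuffles u v" by (auto simp: splits_def)
      have st: "set g = set u \<union> set v" using uv(3) by (rule set_shuffles)
      have ln: "length g = length u + length v" using uv(3) by (rule length_shuffles)
      have dst: "distinct u \<and> distinct v \<and> set u \<inter> set v = {}" if "distinct g"
        using that mset_eq_imp_distinct_iff[of g "u @ v"] mset_shuffles[OF uv(3)] by simp
      show ?thesis
        using a uv st ln dst by (auto simp: labels_def)
    next
      case b
      from Cons.IH[OF b(1)] show ?thesis
        using b(2) by (auto simp: labels_def)
    qed
  qed
  then show "labels s = labels e" "length s = Suc (length e)"
    "length (concat s) = length (concat e)"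
    "distinct (concat e) \<Longrightarrow> distinct (concat s)"
    "[] \<notin> set e \<Longrightarrow> [] \<notin> set s"
    "\<forall>b\<in>set e. length b \<le> l \<Longrightarrow> \<forall>b\<in>set s. length b \<le> l"
    by auto
qed

lemma bd_simps [simp]:
  "bd 0 = 0" "bd (x + y) = bd x + bd y" "bd (x - y) = bd x - bd y"
  "bd (pscale c x) = pscale c (bd x)"
  by (simp_all add: bd_def lin_ext_add lin_ext_diff lin_ext_scale)

lemma bd_symbol_append:
  "bd_symbol (e @ e') = lin_ext (\<lambda>s. bvec (s @ e')) (bd_symbol e)
     + pscale ((-1) ^ length e) (lin_ext (\<lambda>s. bvec (e @ s)) (bd_symbol e'))"
proof (induction e)
  case Nil
  have "lin_ext (\<lambda>s. bvec s) x = x" for x :: chain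
    by (rule poly_mapping_eqI)
      (simp add: lin_ext_def lookup_sum lookup_single when_def in_keys_iff)
  then show ?case by simp
next
  case (Cons g e)
  show ?case
    by (simp add: Cons.IH lin_ext_diff lin_ext_add lin_ext_scale lin_ext_lin_ext)
qed

definition grade :: "chain \<Rightarrow> chain"
  where "grade = lin_ext (\<lambda>e. Poly_Mapping.single e ((-1) ^ length e))"

lemma bd_grade: "bd (grade x) = - grade (bd x)"
proof -
  have "pscale ((-1) ^ length e) (bd_symbol e)
      = - lin_ext (\<lambda>e. Poly_Mapping.single e ((-1) ^ length e)) (bd_symbol e)" for e
  proof -
    have "lin_ext (\<lambda>e. Poly_Mapping.single e ((-1) ^ length e)) (bd_symbol e)
        = lin_ext (\<lambda>s. pscale ((-1) ^ Suc (length e)) (bvec s)) (bd_symbol e)"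
      by (rule lin_ext_cong) (simp add: bd_symbol_keys)
    also have "\<dots> = pscale ((-1) ^ Suc (length e)) (bd_symbol e)"
      unfolding lin_ext_fun_scale
      using bd_symbol_append[of "[]" e] by simp
    finally show ?thesis by simp
  qed
  then show ?thesis
    by (simp add: bd_def grade_def lin_ext_lin_ext lin_ext_fun_uminus)
qed

lemma grade_grade: "grade (grade x) = x"
proof -
  have "lin_ext (\<lambda>s. bvec s) x = x" for x :: chain
    by (rule poly_mapping_eqI)
      (simp add: lin_ext_def lookup_sum lookup_single when_def in_keys_iff)
  then show ?thesis
    by (simp add: grade_def lin_ext_lin_ext flip: power_mult_distrib)
qed

lemma keys_grade: "Poly_Mapping.keys (grade x) \<subseteq> Poly_Mapping.keys x"
  unfolding grade_def by (rule keys_lin_ext) auto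

lemma conc_simps:
  "conc 0 y = 0" "conc x 0 = 0"
  "conc (x + x') y = conc x y + conc x' y" "conc x (y + y') = conc x y + conc x y'"
  "conc (x - x') y = conc x y - conc x' y" "conc x (y - y') = conc x y - conc x y'"
  by (simp_all add: conc_def lin_ext_add lin_ext_diff lin_ext_fun_add lin_ext_fun_diff)

lemma bd_conc: "bd (conc x y) = conc (bd x) y + conc (grade x) (bd y)"
proof -
  have 1: "bd (if labels e \<inter> labels e' = {} then bvec (e @ e') else 0)
     = lin_ext (\<lambda>s. if labels s \<inter> labels e' = {} then bvec (s @ e') else 0) (bd_symbol e)
     + pscale ((-1) ^ length e)
       (lin_ext (\<lambda>s. if labels e \<inter> labels s = {} then bvec (e @ s) else 0) (bd_symbol e'))"
    (is "_ = lin_ext ?f _ + pscale _ (lin_ext ?g _)") for e e'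
  proof -
    have "lin_ext ?f (bd_symbol e)
        = lin_ext (\<lambda>s. if labels e \<inter> labels e' = {} then bvec (s @ e') else 0) (bd_symbol e)"
      by (rule lin_ext_cong) (simp add: bd_symbol_keys)
    moreover have "lin_ext ?g (bd_symbol e')
        = lin_ext (\<lambda>s. if labels e \<inter> labels e' = {} then bvec (e @ s) else 0) (bd_symbol e')"
      by (rule lin_ext_cong) (simp add: bd_symbol_keys)
    ultimately show ?thesis
      by (simp add: bd_def bd_symbol_append)
  qed
  have swap: "lin_ext (\<lambda>e. lin_ext (\<lambda>e'. F e e') y) x = lin_ext (\<lambda>e'. lin_ext (\<lambda>e. F e e') x) y"
    for F :: "symbol \<Rightarrow> symbol \<Rightarrow> chain" and x y
    unfolding lin_ext_def FV.scale_sum_right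
    by (subst sum.swap) (simp add: mult.commute)
  have "bd (conc x y) = lin_ext (\<lambda>e. lin_ext (\<lambda>e'.
      bd (if labels e \<inter> labels e' = {} then bvec (e @ e') else 0)) y) x"
    by (simp add: bd_def conc_def lin_ext_lin_ext)
  also have "\<dots> = lin_ext (\<lambda>e. lin_ext (\<lambda>e'.
        lin_ext (\<lambda>s. if labels s \<inter> labels e' = {} then bvec (s @ e') else 0) (bd_symbol e)) y) x
     + lin_ext (\<lambda>e. lin_ext (\<lambda>e'. pscale ((-1) ^ length e)
       (lin_ext (\<lambda>s. if labels e \<inter> labels s = {} then bvec (e @ s) else 0) (bd_symbol e'))) y) x"
    by (simp only: 1 lin_ext_fun_add)
  also have "lin_ext (\<lambda>e. lin_ext (\<lambda>e'.
        lin_ext (\<lambda>s. if labels s \<inter> labels e' = {} then bvec (s @ e') else 0) (bd_symbol e)) y) x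
      = conc (bd x) y"
    unfolding conc_def bd_def lin_ext_lin_ext
    by (intro lin_ext_cong swap)
  also have "lin_ext (\<lambda>e. lin_ext (\<lambda>e'. pscale ((-1) ^ length e)
       (lin_ext (\<lambda>s. if labels e \<inter> labels s = {} then bvec (e @ s) else 0) (bd_symbol e'))) y) x
      = conc (grade x) (bd y)"
    by (simp add: conc_def grade_def bd_def lin_ext_lin_ext lin_ext_fun_scale)
  finally show ?thesis .
qed

lemma keys_conc:
  assumes "Poly_Mapping.keys x \<subseteq> (\<Union>S. cells2 S)" "Poly_Mapping.keys y \<subseteq> (\<Union>S. cells2 S)"
  shows "Poly_Mapping.keys (conc x y) \<subseteq> (\<Union>S. cells2 S)"
proof -
  have "e @ e' \<in> (\<Union>S. cells2 S)"
    if "e \<in> (\<Union>S. cells2 S)" "e' \<in> (\<Union>S. cells2 S)" "labels e \<inter> labels e' = {}" for e e'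
    using that by (auto simp: cells2_def cells_def labels_def)
  then show ?thesis
    unfolding conc_def using assms by (intro keys_lin_ext) (auto split: if_splits; blast)
qed

lemma map_in_shuffles: "zs \<in> shuffles xs ys \<Longrightarrow> map f zs \<in> shuffles (map f xs) (map f ys)"
proof (induction xs ys arbitrary: zs rule: shuffles.induct)
  case (3 x xs y ys)
  from "3.prems" obtain zs' where "zs = x # zs' \<and> zs' \<in> shuffles xs (y # ys)
      \<or> zs = y # zs' \<and> zs' \<in> shuffles (x # xs) ys"
    by auto
  then show ?case
    using "3.IH"(1)[of zs'] "3.IH"(2)[of zs'] by auto
qed auto

lemma splits_map:
  assumes "inj_on f (set g)"
  shows "splits (map f g) = (\<lambda>(u, v). (map f u, map f v)) ` splits g"
proof (intro equalityI subsetI)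
  fix p assume "p \<in> (\<lambda>(u, v). (map f u, map f v)) ` splits g"
  then show "p \<in> splits (map f g)"
    by (auto simp: splits_def map_in_shuffles)
next
  fix p assume "p \<in> splits (map f g)"
  then obtain u v where p: "p = (u, v)" and uv: "u \<noteq> []" "v \<noteq> []" "map f g \<in> shuffles u v"
    by (auto simp: splits_def)
  let ?h = "inv_into (set g) f"
  have st: "set u \<union> set v = f ` set g" using set_shuffles[OF uv(3)] by auto
  have "map ?h (map f g) = g"
    using assms by (simp add: map_idI)
  then have "g \<in> shuffles (map ?h u) (map ?h v)"
    using map_in_shuffles[OF uv(3), of ?h] by simp
  moreover have "map f (map ?h u) = u" "map f (map ?h v) = v"
  proof -
    have "f (?h x) = x" if "x \<in> set u \<union> set v" for x
      using that unfolding st by (rule f_inv_into_f)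
    then show "map f (map ?h u) = u" "map f (map ?h v) = v"
      by (auto intro!: map_idI)
  qed
  ultimately show "p \<in> (\<lambda>(u, v). (map f u, map f v)) ` splits g"
    using uv p by (intro image_eqI[of _ _ "(map ?h u, map ?h v)"]) (auto simp: splits_def)
qed

lemma word_sign_map:
  assumes "inj_on f (set g \<union> set w)"
  shows "word_sign (map f g) (map f w) = word_sign g w"
proof -
  have "permute_list p (map f g) = map f w \<longleftrightarrow> permute_list p g = w"
    if p: "p permutes {..<length g}" for p
  proof -
    have m: "permute_list p (map f g) = map f (permute_list p g)"
      using p by (rule permute_list_map)
    have "set (permute_list p g) = set g" using p by (rule set_permute_list)
    then show ?thesis unfolding m using assms by (auto dest!: map_inj_on)
  qed
  then have "(\<lambda>p. p permutes {..<length g} \<and> permute_list p (map f g) = map f w)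
      = (\<lambda>p. p permutes {..<length g} \<and> permute_list p g = w)"
    by blast
  then show ?thesis by (simp add: word_sign_def)
qed

lemma bd_block_map:
  assumes "inj_on f (set g)"
  shows "bd_block (map f g) = lin_ext (\<lambda>s. bvec (map (map f) s)) (bd_block g)"
proof -
  have sub: "set u \<subseteq> set g \<and> set v \<subseteq> set g" if "(u, v) \<in> splits g" for u v
    using that set_shuffles[of g u v] by (auto simp: splits_def)
  have inj: "inj_on (\<lambda>(u, v). (map f u, map f v)) (splits g)"
  proof (rule inj_onI, clarify)
    fix u v u' v'
    assume *: "(u, v) \<in> splits g" "(u', v') \<in> splits g" "map f u = map f u'" "map f v = map f v'"
    have "inj_on f (set u \<union> set u')" "inj_on f (set v \<union> set v')"
      using sub[OF *(1)] sub[OF *(2)] by (auto intro!: inj_on_subset[OF assms])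
    with *(3,4) show "u = u' \<and> v = v'" by (auto dest: map_inj_on)
  qed
  have "bd_block (map f g) = (\<Sum>(u, v)\<in>splits g.
      Poly_Mapping.single [map f u, map f v] (of_int (word_sign (map f g) (map f u @ map f v))))"
    unfolding bd_block_def splits_map[OF assms] sum.reindex[OF inj]
    by (rule sum.cong) auto
  also have "\<dots> = (\<Sum>(u, v)\<in>splits g.
      Poly_Mapping.single [map f u, map f v] (of_int (word_sign g (u @ v))))"
  proof (rule sum.cong, simp, clarify)
    fix u v assume "(u, v) \<in> splits g"
    then have "set g \<union> set (u @ v) = set g" using sub by auto
    then have "word_sign (map f g) (map f (u @ v)) = word_sign g (u @ v)"
      using assms by (intro word_sign_map) simp
    then show "Poly_Mapping.single [map f u, map f v]
        (of_int (word_sign (map f g) (map f u @ map f v)) :: rat)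
      = Poly_Mapping.single [map f u, map f v] (of_int (word_sign g (u @ v)))"
      by simp
  qed
  also have "\<dots> = lin_ext (\<lambda>s. bvec (map (map f) s)) (bd_block g)"
    unfolding bd_block_def lin_ext_sum by (rule sum.cong) auto
  finally show ?thesis .
qed

lemma bd_symbol_map:
  assumes "inj_on f (labels e)"
  shows "bd_symbol (map (map f) e) = lin_ext (\<lambda>s. bvec (map (map f) s)) (bd_symbol e)"
  using assms
proof (induction e)
  case (Cons g e)
  have i: "inj_on f (set g)" "inj_on f (labels e)"
    using Cons.prems by (auto simp: labels_def intro: inj_on_subset)
  show ?case
    by (simp add: Cons.IH[OF i(2)] bd_block_map[OF i(1)] lin_ext_lin_ext lin_ext_diff)
qed simp

lemma bd_relabel: "bd (relabel f x) = relabel f (bd x)"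
proof -
  have "lin_ext bd_symbol (if inj_on f (labels e) then bvec (map (map f) e) else 0)
    = lin_ext (\<lambda>e. if inj_on f (labels e) then bvec (map (map f) e) else 0) (bd_symbol e)" for e
  proof -
    have "lin_ext (\<lambda>e. if inj_on f (labels e) then bvec (map (map f) e) else 0) (bd_symbol e)
      = lin_ext (\<lambda>s. if inj_on f (labels e) then bvec (map (map f) s) else 0) (bd_symbol e)"
      by (rule lin_ext_cong) (simp add: bd_symbol_keys)
    then show ?thesis by (simp add: bd_symbol_map)
  qed
  then show ?thesis
    by (simp add: bd_def relabel_def lin_ext_lin_ext)
qed

lemma relabel_diff: "relabel f (x - y) = relabel f x - relabel f y"
  by (simp add: relabel_def lin_ext_diff)

lemma keys_relabel:
  assumes "Poly_Mapping.keys x \<subseteq> (\<Union>S. cells2 S)"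
  shows "Poly_Mapping.keys (relabel f x) \<subseteq> (\<Union>S. cells2 S)"
proof -
  have "map (map f) e \<in> (\<Union>S. cells2 S)" if "e \<in> (\<Union>S. cells2 S)" "inj_on f (labels e)" for e
    using that by (auto simp: cells2_def cells_def labels_def distinct_map simp flip: map_concat)
  then show ?thesis
    unfolding relabel_def using assms by (intro keys_lin_ext) (auto split: if_splits; blast)
qed


section \<open>Homology\<close>

text \<open>All homology groups live in one ambient rational vector space, the homology of the direct sum
  of the chain complexes of \<open>cell(S,2)\<close> over all finite sets \<open>S\<close> of labels. It is the direct
  sum of the spaces \<open>H\<^sub>k(cell(S,2);\<rat>)\<close>, which are the subspaces \<open>homology2 S k\<close> below.\<close>

definition all_chains2 :: "chain set"
  where "all_chains2 = {c. Poly_Mapping.keys c \<subseteq> (\<Union>S. cells2 S)}"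

definition homologous :: "chain \<Rightarrow> chain \<Rightarrow> bool"
  where "homologous x y \<longleftrightarrow>
    x \<in> all_chains2 \<and> bd x = 0 \<and> y \<in> all_chains2 \<and> bd y = 0 \<and> x - y \<in> bd ` all_chains2"

lemma all_chains2_closed:
  "0 \<in> all_chains2"
  "x \<in> all_chains2 \<Longrightarrow> y \<in> all_chains2 \<Longrightarrow> x + y \<in> all_chains2"
  "x \<in> all_chains2 \<Longrightarrow> y \<in> all_chains2 \<Longrightarrow> x - y \<in> all_chains2"
  "x \<in> all_chains2 \<Longrightarrow> pscale c x \<in> all_chains2"
  "x \<in> all_chains2 \<Longrightarrow> y \<in> all_chains2 \<Longrightarrow> conc x y \<in> all_chains2"
  "x \<in> all_chains2 \<Longrightarrow> relabel f x \<in> all_chains2"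
  "x \<in> all_chains2 \<Longrightarrow> grade x \<in> all_chains2"
proof -
  assume x: "x \<in> all_chains2"
  show "pscale c x \<in> all_chains2"
    using x keys_pscale[of c x] by (auto simp only: all_chains2_def mem_Collect_eq)
  show "relabel f x \<in> all_chains2"
    using x keys_relabel[of x f] by (simp only: all_chains2_def mem_Collect_eq)
  show "grade x \<in> all_chains2"
    using x keys_grade[of x] by (auto simp only: all_chains2_def mem_Collect_eq)
  assume y: "y \<in> all_chains2"
  show "x + y \<in> all_chains2"
    using x y keys_add[of x y] by (auto simp only: all_chains2_def mem_Collect_eq)
  show "x - y \<in> all_chains2"
    using x y keys_diff_subset[of x y] by (auto simp only: all_chains2_def mem_Collect_eq)
  show "conc x y \<in> all_chains2"
    using x y keys_conc[of x y] by (simp only: all_chains2_def mem_Collect_eq)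
qed (simp add: all_chains2_def)

lemma bd_image_closed:
  assumes "x \<in> bd ` all_chains2" "y \<in> bd ` all_chains2"
  shows "x + y \<in> bd ` all_chains2" "x - y \<in> bd ` all_chains2"
    "pscale c x \<in> bd ` all_chains2"
proof -
  obtain a b where ab: "a \<in> all_chains2" "x = bd a" "b \<in> all_chains2" "y = bd b"
    using assms by blast
  show "x + y \<in> bd ` all_chains2"
    using ab by (intro image_eqI[of _ _ "a + b"]) (simp_all add: all_chains2_closed)
  show "x - y \<in> bd ` all_chains2"
    using ab by (intro image_eqI[of _ _ "a - b"]) (simp_all add: all_chains2_closed)
  show "pscale c x \<in> bd ` all_chains2"
    using ab by (intro image_eqI[of _ _ "pscale c a"]) (simp_all add: all_chains2_closed)
qed

lemma homologous_refl_iff: "homologous x x \<longleftrightarrow> x \<in> all_chains2 \<and> bd x = 0"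
proof -
  have "0 \<in> bd ` all_chains2"
    by (rule image_eqI[of _ _ 0]) (simp_all add: all_chains2_closed)
  then show ?thesis by (auto simp: homologous_def)
qed

quotient_type hclass = "chain" / partial: homologous
proof (rule part_equivpI)
  show "\<exists>x. homologous x x"
    by (rule exI[of _ 0]) (simp add: homologous_refl_iff all_chains2_closed)
  show "symp homologous"
  proof (rule sympI)
    fix x y assume "homologous x y"
    then show "homologous y x"
      using bd_image_closed(3)[of "x - y" "x - y" "-1"] by (simp add: homologous_def)
  qed
  show "transp homologous"
  proof (rule transpI)
    fix x y z assume "homologous x y" "homologous y z"
    then show "homologous x z"
      using bd_image_closed(1)[of "x - y" "y - z"] by (simp add: homologous_def)
  qed
qed

instantiation hclass :: ab_group_add
begin

lift_definition zero_hclass :: hclass is 0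
  by (simp add: homologous_refl_iff all_chains2_closed)

lift_definition plus_hclass :: "hclass \<Rightarrow> hclass \<Rightarrow> hclass" is "(+)"
  by (auto simp: homologous_def all_chains2_closed add_diff_add bd_image_closed)

lift_definition minus_hclass :: "hclass \<Rightarrow> hclass \<Rightarrow> hclass" is "(-)"
proof -
  fix a b c d :: chain assume h: "homologous a b" "homologous c d"
  have "a - c - (b - d) = (a - b) - (c - d)" by simp
  moreover have "(a - b) - (c - d) \<in> bd ` all_chains2"
    using h bd_image_closed(2)[of "a - b" "c - d"] by (simp add: homologous_def)
  ultimately have "a - c - (b - d) \<in> bd ` all_chains2" by (simp only:)
  with h show "homologous (a - c) (b - d)"
    by (simp add: homologous_def all_chains2_closed)
qed

lift_definition uminus_hclass :: "hclass \<Rightarrow> hclass" is uminus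
proof -
  fix a b :: chain assume h: "homologous a b"
  have "bd (- a) = - bd a" "bd (- b) = - bd b" for a b
    using bd_simps(3)[of 0 a] bd_simps(3)[of 0 b] by auto
  moreover have "- a - - b = pscale (-1) (a - b)" by simp
  ultimately show "homologous (- a) (- b)"
    using h all_chains2_closed(4)[of a "-1"] all_chains2_closed(4)[of b "-1"]
      bd_image_closed(3)[of "a - b" "a - b" "-1"]
    by (simp add: homologous_def)
qed

instance
proof
  fix a b c :: hclass
  show "a + b + c = a + (b + c)"
    by transfer (simp add: homologous_refl_iff all_chains2_closed add.assoc)
  show "a + b = b + a"
    by transfer (simp add: homologous_refl_iff all_chains2_closed add.commute)
  show "0 + a = a"
    by transfer simp
  show "- a + a = 0"
    by transfer (simp add: homologous_refl_iff all_chains2_closed)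
  show "a - b = a + - b"
  proof transfer
    fix x y assume "homologous x x" "homologous y y"
    then show "homologous (x - y) (x + - y)"
      by (simp add: homologous_refl_iff all_chains2_closed)
  qed
qed

end

lift_definition hscale :: "rat \<Rightarrow> hclass \<Rightarrow> hclass" is pscale
proof -
  fix c :: rat and x y assume h: "homologous x y"
  have "pscale c x - pscale c y = pscale c (x - y)" by (simp add: FV.scale_right_diff_distrib)
  with h show "homologous (pscale c x) (pscale c y)"
    by (simp add: homologous_def all_chains2_closed bd_image_closed(3)[of _ "x - y"])
qed

global_interpretation HV: vector_space hscale
proof
  fix a b :: rat and x y :: hclass
  show "hscale a (x + y) = hscale a x + hscale a y"
    by transfer (simp add: homologous_refl_iff all_chains2_closed FV.scale_right_distrib)
  show "hscale (a + b) x = hscale a x + hscale b x"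
    by transfer (simp add: homologous_refl_iff all_chains2_closed FV.scale_left_distrib)
  show "hscale a (hscale b x) = hscale (a * b) x"
    by transfer (simp add: homologous_refl_iff all_chains2_closed)
  show "hscale 1 x = x"
    by transfer simp
qed

lift_definition hcls :: "chain \<Rightarrow> hclass" is "\<lambda>x. if x \<in> all_chains2 \<and> bd x = 0 then x else 0"
  by (auto simp: homologous_refl_iff all_chains2_closed)

lift_definition hrelabel :: "(nat \<Rightarrow> nat) \<Rightarrow> hclass \<Rightarrow> hclass" is relabel
proof -
  fix f :: "nat \<Rightarrow> nat" and x y assume h: "homologous x y"
  then obtain c where c: "c \<in> all_chains2" "x - y = bd c" by (auto simp: homologous_def)
  have "relabel f x - relabel f y = bd (relabel f c)"
    by (simp add: bd_relabel flip: relabel_diff c(2))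
  then have "relabel f x - relabel f y \<in> bd ` all_chains2"
    using c(1) by (auto intro: all_chains2_closed)
  moreover have "relabel f 0 = 0" by (simp add: relabel_def)
  ultimately show "homologous (relabel f x) (relabel f y)"
    using h by (simp add: homologous_def all_chains2_closed bd_relabel)
qed

lift_definition hconc :: "hclass \<Rightarrow> hclass \<Rightarrow> hclass" is conc
proof -
  fix x x' y y' assume h: "homologous x x'" "homologous y y'"
  from h obtain c where c: "c \<in> all_chains2" "x - x' = bd c" by (auto simp: homologous_def)
  from h obtain d where d: "d \<in> all_chains2" "y - y' = bd d" by (auto simp: homologous_def)
  have z: "bd x = 0" "bd x' = 0" "bd y = 0" "bd y' = 0"
    and a: "x \<in> all_chains2" "x' \<in> all_chains2" "y \<in> all_chains2" "y' \<in> all_chains2"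
    using h by (auto simp: homologous_def)
  have "conc x y - conc x' y' = conc (bd c) y + conc x' (bd d)"
    by (simp add: conc_simps flip: c(2) d(2))
  also have "\<dots> = bd (conc c y + conc (grade x') d)"
    using z by (simp add: bd_conc bd_grade grade_grade conc_simps) (simp add: grade_def conc_simps)
  finally have "conc x y - conc x' y' \<in> bd ` all_chains2"
    using a c(1) d(1) by (auto simp: all_chains2_closed simp del: bd_simps)
  then show "homologous (conc x y) (conc x' y')"
    using a z by (simp add: homologous_def all_chains2_closed bd_conc conc_simps)
qed

definition homology2 :: "nat set \<Rightarrow> nat \<Rightarrow> hclass set"
  where "homology2 S k = hcls ` cycles2 S k"

text \<open>The space \<open>homology2 S k\<close> is the quotient of the cycles of \<open>cell(S,2)\<close> by its
  boundaries.\<close>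

lemma cycles2_all: "x \<in> cycles2 S k \<Longrightarrow> x \<in> all_chains2 \<and> bd x = 0"
  by (auto simp: cycles2_def chains2_def all_chains2_def)

lemma bd_symbol_cell:
  assumes "e \<in> cells2 S" "s \<in> Poly_Mapping.keys (bd_symbol e)"
  shows "s \<in> cells2 S" "cdim e = Suc (cdim s)"
proof -
  have e: "[] \<notin> set e" "distinct (concat e)" "labels e = S" "\<forall>b\<in>set e. length b \<le> 2"
    using assms(1) by (auto simp: cells2_def cells_def)
  note k = bd_symbol_keys[OF assms(2)]
  show "s \<in> cells2 S"
    using e k(1) k(4) k(5) k(6)[of 2] by (auto simp: cells2_def cells_def)
  have le: "[] \<notin> set t \<Longrightarrow> length t \<le> length (concat t)" for t :: symbol
  proof (induction t)
    case (Cons b t)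
    then have "length b \<ge> 1" by (cases b) auto
    with Cons show ?case by simp
  qed simp
  show "cdim e = Suc (cdim s)"
    using le[OF k(5)[OF e(1)]] k(2,3) by (simp add: cdim_def)
qed

lemma hcls_eq_iff:
  assumes x: "x \<in> cycles2 S k" and y: "y \<in> cycles2 S k"
  shows "hcls x = hcls y \<longleftrightarrow> x - y \<in> boundaries2 S k"
proof -
  have all: "x \<in> all_chains2 \<and> bd x = 0" "y \<in> all_chains2 \<and> bd y = 0"
    using x y cycles2_all by auto
  have "hcls x = hcls y \<longleftrightarrow> homologous x y"
    using all by transfer (simp add: homologous_def)
  also have "\<dots> \<longleftrightarrow> x - y \<in> bd ` all_chains2"
    using all by (simp add: homologous_def)
  also have "\<dots> \<longleftrightarrow> x - y \<in> boundaries2 S k"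
  proof
    assume "x - y \<in> boundaries2 S k"
    moreover have "chains2 S (Suc k) \<subseteq> all_chains2"
      by (auto simp: chains2_def all_chains2_def)
    ultimately show "x - y \<in> bd ` all_chains2"
      by (auto simp: boundaries2_def)
  next
    assume "x - y \<in> bd ` all_chains2"
    then obtain c where c: "c \<in> all_chains2" "x - y = bd c" by auto
    let ?P = "\<lambda>e. e \<in> cells2 S \<and> cdim e = Suc k"
    let ?K = "{e \<in> cells2 S. cdim e = k}"
    define c1 where "c1 = lin_ext (\<lambda>e. if ?P e then bvec e else 0) c"
    define c2 where "c2 = lin_ext (\<lambda>e. if ?P e then 0 else bvec e) c"
    have "lin_ext (\<lambda>s. bvec s) c = c"
      by (rule poly_mapping_eqI)
        (simp add: lin_ext_def lookup_sum lookup_single when_def in_keys_iff)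
    moreover have "lin_ext (\<lambda>s. bvec s) c = c1 + c2"
      unfolding c1_def c2_def lin_ext_fun_add[symmetric] by (rule lin_ext_cong) simp
    ultimately have sum: "c = c1 + c2" by simp
    have k1: "Poly_Mapping.keys c1 \<subseteq> {e. ?P e}"
      unfolding c1_def by (rule keys_lin_ext) auto
    have k2: "Poly_Mapping.keys c2 \<subseteq> {e \<in> (\<Union>S. cells2 S). \<not> ?P e}"
      unfolding c2_def
    proof (rule keys_lin_ext)
      fix e assume "e \<in> Poly_Mapping.keys c"
      then have "e \<in> (\<Union>S. cells2 S)" using c(1) by (auto simp: all_chains2_def)
      then show "Poly_Mapping.keys (if ?P e then 0 else bvec e)
          \<subseteq> {e \<in> (\<Union>S. cells2 S). \<not> ?P e}"
        by (simp split: if_splits)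
    qed
    have b1: "Poly_Mapping.keys (bd c1) \<subseteq> ?K"
      unfolding bd_def
    proof (rule keys_lin_ext, rule subsetI)
      fix e s assume "e \<in> Poly_Mapping.keys c1" "s \<in> Poly_Mapping.keys (bd_symbol e)"
      then show "s \<in> ?K" using k1 bd_symbol_cell[of e S s] by auto
    qed
    have b2: "Poly_Mapping.keys (bd c2) \<subseteq> - ?K"
      unfolding bd_def
    proof (rule keys_lin_ext, rule subsetI)
      fix e s assume e: "e \<in> Poly_Mapping.keys c2" and s: "s \<in> Poly_Mapping.keys (bd_symbol e)"
      then obtain T where T: "e \<in> cells2 T" "\<not> ?P e" using k2 by auto
      have "s \<in> cells2 T" "cdim e = Suc (cdim s)" using bd_symbol_cell[OF T(1) s] by auto
      moreover have "T = S" if "s \<in> cells2 S" "s \<in> cells2 T"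
        using that by (auto simp: cells2_def cells_def)
      ultimately show "s \<in> - ?K" using T by auto
    qed
    have "Poly_Mapping.keys (x - y) \<subseteq> ?K"
      using x y keys_diff_subset[of x y] by (auto simp only: cycles2_def chains2_def mem_Collect_eq)
    then have "Poly_Mapping.keys (x - y - bd c1) \<subseteq> ?K"
      using b1 keys_diff_subset[of "x - y" "bd c1"] by blast
    moreover have "x - y - bd c1 = bd c2" by (simp add: c(2) sum)
    ultimately have "Poly_Mapping.keys (bd c2) \<subseteq> ?K" by simp
    with b2 have "Poly_Mapping.keys (bd c2) = {}" by blast
    then have "bd c2 = 0" by (simp only: keys_eq_empty)
    then have "x - y = bd c1" using c(2) sum by simp
    moreover have "c1 \<in> chains2 S (Suc k)" using k1 by (auto simp: chains2_def)
    ultimately show "x - y \<in> boundaries2 S k" by (simp add: boundaries2_def)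
  qed
  finally show ?thesis .
qed

text \<open>\<open>Hk k n\<close> is \<open>H\<^sub>k(cell(n,2);\<rat>)\<close>; a permutation \<open>\<sigma>\<close> of \<open>{1..n}\<close> acts on it by
  \<open>hrelabel \<sigma>\<close>.\<close>

abbreviation Hk :: "nat \<Rightarrow> nat \<Rightarrow> hclass set"
  where "Hk k n \<equiv> homology2 {1..n} k"

definition subrep :: "nat \<Rightarrow> nat \<Rightarrow> hclass set \<Rightarrow> bool"
  where "subrep k n V \<longleftrightarrow> HV.subspace V \<and> V \<subseteq> Hk k n \<and>
    (\<forall>\<sigma>. \<sigma> permutes {1..n} \<longrightarrow> hrelabel \<sigma> ` V \<subseteq> V)"


section \<open>Critical symbols and the basis\<close>

definition follower :: "symbol \<Rightarrow> nat \<Rightarrow> bool"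
  where "follower e i \<longleftrightarrow>
    0 < i \<and> length (e ! (i - 1)) = 1 \<and> (\<forall>x\<in>set (e ! i). hd (e ! (i - 1)) < x)"

definition critical :: "nat \<Rightarrow> nat \<Rightarrow> symbol set"
  where "critical n k = {e \<in> cells2 {1..n}.
    (\<forall>i. Suc i < length e \<and> length (e ! i) = 1 \<and> length (e ! Suc i) = 1 \<longrightarrow>
      hd (e ! i) > hd (e ! Suc i)) \<and>
    (\<forall>i<length e. \<forall>c b. e ! i = [c, b] \<and> c > b \<longrightarrow> follower e i) \<and>
    card {i. i < length e \<and> length (e ! i) = 2} = k}"

text \<open>\<open>PTriple a b c\<close> stands for \<open>a|c b\<close>. The function \<open>pieces\<close> is only relevant for critical
  symbols, in which a decreasing block always follows a smaller singleton.\<close>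

datatype piece = PSingle nat | PPair nat nat | PTriple nat nat nat

fun piece_symbol :: "piece \<Rightarrow> symbol"
  where
    "piece_symbol (PSingle i) = [[i]]"
  | "piece_symbol (PPair a b) = [[a, b]]"
  | "piece_symbol (PTriple a b c) = [[a], [c, b]]"

fun pieces :: "symbol \<Rightarrow> piece list"
  where
    "pieces [] = []"
  | "pieces ([a] # [c, b] # e) =
      (if b < c then PTriple a b c # pieces e else PSingle a # pieces ([c, b] # e))"
  | "pieces ([i] # e) = PSingle i # pieces e"
  | "pieces ([a, b] # e) = PPair a b # pieces e"
  | "pieces (_ # e) = pieces e"

fun z_piece :: "piece \<Rightarrow> chain"
  where
    "z_piece (PSingle i) = bvec [[i]]"
  | "z_piece (PPair a b) = bvec [[a, b]] + bvec [[b, a]]"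
  | "z_piece (PTriple a b c) =
      relabel (\<lambda>i. if i = 1 then a else if i = 2 then b else c) (bd (bvec [[3, 2, 1]]))"

definition zclass :: "symbol \<Rightarrow> hclass"
  where "zclass e = hcls (foldr conc (map z_piece (pieces e)) (bvec []))"

definition singletons :: "nat list \<Rightarrow> symbol"
  where "singletons us = map (\<lambda>i. [i]) us"

definition A_set :: "nat \<Rightarrow> nat \<Rightarrow> hclass set"
  where "A_set n m = {zclass (singletons us @ [[p, q]] @ singletons vs) | us p q vs.
    length us = m \<and> distinct (us @ [p, q] @ vs) \<and> set (us @ [p, q] @ vs) = {1..n} \<and>
    sorted_wrt (>) us \<and> sorted_wrt (>) vs \<and> p > q \<and> q > last us}"

definition B_set :: "nat \<Rightarrow> nat \<Rightarrow> hclass set"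
  where "B_set n m = {zclass (singletons us @ [[p, q]] @ singletons vs) | us p q vs.
    length us = m \<and> distinct (us @ [p, q] @ vs) \<and> set (us @ [p, q] @ vs) = {1..n} \<and>
    sorted_wrt (>) us \<and> sorted_wrt (>) vs \<and> q > p}"


section \<open>High insertion maps\<close>

fun is_barrier :: "piece \<Rightarrow> bool"
  where
    "is_barrier (PSingle i) = False"
  | "is_barrier (PPair a b) = True"
  | "is_barrier (PTriple a b c) = True"

fun insert_after_barrier :: "nat \<Rightarrow> piece \<Rightarrow> piece list \<Rightarrow> piece list"
  where
    "insert_after_barrier 0 x ps = x # ps"
  | "insert_after_barrier (Suc j) x [] = [x]"
  | "insert_after_barrier (Suc j) x (p # ps) =
      p # insert_after_barrier (if is_barrier p then j else Suc j) x ps"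

definition iota :: "nat \<Rightarrow> nat \<Rightarrow> symbol \<Rightarrow> symbol"
  where "iota n j e =
    concat (map piece_symbol (insert_after_barrier j (PSingle (n + 1)) (pieces e)))"

text \<open>The linear map \<open>Hk k n \<rightarrow> Hk k (n + 1)\<close> with \<open>zclass e \<mapsto> zclass (iota n j e)\<close>, written in
  coordinates with respect to the basis of all \<open>zclass e\<close>.\<close>

definition hiota :: "nat \<Rightarrow> nat \<Rightarrow> nat \<Rightarrow> hclass \<Rightarrow> hclass"
  where "hiota k n j x = (\<Sum>e\<in>critical n k.
    hscale (HV.representation (zclass ` critical n k) x (zclass e)) (zclass (iota n j e)))"

text \<open>The submodule generated by \<open>G \<subseteq> Hk k N\<close> and the maps \<open>[\<iota>\<^sub>j]\<close> with \<open>j\<close> in the list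
  \<open>js\<close>.\<close>

definition generated :: "nat \<Rightarrow> nat list \<Rightarrow> nat \<Rightarrow> hclass set \<Rightarrow> nat \<Rightarrow> hclass set"
  where "generated k js N G n = \<Inter> {W n | W. (\<forall>i. subrep k i (W i)) \<and> G \<subseteq> W N \<and>
    (\<forall>i. \<forall>j\<in>set js. hiota k i j ` W i \<subseteq> W (Suc i))}"


section \<open>Free modules over the category of colored injections\<close>

definition lin_on :: "(rat \<Rightarrow> 'a \<Rightarrow> 'a) \<Rightarrow> (rat \<Rightarrow> 'b \<Rightarrow> 'b) \<Rightarrow>
    'a::ab_group_add set \<Rightarrow> ('a \<Rightarrow> 'b::ab_group_add) \<Rightarrow> bool"
  where "lin_on s t V T \<longleftrightarrow>
    (\<forall>x\<in>V. \<forall>y\<in>V. T (x + y) = T x + T y) \<and> (\<forall>c. \<forall>x\<in>V. T (s c x) = t c (T x))"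

text \<open>Morphisms \<open>[m] \<rightarrow> [n]\<close> of \<open>FI\<^sub>d\<close>, with colors \<open>0, \<dots>, d - 1\<close>. Both components are
  extensional, so that morphisms are equal iff they are equal as terms.\<close>

type_synonym fi_mor = "(nat \<Rightarrow> nat) \<times> (nat \<Rightarrow> nat)"

definition fi_hom :: "nat \<Rightarrow> nat \<Rightarrow> nat \<Rightarrow> fi_mor set"
  where "fi_hom d m n = {(f, g). f \<in> {1..m} \<rightarrow>\<^sub>E {1..n} \<and> inj_on f {1..m} \<and>
    g \<in> ({1..n} - f ` {1..m}) \<rightarrow>\<^sub>E {..<d}}"

text \<open>The composite of \<open>(f, g) : [n] \<rightarrow> [p]\<close> after \<open>(f', g') : [m] \<rightarrow> [n]\<close>.\<close>

definition fi_comp :: "nat \<Rightarrow> nat \<Rightarrow> nat \<Rightarrow> fi_mor \<Rightarrow> fi_mor \<Rightarrow> fi_mor"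
  where "fi_comp m n p h h' = (case (h, h') of ((f, g), (f', g')) \<Rightarrow>
    (restrict (\<lambda>x. f (f' x)) {1..m},
     restrict (\<lambda>x. if x \<notin> f ` {1..n} then g x else g' (inv_into {1..n} f x))
       ({1..p} - (\<lambda>x. f (f' x)) ` {1..m})))"

definition fi_perm :: "nat \<Rightarrow> (nat \<Rightarrow> nat) \<Rightarrow> fi_mor"
  where "fi_perm n \<sigma> = (restrict \<sigma> {1..n}, restrict \<sigma> {})"

definition fi_incl :: "nat \<Rightarrow> nat \<Rightarrow> fi_mor"
  where "fi_incl n c = (restrict (\<lambda>x. x) {1..n}, restrict (\<lambda>x. c) {n + 1})"

type_synonym fi_action = "nat \<Rightarrow> nat \<Rightarrow> fi_mor \<Rightarrow> hclass \<Rightarrow> hclass"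

definition fi_module :: "nat \<Rightarrow> (nat \<Rightarrow> hclass set) \<Rightarrow> fi_action \<Rightarrow> bool"
  where "fi_module d V F \<longleftrightarrow>
    (\<forall>n. HV.subspace (V n)) \<and>
    (\<forall>m n. \<forall>h\<in>fi_hom d m n. lin_on hscale hscale (V m) (F m n h) \<and> F m n h ` V m \<subseteq> V n) \<and>
    (\<forall>n. \<forall>x\<in>V n. F n n (fi_perm n id) x = x) \<and>
    (\<forall>m n p. \<forall>h\<in>fi_hom d n p. \<forall>h'\<in>fi_hom d m n. \<forall>x\<in>V m.
      F m p (fi_comp m n p h h') x = F n p h (F m n h' x))"

text \<open>The submodule \<open>V\<close> of \<open>Hk k\<close>, with the module structure in which permutations act by
  relabeling and the standard inclusion \<open>[n] \<rightarrow> [n + 1]\<close> with \<open>n + 1\<close> of color \<open>c\<close> acts by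
  \<open>[\<iota>\<^sub>j]\<close>, where \<open>j\<close> is entry \<open>c\<close> of \<open>js\<close>. There is at most one such structure.\<close>

definition iota_structure :: "nat \<Rightarrow> nat list \<Rightarrow> (nat \<Rightarrow> hclass set) \<Rightarrow> fi_action \<Rightarrow> bool"
  where "iota_structure k js V F \<longleftrightarrow> fi_module (length js) V F \<and>
    (\<forall>n \<sigma>. \<sigma> permutes {1..n} \<longrightarrow> (\<forall>x\<in>V n. F n n (fi_perm n \<sigma>) x = hrelabel \<sigma> x)) \<and>
    (\<forall>n. \<forall>c<length js. \<forall>x\<in>V n. F n (Suc n) (fi_incl n c) x = hiota k n (js ! c) x)"

definition is_rep :: "nat \<Rightarrow> hclass set \<Rightarrow> ((nat \<Rightarrow> nat) \<Rightarrow> hclass \<Rightarrow> hclass) \<Rightarrow> bool"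
  where "is_rep m U \<rho> \<longleftrightarrow> HV.subspace U \<and> (\<forall>x\<in>U. \<rho> id x = x) \<and>
    (\<forall>\<sigma>. \<sigma> permutes {1..m} \<longrightarrow> lin_on hscale hscale U (\<rho> \<sigma>) \<and> \<rho> \<sigma> ` U \<subseteq> U) \<and>
    (\<forall>\<sigma> \<tau>. \<sigma> permutes {1..m} \<and> \<tau> permutes {1..m} \<longrightarrow>
      (\<forall>x\<in>U. \<rho> (\<sigma> \<circ> \<tau>) x = \<rho> \<sigma> (\<rho> \<tau> x)))"

text \<open>The space \<open>\<Oplus>\<^sub>m \<rat>[Hom([m],[n])] \<otimes> U\<^sub>m\<close>, tensor product over \<open>\<rat>[S\<^sub>m]\<close>, is presented as the
  quotient of \<open>induced_gens\<close>, the formal combinations of symbols \<open>h \<otimes> u\<close>, by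
  \<open>induced_rels\<close>.\<close>

type_synonym tensor_gens = "(nat \<times> fi_mor \<times> hclass) \<Rightarrow>\<^sub>0 rat"

definition induced_gens :: "nat \<Rightarrow> (nat \<Rightarrow> hclass set) \<Rightarrow> nat \<Rightarrow> tensor_gens set"
  where "induced_gens d U n =
    {x. Poly_Mapping.keys x \<subseteq> {(m, h, u). h \<in> fi_hom d m n \<and> u \<in> U m}}"

definition induced_rels :: "nat \<Rightarrow> (nat \<Rightarrow> hclass set) \<Rightarrow>
    (nat \<Rightarrow> (nat \<Rightarrow> nat) \<Rightarrow> hclass \<Rightarrow> hclass) \<Rightarrow> nat \<Rightarrow> tensor_gens set"
  where "induced_rels d U \<rho> n = FV.span (
    {bvec (m, h, u + v) - bvec (m, h, u) - bvec (m, h, v) | m h u v.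
      h \<in> fi_hom d m n \<and> u \<in> U m \<and> v \<in> U m} \<union>
    {bvec (m, h, hscale c u) - pscale c (bvec (m, h, u)) | m h c u.
      h \<in> fi_hom d m n \<and> u \<in> U m} \<union>
    {bvec (m, fi_comp m m n h (fi_perm m \<sigma>), u) - bvec (m, h, \<rho> m \<sigma> u) | m h \<sigma> u.
      h \<in> fi_hom d m n \<and> u \<in> U m \<and> \<sigma> permutes {1..m}})"

definition induced_map :: "nat \<Rightarrow> nat \<Rightarrow> fi_mor \<Rightarrow> tensor_gens \<Rightarrow> tensor_gens"
  where "induced_map n p h = lin_ext (\<lambda>(m, h', u). bvec (m, fi_comp m n p h h', u))"

text \<open>A module is free if it is isomorphic to an induced one: \<open>\<Phi> n\<close> maps \<open>induced_gens\<close> onto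
  \<open>V n\<close> with kernel \<open>induced_rels\<close>, naturally in \<open>n\<close>. As \<open>U\<^sub>m\<close> embeds in degree \<open>m\<close> of the induced
  module, it is no restriction to realize \<open>U\<^sub>m\<close> inside the type of homology classes.\<close>

definition fi_free :: "nat \<Rightarrow> (nat \<Rightarrow> hclass set) \<Rightarrow> fi_action \<Rightarrow> bool"
  where "fi_free d V F \<longleftrightarrow> (\<exists>U \<rho> \<Phi>.
    (\<forall>m. is_rep m (U m) (\<rho> m)) \<and>
    (\<forall>n. lin_on pscale hscale (induced_gens d U n) (\<Phi> n) \<and>
      \<Phi> n ` induced_gens d U n = V n \<and>
      (\<forall>x\<in>induced_gens d U n. \<Phi> n x = 0 \<longleftrightarrow> x \<in> induced_rels d U \<rho> n)) \<and>
    (\<forall>n p. \<forall>h\<in>fi_hom d n p. \<forall>x\<in>induced_gens d U n.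
      \<Phi> p (induced_map n p h x) = F n p h (\<Phi> n x)))"

definition free_submodule :: "nat \<Rightarrow> nat list \<Rightarrow> (nat \<Rightarrow> hclass set) \<Rightarrow> bool"
  where "free_submodule k js V \<longleftrightarrow> (\<exists>F. iota_structure k js V F \<and> fi_free (length js) V F)"


section \<open>Admissible families\<close>

definition std_rep :: "nat \<Rightarrow> (nat \<Rightarrow>\<^sub>0 rat) set"
  where "std_rep n = {x. Poly_Mapping.keys x \<subseteq> {1..n} \<and> (\<Sum>i=1..n. Poly_Mapping.lookup x i) = 0}"

definition tensor :: "(nat \<Rightarrow>\<^sub>0 rat) \<Rightarrow> (nat \<Rightarrow>\<^sub>0 rat) \<Rightarrow> (nat \<times> nat \<Rightarrow>\<^sub>0 rat)"
  where "tensor x y = lin_ext (\<lambda>i. lin_ext (\<lambda>j. bvec (i, j)) y) x"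

text \<open>The exterior square of \<open>std_rep n\<close>, realized inside the tensor square by
  \<open>x \<and> y = x \<otimes> y - y \<otimes> x\<close>.\<close>

definition wedge_std :: "nat \<Rightarrow> (nat \<times> nat \<Rightarrow>\<^sub>0 rat) set"
  where "wedge_std n = FV.span {tensor x y - tensor y x | x y. x \<in> std_rep n \<and> y \<in> std_rep n}"

definition wedge_act :: "(nat \<Rightarrow> nat) \<Rightarrow> (nat \<times> nat \<Rightarrow>\<^sub>0 rat) \<Rightarrow> (nat \<times> nat \<Rightarrow>\<^sub>0 rat)"
  where "wedge_act \<sigma> = lin_ext (\<lambda>(i, j). bvec (\<sigma> i, \<sigma> j))"

definition iso_wedge_std :: "nat \<Rightarrow> hclass set \<Rightarrow> bool"
  where "iso_wedge_std n V \<longleftrightarrow> (\<exists>T. lin_on pscale hscale (wedge_std n) T \<and>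
    bij_betw T (wedge_std n) V \<and>
    (\<forall>\<sigma>. \<sigma> permutes {1..n} \<longrightarrow> (\<forall>x\<in>wedge_std n. T (wedge_act \<sigma> x) = hrelabel \<sigma> (T x))))"

definition admissible :: "(nat \<Rightarrow> nat \<Rightarrow> hclass set) \<Rightarrow> bool"
  where "admissible A' \<longleftrightarrow> (\<forall>n m. 3 \<le> n \<and> 1 \<le> m \<and> m \<le> n - 2 \<longrightarrow>
    finite (A' n m) \<and> A' n m \<subseteq> Hk 1 n \<and>
    HV.independent (A' n m) \<and> card (A' n m) = card (A_set n m) \<and>
    HV.span (B_set n 0 \<union> (\<Union>l\<in>{1..m}. A' n l \<union> B_set n l)) =
      HV.span (B_set n 0 \<union> (\<Union>l\<in>{1..m}. A_set n l \<union> B_set n l)) \<and>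
    HV.span (A' n m) = generated 1 [1] (m + 2) (HV.span (A' (m + 2) m)) n \<and>
    free_submodule 1 [1] (generated 1 [1] (m + 2) (HV.span (A' (m + 2) m))) \<and>
    iso_wedge_std (m + 2) (HV.span (A' (m + 2) m)) \<and>
    HV.span (A' (m + 2) m) \<subseteq> generated 1 [0] 3 (HV.span (A' 3 1)) (m + 2))"


section \<open>Barrier sets\<close>

text \<open>A tuple \<open>(C'\<^sub>1, \<dots>, C'\<^sub>k)\<close> is a list of kinds: \<open>KindB\<close> stands for \<open>B\<^sub>2\<close> and \<open>KindA m\<close>
  for \<open>A' (m + 2) m\<close>.\<close>

datatype kind = KindB | KindA nat

definition barrier_tuples :: "nat \<Rightarrow> kind list set"
  where "barrier_tuples k = {t. length t = k \<and> (\<forall>m. KindA m \<in> set t \<longrightarrow> 1 \<le> m)}"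

fun kind_set :: "(nat \<Rightarrow> nat \<Rightarrow> hclass set) \<Rightarrow> kind \<Rightarrow> hclass set"
  where
    "kind_set A' KindB = B_set 2 0"
  | "kind_set A' (KindA m) = A' (m + 2) m"

fun kind_degree :: "kind \<Rightarrow> nat"
  where
    "kind_degree KindB = 2"
  | "kind_degree (KindA m) = m + 2"

definition tuple_degree :: "kind list \<Rightarrow> nat"
  where "tuple_degree t = sum_list (map kind_degree t)"

text \<open>Factor \<open>j\<close> is the relabeling of \<open>xs ! j\<close> by \<open>fs ! j\<close>, which is increasing on
  \<open>{1..kind_degree (t ! j)}\<close>.\<close>

definition barrier_set :: "(nat \<Rightarrow> nat \<Rightarrow> hclass set) \<Rightarrow> kind list \<Rightarrow> hclass set"
  where "barrier_set A' t = {foldr hconc (map2 hrelabel fs xs) (hcls (bvec [])) | fs xs.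
    length fs = length t \<and> length xs = length t \<and>
    (\<forall>j<length t. xs ! j \<in> kind_set A' (t ! j) \<and>
      strict_mono_on {1..kind_degree (t ! j)} (fs ! j)) \<and>
    disjoint_family_on (\<lambda>j. (fs ! j) ` {1..kind_degree (t ! j)}) {..<length t} \<and>
    (\<Union>j<length t. (fs ! j) ` {1..kind_degree (t ! j)}) = {1..tuple_degree t}}"

text \<open>With zero-based positions, the maps \<open>[\<iota>\<^sub>j\<^sub>-\<^sub>1]\<close> for the one-based positions \<open>j\<close> of \<open>B\<^sub>2\<close>
  have as index the position of \<open>KindB\<close>. The list has length \<open>S(C') + 1\<close>.\<close>

definition barrier_maps :: "kind list \<Rightarrow> nat list"
  where "barrier_maps t = filter (\<lambda>j. t ! j = KindB) [0..<length t] @ [length t]"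

definition barrier_module ::
    "(nat \<Rightarrow> nat \<Rightarrow> hclass set) \<Rightarrow> kind list \<Rightarrow> nat \<Rightarrow> hclass set"
  where "barrier_module A' t =
    generated (length t) (barrier_maps t) (tuple_degree t) (HV.span (barrier_set A' t))"

definition internal_direct_sum :: "'i set \<Rightarrow> ('i \<Rightarrow> hclass set) \<Rightarrow> hclass set \<Rightarrow> bool"
  where "internal_direct_sum I W V \<longleftrightarrow>
    (\<forall>i\<in>I. HV.subspace (W i)) \<and> V = HV.span (\<Union>i\<in>I. W i) \<and>
    (\<forall>J x. finite J \<and> J \<subseteq> I \<and> (\<forall>i\<in>J. x i \<in> W i) \<and> (\<Sum>i\<in>J. x i) = 0 \<longrightarrow> (\<forall>i\<in>J. x i = 0))"

end

theory Submission
  imports Defs "HOL-Library.List_Lexorder"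
begin

text \<open>A symbol all of whose blocks have at most two elements is a word in letters \<open>[a]\<close> and
\<open>[a, b]\<close>, and the boundary of \<open>[a, b]\<close> is the commutator of \<open>[a]\<close> and \<open>[b]\<close>. The first step is
the theorem of Alpert that the classes of the critical symbols form a basis of homology. Match
the first ascent \<open>a|b\<close> of neighboring singletons with the block \<open>b a\<close>; this is an involution
\<open>partner\<close> whose fixed points are the critical symbols. Every symbol \<open>e\<close> gets a chain \<open>adapted e\<close>:
the product cycle if \<open>e\<close> is critical, the product cycle of the pieces before the defect followed by
the rest of \<open>e\<close> if the defect is a block, and up to sign the boundary of the chain of the partner
otherwise. In all cases the other terms of \<open>adapted e\<close> have a lexicographically larger underlying
word than \<open>e\<close>. So these chains form a basis of the chain complex, in which the boundary
is a bijection, up to scalars, from the chains of one matched half to those of the other and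
kills the remaining ones (\<open>zclass_indep\<close>, \<open>zclass_span\<close>).

Concatenation makes the homology classes into a ring in which singletons commute. A critical symbol
is, uniquely, a head (a run of singletons and the first barrier) followed by a critical symbol
with one barrier less, and its class is the product. It follows that inserting a singleton after
barrier \<open>j + 1\<close> of \<open>x * y\<close>, where \<open>x\<close> has one barrier, is \<open>x\<close> times the insertion after barrier \<open>j\<close> of
\<open>y\<close> (\<open>hins_mult_1\<close>): if \<open>x\<close> ends in singletons, they may be moved past the new one.

Now replace, in the product for a critical symbol, every head of type \<open>A\<close> by the corresponding
element of the admissible family. The equality of spans says that an element of \<open>A_set\<close> is a
combination of elements of the admissible family, of elements of \<open>B_set\<close>, and of classes
with a shorter first run; the singletons that leave the first run are absorbed by the factors that
follow. Induction on the number of barriers and on the length of the first run shows that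
the modified products still span homology (\<open>homology2_all_products\<close>). There are as many of them as
critical symbols, so they form a basis (\<open>product_class_indep\<close>), and grouping them by
the tuple of kinds of their factors gives a direct sum.

It remains to see that the products for a tuple span the corresponding barrier module
(\<open>barrier_module_products\<close>). Their span is invariant, because relabeling a generator by a permutation
amounts to acting on the admissible family by a permutation and relabeling in order, and it is
closed under the chosen insertions, which lengthen a free run of singletons. Conversely, a product
with a singleton in a free run is an insertion after a transposition that makes this singleton the
largest label, and a product without one belongs to the barrier set.\<close>

abbreviation keys where "keys \<equiv> Poly_Mapping.keys"
abbreviation lookup where "lookup \<equiv> Poly_Mapping.lookup"

section \<open>Linear algebra\<close>

context vector_space
begin

lemma span_image_sum:
  assumes "finite E"
  shows "span (v ` E) = {\<Sum>e\<in>E. scale (a e) (v e) | a. True}" (is "_ = ?R")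
proof
  have "subspace ?R"
  proof (rule subspaceI)
    show "0 \<in> ?R" by (rule CollectI, rule exI[of _ "\<lambda>_. 0"]) simp
  next
    fix x y assume "x \<in> ?R" "y \<in> ?R"
    then obtain a b where "x = (\<Sum>e\<in>E. scale (a e) (v e))" "y = (\<Sum>e\<in>E. scale (b e) (v e))"
      by blast
    then show "x + y \<in> ?R"
      by (intro CollectI exI[of _ "\<lambda>e. a e + b e"]) (simp add: scale_left_distrib sum.distrib)
  next
    fix c x assume "x \<in> ?R"
    then obtain a where "x = (\<Sum>e\<in>E. scale (a e) (v e))" by blast
    then show "scale c x \<in> ?R"
      by (intro CollectI exI[of _ "\<lambda>e. c * a e"]) (simp add: scale_sum_right)
  qed
  moreover have "v ` E \<subseteq> ?R"
  proof
    fix x assume "x \<in> v ` E"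
    then obtain e where e: "e \<in> E" "x = v e" by blast
    have "(\<Sum>f\<in>E. scale (if f = e then 1 else 0) (v f)) = (\<Sum>f\<in>E. if f = e then v f else 0)"
      by (rule sum.cong) auto
    then show "x \<in> ?R"
      using e assms by (intro CollectI exI[of _ "\<lambda>f. if f = e then 1 else 0"]) simp
  qed
  ultimately show "span (v ` E) \<subseteq> ?R" by (intro span_minimal)
  show "?R \<subseteq> span (v ` E)"
    by (auto intro!: span_sum[of E] span_scale intro: span_base)
qed

definition indep_family :: "('i \<Rightarrow> 'b) \<Rightarrow> 'i set \<Rightarrow> bool"
  where "indep_family v E \<longleftrightarrow> (\<forall>a. (\<Sum>e\<in>E. scale (a e) (v e)) = 0 \<longrightarrow> (\<forall>e\<in>E. a e = 0))"

lemma indep_family_inj: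
  assumes "finite E" "local.indep_family v E"
  shows "inj_on v E"
proof (rule inj_onI, rule ccontr)
  fix e f assume ef: "e \<in> E" "f \<in> E" "v e = v f" "e \<noteq> f"
  let ?a = "\<lambda>g. if g = e then 1 :: 'a else if g = f then - 1 else 0"
  have "(\<Sum>g\<in>E. scale (?a g) (v g)) = (\<Sum>g\<in>{e, f}. scale (?a g) (v g))"
    using assms(1) ef by (intro sum.mono_neutral_right) auto
  also have "\<dots> = 0" using ef by simp
  finally have "?a e = 0" using assms(2) ef(1) unfolding local.indep_family_def by fastforce
  then show False by simp
qed

lemma indep_family_independent:
  assumes "finite E" "local.indep_family v E"
  shows "independent (v ` E)"
proof -
  have inj: "inj_on v E" using assms by (rule local.indep_family_inj)
  show ?thesis
  proof (subst independent_explicit_finite_subsets, intro allI impI ballI)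
    fix S u s assume S: "S \<subseteq> v ` E" "finite S" "(\<Sum>s\<in>S. scale (u s) s) = 0" "s \<in> S"
    define F where "F = {e \<in> E. v e \<in> S}"
    have im: "S = v ` F" using S(1) by (auto simp: F_def)
    have F: "F \<subseteq> E" by (auto simp: F_def)
    let ?a = "\<lambda>e. if e \<in> F then u (v e) else 0"
    have "(\<Sum>e\<in>E. scale (?a e) (v e)) = (\<Sum>e\<in>F. scale (?a e) (v e))"
      using assms(1) F by (intro sum.mono_neutral_right) auto
    also have "\<dots> = (\<Sum>e\<in>F. scale (u (v e)) (v e))" by (rule sum.cong) auto
    also have "\<dots> = (\<Sum>s\<in>S. scale (u s) s)"
      unfolding im using inj_on_subset[OF inj F] by (simp add: sum.reindex)
    finally have "\<forall>e\<in>E. ?a e = 0"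
      using assms(2) S(3) unfolding local.indep_family_def by fastforce
    then show "u s = 0" using S(4) im F by fastforce
  qed
qed

lemma independent_image_indep_family:
  assumes "finite E" "inj_on v E" "independent (v ` E)"
  shows "local.indep_family v E"
  unfolding local.indep_family_def
proof (intro allI impI ballI)
  fix a e assume s: "(\<Sum>e\<in>E. scale (a e) (v e)) = 0" and e: "e \<in> E"
  let ?u = "\<lambda>x. a (inv_into E v x)"
  have "(\<Sum>x\<in>v ` E. scale (?u x) x) = (\<Sum>e\<in>E. scale (a e) (v e))"
    using assms(2) by (simp add: sum.reindex)
  then have "?u (v e) = 0"
    using independentD[OF assms(3), of "v ` E" ?u "v e"] assms(1) s e by simp
  then show "a e = 0" using assms(2) e by simp
qed

text \<open>Independence by counting: a spanning family with at most as many members as a basis has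
is linearly independent. The modified products below are compared with the basis of critical classes
in this way, which makes it enough to prove that they span.\<close>

lemma spanning_family_indep:
  assumes fin: "finite I" "finite E"
    and v: "local.indep_family v E"
    and sub: "v ` E \<subseteq> span (w ` I)" "w ` I \<subseteq> span (v ` E)"
    and card: "card I \<le> card E"
  shows "local.indep_family w I"
proof -
  have B: "independent (v ` E)" "card (v ` E) = card E"
    using local.indep_family_independent[OF fin(2) v] card_image[OF local.indep_family_inj[OF fin(2) v]]
    by auto
  obtain W where W: "W \<subseteq> w ` I" "independent W" "w ` I \<subseteq> span W"
    using maximal_independent_subset by blast
  have sp: "span W = span (w ` I)"
    using W by (metis span_mono span_span subset_antisym)
  also have "\<dots> = span (v ` E)"
    using sub by (metis span_mono span_span subset_antisym)
  finally obtain f where "bij_betw f W (v ` E)"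
    using bij_if_span_eq_span_bases[OF W(2) B(1)] by blast
  then have cW: "card W = card E" using B(2) bij_betw_same_card by fastforce
  have "card (w ` I) \<le> card I" using fin(1) by (rule card_image_le)
  then have *: "W = w ` I"
    using W(1) cW card fin(1) by (intro card_seteq) auto
  then have "card (w ` I) = card I"
    using \<open>card (w ` I) \<le> card I\<close> cW card by simp
  then have "inj_on w I" using fin(1) by (intro eq_card_imp_inj_on)
  then show ?thesis
    using local.independent_image_indep_family[OF fin(1)] W(2) * by blast
qed

end

text \<open>Among the indices with nonzero coefficient take one with the smallest key: its basis vector occurs
in no other term of the combination.\<close>

lemma triangular_independent:
  fixes v :: "'a \<Rightarrow> 'a \<Rightarrow>\<^sub>0 rat" and key :: "'a \<Rightarrow> 'k::linorder"
  assumes fin: "finite E"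
    and tri: "\<And>e. e \<in> E \<Longrightarrow> keys (v e - bvec e) \<subseteq> {f \<in> E. key e < key f}"
  shows "FV.indep_family v E"
  unfolding FV.indep_family_def
proof (intro allI impI ballI, rule ccontr)
  fix a e assume s: "(\<Sum>e\<in>E. pscale (a e) (v e)) = 0" and e: "e \<in> E" "a e \<noteq> 0"
  let ?D = "{e \<in> E. a e \<noteq> 0}"
  define m where "m = arg_min_on key ?D"
  have D: "finite ?D" "?D \<noteq> {}" using fin e by auto
  have m: "m \<in> E" "a m \<noteq> 0" using arg_min_if_finite(1)[OF D, of key] by (auto simp: m_def)
  have min: "\<not> key e < key m" if "e \<in> ?D" for e
    using arg_min_if_finite(2)[OF D, of key] that by (auto simp: m_def)
  have off: "a e * lookup (v e) m = 0" if "e \<in> E" "e \<noteq> m" for e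
  proof (rule ccontr)
    assume "a e * lookup (v e) m \<noteq> 0"
    then have ae: "a e \<noteq> 0" "lookup (v e) m \<noteq> 0" by auto
    then have "m \<in> keys (v e - bvec e)"
      using that by (simp add: in_keys_iff lookup_minus lookup_single when_def)
    then have "key e < key m" using tri[OF that(1)] by auto
    then show False using min ae that by auto
  qed
  have "m \<notin> keys (v m - bvec m)" using tri[OF m(1)] by auto
  then have one: "lookup (v m) m = 1"
    by (simp add: in_keys_iff lookup_minus lookup_single)
  have "0 = lookup (\<Sum>e\<in>E. pscale (a e) (v e)) m" using s by simp
  also have "\<dots> = (\<Sum>e\<in>E. a e * lookup (v e) m)" by (simp add: lookup_sum)
  also have "\<dots> = (\<Sum>e\<in>{m}. a e * lookup (v e) m)"
    using fin m(1) off by (intro sum.mono_neutral_right) auto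
  finally show False using one m(2) by simp
qed

lemma poly_mapping_sum_bvec:
  fixes x :: "'a \<Rightarrow>\<^sub>0 rat"
  shows "x = (\<Sum>i\<in>keys x. pscale (lookup x i) (bvec i))"
  by (rule poly_mapping_eqI) (simp add: lookup_sum lookup_single when_def in_keys_iff)

text \<open>Going down from the largest key, each basis vector is \<open>v e\<close> minus vectors already obtained.\<close>

lemma triangular_spanning:
  fixes v :: "'a \<Rightarrow> 'a \<Rightarrow>\<^sub>0 rat" and key :: "'a \<Rightarrow> 'k::linorder"
  assumes fin: "finite E"
    and tri: "\<And>e. e \<in> E \<Longrightarrow> keys (v e - bvec e) \<subseteq> {f \<in> E. key e < key f}"
    and x: "keys x \<subseteq> E"
  shows "x \<in> FV.span (v ` E)"
proof -
  have sp: "y \<in> FV.span (v ` E)" if "\<And>i. i \<in> keys y \<Longrightarrow> bvec i \<in> FV.span (v ` E)" for y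
  proof -
    have "(\<Sum>i\<in>keys y. pscale (lookup y i) (bvec i)) \<in> FV.span (v ` E)"
      by (intro FV.span_sum FV.span_scale that)
    then show ?thesis using poly_mapping_sum_bvec[of y] by simp
  qed
  have "bvec e \<in> FV.span (v ` E)" if "e \<in> E" for e
    using that
  proof (induction "card {f \<in> E. key e < key f}" arbitrary: e rule: less_induct)
    case less
    have "v e - bvec e \<in> FV.span (v ` E)"
    proof (rule sp)
      fix f assume "f \<in> keys (v e - bvec e)"
      then have f: "f \<in> E" "key e < key f" using tri less.prems by auto
      then have "{g \<in> E. key f < key g} \<subset> {g \<in> E. key e < key g}" by auto
      then show "bvec f \<in> FV.span (v ` E)"
        using fin f by (intro less.hyps psubset_card_mono) auto
    qed
    moreover have "v e \<in> FV.span (v ` E)" using less.prems by (intro FV.span_base) auto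
    ultimately have "v e - (v e - bvec e) \<in> FV.span (v ` E)" by (rule FV.span_diff[rotated])
    then show ?case by simp
  qed
  then show ?thesis using x by (blast intro: sp[of x])
qed

section \<open>Symbols and boundaries\<close>

lemma lin_ext_bvec [simp]: "lin_ext bvec x = x"
  by (rule poly_mapping_eqI)
    (simp add: lin_ext_def lookup_sum lookup_single when_def in_keys_iff)

lemma labels_simps [simp]:
  "labels [] = {}" "labels (g # e) = set g \<union> labels e" "labels (e @ f) = labels e \<union> labels f"
  by (auto simp: labels_def)

lemma cells2_Nil [simp]: "[] \<in> cells2 S \<longleftrightarrow> S = {}"
  by (auto simp: cells2_def cells_def)

lemma cells2_Cons:
  "g # e \<in> cells2 S \<longleftrightarrow> g \<noteq> [] \<and> length g \<le> 2 \<and> distinct g \<and> set g \<subseteq> S \<and> e \<in> cells2 (S - set g)"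
  by (auto simp: cells2_def cells_def) (auto simp: labels_def)

lemma cells2_append_disjoint:
  "e \<in> cells2 S \<Longrightarrow> f \<in> cells2 T \<Longrightarrow> S \<inter> T = {} \<Longrightarrow> e @ f \<in> cells2 (S \<union> T)"
  by (auto simp: cells2_def cells_def labels_def)

lemma cells2_labels: "e \<in> cells2 S \<Longrightarrow> labels e = S"
  by (simp add: cells2_def cells_def)

lemma finite_labels [simp]: "finite (labels e)"
  by (simp add: labels_def)

lemma cells2_length_concat: "e \<in> cells2 S \<Longrightarrow> length (concat e) = card S"
  using distinct_card[of "concat e"] by (simp add: cells2_def cells_def labels_def)

lemma length_le_concat: "e \<in> cells2 S \<Longrightarrow> length e \<le> length (concat e)"
proof (induction e arbitrary: S)
  case (Cons g e)
  then show ?case by (cases g) (force simp: cells2_Cons)+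
qed simp

lemma cdim_length: "e \<in> cells2 S \<Longrightarrow> cdim e + length e = card S"
  using length_le_concat[of e S] cells2_length_concat[of e S] by (simp add: cdim_def)

lemma finite_cells2: "finite S \<Longrightarrow> finite (cells2 S)"
proof -
  assume S: "finite S"
  have "cells2 S \<subseteq> {e. set e \<subseteq> {b. set b \<subseteq> S \<and> length b \<le> 2} \<and> length e \<le> card S}"
  proof
    fix e assume e: "e \<in> cells2 S"
    then have "length e \<le> card S" using cdim_length by force
    then show "e \<in> {e. set e \<subseteq> {b. set b \<subseteq> S \<and> length b \<le> 2} \<and> length e \<le> card S}"
      using e by (auto simp: cells2_def cells_def labels_def)
  qed
  moreover have "finite \<dots>"
    using S by (intro finite_lists_length_le)
  ultimately show ?thesis
    by (rule finite_subset)
qed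

lemma conc_bvec [simp]:
  "conc (bvec e) (bvec f) = (if labels e \<inter> labels f = {} then bvec (e @ f) else 0)"
  by (simp add: conc_def)

lemma conc_scale:
  "conc (pscale c x) y = pscale c (conc x y)" "conc x (pscale c y) = pscale c (conc x y)"
  by (simp_all add: conc_def lin_ext_scale lin_ext_fun_scale)

lemma conc_uminus: "conc (- x) y = - conc x y" "conc x (- y) = - conc x y"
  using conc_scale(1)[of "-1" x y] conc_scale(2)[of x "-1" y] by auto

lemma keys_conc_subset:
  "keys (conc x y) \<subseteq> {e @ f | e f. e \<in> keys x \<and> f \<in> keys y \<and> labels e \<inter> labels f = {}}"
  unfolding conc_def
  by (intro keys_lin_ext) (auto split: if_splits)

lemma bd_bvec [simp]: "bd (bvec e) = bd_symbol e"
  by (simp add: bd_def)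

lemma bd_uminus [simp]: "bd (- x) = - bd x"
  by (simp add: bd_def lin_ext_uminus)

lemma splits_length:
  "(u, v) \<in> splits g \<Longrightarrow> u \<noteq> [] \<and> v \<noteq> [] \<and> length u + length v = length g"
  by (auto simp: splits_def dest: length_shuffles)

lemma bd_block_single [simp]: "bd_block [a] = 0"
proof -
  have "splits [a] = {}"
  proof (intro equals0I)
    fix p assume "p \<in> splits [a]"
    then obtain u v where "(u, v) \<in> splits [a]" by (cases p) auto
    then show False using splits_length by (cases u; cases v) fastforce+
  qed
  then show ?thesis by (simp add: bd_block_def)
qed

text \<open>In a word with distinct letters a rearrangement determines its permutation, so the sign can be read
off from any witness.\<close>

lemma word_sign_eq:
  assumes "distinct g" "p permutes {..<length g}" "permute_list p g = w"
  shows "word_sign g w = sign p"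
proof -
  have "(THE p. p permutes {..<length g} \<and> permute_list p g = w) = p"
  proof (rule the_equality)
    fix q assume q: "q permutes {..<length g} \<and> permute_list q g = w"
    show "q = p"
    proof
      fix i
      show "q i = p i"
      proof (cases "i < length g")
        case True
        then have "g ! q i = g ! p i"
          using q assms(2,3) permute_list_nth[of q g i] permute_list_nth[of p g i] by simp
        moreover have "q i < length g" "p i < length g"
          using True permutes_in_image[of q] permutes_in_image[of p] q assms(2) by fastforce+
        ultimately show ?thesis using assms(1) nth_eq_iff_index_eq by blast
      next
        case False
        then show ?thesis
          using permutes_not_in[of q "{..<length g}" i] permutes_not_in[of p "{..<length g}" i]
            q assms(2) by simp
      qed
    qed
  qed (use assms in auto)
  then show ?thesis by (simp add: word_sign_def)
qed

lemma word_sign_refl: "distinct g \<Longrightarrow> word_sign g g = 1"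
  by (subst word_sign_eq[of _ id]) (auto simp: permutes_id)

lemma bd_block_pair:
  assumes "a \<noteq> b"
  shows "bd_block [a, b] = bvec [[a], [b]] - bvec [[b], [a]]"
proof -
  have "splits [a, b] = {([a], [b]), ([b], [a])}"
  proof (intro equalityI subsetI)
    fix p assume p: "p \<in> splits [a, b]"
    then obtain u v where uv: "p = (u, v)" "u \<noteq> []" "v \<noteq> []" "length u + length v = 2"
      using splits_length by (cases p) fastforce
    then obtain x y where "u = [x]" "v = [y]"
      by (cases u; cases v; auto)
    then show "p \<in> {([a], [b]), ([b], [a])}" using p uv by (auto simp: splits_def)
  qed (auto simp: splits_def)
  moreover have "word_sign [a, b] [b, a] = -1"
    using assms
    by (subst word_sign_eq[of _ "transpose 0 1"])
      (auto simp: permute_list_def sign_swap_id intro!: permutes_swap_id)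
  ultimately show ?thesis
    using assms by (simp add: bd_block_def word_sign_refl single_uminus)
qed

lemma splits_321:
  "splits [3, 2, 1 :: nat] = {([3], [2, 1]), ([2], [3, 1]), ([1], [3, 2]),
    ([3, 2], [1]), ([3, 1], [2]), ([2, 1], [3])}"
proof (intro equalityI subsetI)
  fix p assume p: "p \<in> splits [3, 2, 1 :: nat]"
  then obtain u v where uv: "p = (u, v)" "u \<noteq> []" "v \<noteq> []" "length u + length v = 3"
    using splits_length by (cases p) fastforce
  then consider "length u = 1" "length v = 2" | "length u = 2" "length v = 1"
    by (cases u; cases v; cases "tl u"; cases "tl v"; auto)
  then show "p \<in> {([3], [2, 1]), ([2], [3, 1]), ([1], [3, 2]),
    ([3, 2], [1]), ([3, 1], [2]), ([2, 1], [3])}"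
  proof cases
    case 1
    then obtain x y z where "u = [x]" "v = [y, z]"
      by (auto simp: length_Suc_conv numeral_2_eq_2)
    then show ?thesis using p uv by (auto simp: splits_def)
  next
    case 2
    then obtain x y z where "u = [y, z]" "v = [x]"
      by (auto simp: length_Suc_conv numeral_2_eq_2)
    then show ?thesis using p uv by (auto simp: splits_def)
  qed
qed (auto simp: splits_def)

lemma word_sign_321:
  "word_sign [3, 2, 1 :: nat] [2, 3, 1] = -1" "word_sign [3, 2, 1 :: nat] [1, 3, 2] = 1"
  "word_sign [3, 2, 1 :: nat] [3, 1, 2] = -1" "word_sign [3, 2, 1 :: nat] [2, 1, 3] = 1"
  "word_sign [3, 2, 1 :: nat] [3, 2, 1] = 1"
proof -
  have upt: "[0..<length [3, 2, 1 :: nat]] = [0, 1, 2]" by (simp add: upt_rec)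
  have tr: "transpose i j permutes {..<length [3, 2, 1 :: nat]}" if "i < 3" "j < 3" for i j
    using that by (intro permutes_swap_id) auto
  show "word_sign [3, 2, 1 :: nat] [2, 3, 1] = -1"
    by (subst word_sign_eq[of _ "transpose 0 1"])
      (use tr[of 0 1] in \<open>auto simp: permute_list_def upt sign_swap_id transpose_def\<close>)
  show "word_sign [3, 2, 1 :: nat] [3, 1, 2] = -1"
    by (subst word_sign_eq[of _ "transpose 1 2"])
      (use tr[of 1 2] in \<open>auto simp: permute_list_def upt sign_swap_id transpose_def\<close>)
  have c: "sign (transpose i j \<circ> transpose k l) = (1::int)" if "i \<noteq> j" "k \<noteq> l" for i j k l :: nat
    using that by (simp add: sign_compose permutation_swap_id sign_swap_id)
  show "word_sign [3, 2, 1 :: nat] [1, 3, 2] = 1"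
    \<comment> \<open>the 3-cycles are written as products of two transpositions\<close>
    by (subst word_sign_eq[of _ "transpose 0 1 \<circ> transpose 0 2"])
      (use permutes_compose[OF tr[of 0 2] tr[of 0 1]] c[of 0 1 0 2] in
        \<open>auto simp: permute_list_def upt transpose_def\<close>)
  show "word_sign [3, 2, 1 :: nat] [2, 1, 3] = 1"
    by (subst word_sign_eq[of _ "transpose 0 1 \<circ> transpose 1 2"])
      (use permutes_compose[OF tr[of 1 2] tr[of 0 1]] c[of 0 1 1 2] in
        \<open>auto simp: permute_list_def upt transpose_def\<close>)
  show "word_sign [3, 2, 1 :: nat] [3, 2, 1] = 1" by (rule word_sign_refl) simp
qed

lemma z_triple:
  assumes "distinct [a, b, c]"
  shows "z_piece (PTriple a b c) = bvec [[a], [c, b]] - bvec [[b], [c, a]] + bvec [[c], [b, a]]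
    + bvec [[c, b], [a]] - bvec [[c, a], [b]] + bvec [[b, a], [c]]"
proof -
  have "bd (bvec [[3, 2, 1 :: nat]]) = bd_block [3, 2, 1]" by simp
  also have "\<dots> = bvec [[3], [2, 1]] - bvec [[2], [3, 1]] + bvec [[1], [3, 2]]
    + bvec [[3, 2], [1]] - bvec [[3, 1], [2]] + bvec [[2, 1], [3]]"
    by (simp add: bd_block_def splits_321 word_sign_321 single_uminus del: One_nat_def)
  finally show ?thesis
    using assms
    by (simp add: relabel_def lin_ext_add lin_ext_diff inj_on_def)
qed

lemma bd_z_piece:
  assumes "distinct (concat (piece_symbol p))"
  shows "bd (z_piece p) = 0"
proof (cases p)
  case (PTriple a b c)
  then have "distinct [a, b, c]" using assms by auto
  then show ?thesis
    unfolding PTriple z_triple[OF \<open>distinct [a, b, c]\<close>]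
    by (simp add: bd_block_pair lin_ext_diff)
qed (use assms in \<open>auto simp: bd_block_pair lin_ext_diff\<close>)

text \<open>By the Leibniz rule \<open>bd_conc\<close> this reduces to a single block; the mixed terms cancel because \<open>grade\<close>
anticommutes with the boundary.\<close>

lemma bd_bd_symbol:
  assumes "e \<in> cells2 S"
  shows "bd (bd_symbol e) = 0"
  using assms
proof (induction e arbitrary: S)
  case (Cons g e)
  then have g: "g \<noteq> []" "length g \<le> 2" "distinct g" and e: "e \<in> cells2 (S - set g)"
    by (auto simp: cells2_Cons)
  have "bd (bd (bvec [g])) = 0"
  proof (cases "length g = 1")
    case True
    then obtain a where "g = [a]" by (auto simp: length_Suc_conv)
    then show ?thesis by simp
  next
    case False
    then obtain a b where "g = [a, b]" "a \<noteq> b"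
      using g by (cases g; cases "tl g"; auto)
    then show ?thesis by (simp add: bd_block_pair)
  qed
  moreover have "bvec (g # e) = conc (bvec [g]) (bvec e)"
    using cells2_labels[OF e] by simp
  ultimately have "bd (bd (bvec (g # e))) = conc (grade (grade (bvec [g]))) (bd (bd (bvec e)))"
    by (simp only: bd_conc bd_simps bd_grade conc_uminus conc_simps) simp
  then show ?case using Cons.IH[OF e] by (simp add: conc_simps)
qed simp

section \<open>A matching on symbols\<close>

text \<open>The matching acts at the first defect from the left, that is, an ascent \<open>a|b\<close> of two singletons or
a decreasing block that does not follow a smaller singleton. The ascent \<open>a|b\<close> is exchanged with the
block \<open>b a\<close>. If this block stands at a first defect, a singleton before it is larger than \<open>a\<close>, so
that splitting the block creates no earlier ascent. Of two partners the one with the block, which has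
fewer blocks and the higher dimension, is called upper and the other one lower.\<close>

fun partner :: "symbol \<Rightarrow> symbol"
  where
    "partner [] = []"
  | "partner [[a]] = [[a]]"
  | "partner ([a] # [b] # e) =
      (if a < b then [b, a] # e else [a] # partner ([b] # e))"
  | "partner ([a] # [c, b] # e) =
      (if a < b \<and> b < c then [a] # [c, b] # partner e else [a] # partner ([c, b] # e))"
  | "partner ([a, b] # e) = (if b < a then [b] # [a] # e else [a, b] # partner e)"
  | "partner e = e"

text \<open>The pieces before the first defect contribute their cycles. A decreasing block at the defect
is kept, together with everything after it, as a plain symbol; an ascent is replaced by the boundary
of what belongs to its partner. The sign makes the coefficient of the symbol itself equal to 1.\<close>

fun adapted :: "symbol \<Rightarrow> chain"
  where
    "adapted [] = bvec []"
  | "adapted [[a]] = conc (z_piece (PSingle a)) (bvec [])"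
  | "adapted ([a] # [b] # e) =
      (if a < b then - bd (bvec ([b, a] # e)) else conc (z_piece (PSingle a)) (adapted ([b] # e)))"
  | "adapted ([a] # [c, b] # e) =
      (if a < b \<and> b < c then conc (z_piece (PTriple a b c)) (adapted e)
       else conc (z_piece (PSingle a)) (adapted ([c, b] # e)))"
  | "adapted ([a, b] # e) =
      (if b < a then bvec ([a, b] # e) else conc (z_piece (PPair a b)) (adapted e))"
  | "adapted e = bvec e"

text \<open>Induction along the recursion of \<open>partner\<close> and \<open>adapted\<close>. In the case of a singleton
before a two-element block both tails are needed, since the singleton may or may not form a piece with
that block.\<close>

lemma symbol_induct [consumes 1, case_names Nil Single Singles Single_Pair Pair]:
  assumes "e \<in> cells2 S"
    and "\<And>S. [] \<in> cells2 S \<Longrightarrow> P [] S"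
    and "\<And>a S. [[a]] \<in> cells2 S \<Longrightarrow> P [[a]] S"
    and "\<And>a b e S. [a] # [b] # e \<in> cells2 S \<Longrightarrow> [b] # e \<in> cells2 (S - {a}) \<Longrightarrow> a \<in> S \<Longrightarrow>
      a \<noteq> b \<Longrightarrow> P ([b] # e) (S - {a}) \<Longrightarrow> P ([a] # [b] # e) S"
    and "\<And>a c b e S. [a] # [c, b] # e \<in> cells2 S \<Longrightarrow> [c, b] # e \<in> cells2 (S - {a}) \<Longrightarrow>
      e \<in> cells2 (S - {a, b, c}) \<Longrightarrow> {a, b, c} \<subseteq> S \<Longrightarrow> distinct [a, b, c] \<Longrightarrow>
      P ([c, b] # e) (S - {a}) \<Longrightarrow> P e (S - {a, b, c}) \<Longrightarrow> P ([a] # [c, b] # e) S"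
    and "\<And>a b e S. [a, b] # e \<in> cells2 S \<Longrightarrow> e \<in> cells2 (S - {a, b}) \<Longrightarrow> {a, b} \<subseteq> S \<Longrightarrow>
      a \<noteq> b \<Longrightarrow> P e (S - {a, b}) \<Longrightarrow> P ([a, b] # e) S"
  shows "P e S"
  using assms(1)
proof (induction e arbitrary: S rule: length_induct)
  case (1 e)
  have IH: "P f T" if "length f < length e" "f \<in> cells2 T" for f T
    using 1(1) that by blast
  have block: "(\<exists>a. g = [a]) \<or> (\<exists>a b. g = [a, b])" if "g # f \<in> cells2 T" for g f T
    using that by (cases g; cases "tl g"; cases "tl (tl g)") (auto simp: cells2_Cons)
  show ?case
  proof (cases e)
    case Nil
    then show ?thesis using assms(2) 1(2) by blast
  next
    case (Cons g r)
    have r: "r \<in> cells2 (S - set g)" using 1(2) Cons by (simp add: cells2_Cons)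
    from block[of g r S] 1(2) Cons
    consider a where "g = [a]" "r = []" | a b where "g = [a, b]"
      | a h q where "g = [a]" "r = h # q"
      by (cases r) auto
    then show ?thesis
    proof cases
      case 1
      then show ?thesis using assms(3) \<open>e \<in> cells2 S\<close> Cons by blast
    next
      case (2 a b)
      have "P r (S - {a, b})" using r 2 Cons by (intro IH) auto
      then show ?thesis
        using assms(6)[of a b r S] r 2 Cons \<open>e \<in> cells2 S\<close> by (auto simp: cells2_Cons)
    next
      case (3 a h q)
      have "(\<exists>b. h = [b]) \<or> (\<exists>c b. h = [c, b])" using block[of h q] r 3 by auto
      then show ?thesis
      proof (elim disjE exE)
        fix b assume "h = [b]"
        moreover have "P r (S - {a})" using r 3 Cons by (intro IH) auto
        ultimately show ?thesis
          using assms(4)[of a b q S] r 3 Cons \<open>e \<in> cells2 S\<close> by (auto simp: cells2_Cons)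
      next
        fix c b assume h: "h = [c, b]"
        have S: "S - {a} - set [c, b] = S - {a, b, c}" by auto
        have q: "q \<in> cells2 (S - {a, b, c})"
          using r 3 h S unfolding 3 h cells2_Cons by simp
        have "P r (S - {a})" using r 3 Cons by (intro IH) auto
        moreover have "P q (S - {a, b, c})" using q 3 Cons by (intro IH) auto
        ultimately show ?thesis
          using assms(5)[of a c b q S] q \<open>e \<in> cells2 S\<close> r unfolding Cons 3 h
          by (fastforce simp: cells2_Cons)
      qed
    qed
  qed
qed

lemma partner_cells2: "e \<in> cells2 S \<Longrightarrow> partner e \<in> cells2 S"
proof (induction e S rule: symbol_induct)
  case (Singles a b e S)
  then show ?case by (auto simp: cells2_Cons insert_commute simp flip: Diff_insert)
next
  case (Single_Pair a c b e S)
  have "S - {a} - {c, b} = S - {a, b, c}" by auto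
  with Single_Pair show ?case by (auto simp: cells2_Cons)
next
  case (Pair a b e S)
  then show ?case by (auto simp: cells2_Cons insert_commute simp flip: Diff_insert)
qed auto

text \<open>The partner of a symbol that begins with the singleton \<open>b\<close> begins with \<open>b\<close> or with a block \<open>c b\<close>;
in both cases a larger singleton in front of it is not part of a defect.\<close>

lemma partner_single_Cons:
  assumes "[b] # e \<in> cells2 S"
  shows "(\<exists>f. partner ([b] # e) = [b] # f) \<or>
    (\<exists>c f. b < c \<and> e = [c] # f \<and> partner ([b] # e) = [c, b] # f)"
  using assms
  by (cases "[b] # e" rule: partner.cases) (auto simp: cells2_Cons)

lemma partner_partner: "e \<in> cells2 S \<Longrightarrow> partner (partner e) = e"
proof (induction e S rule: symbol_induct)
  case (Singles a b e S)
  show ?case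
  proof (cases "a < b")
    case False
    then have "b < a" using Singles by auto
    show ?thesis
      using Singles False \<open>b < a\<close>
      partner_single_Cons[OF Singles(2)] by auto
  qed simp
next
  case (Single_Pair a c b e S)
  then show ?case by (auto)
next
  case (Pair a b e S)
  then show ?case by auto
qed auto

lemma partner_length:
  "e \<in> cells2 S \<Longrightarrow> partner e = e \<or> length (partner e) = Suc (length e) \<or> length e = Suc (length (partner e))"
  by (induction e S rule: symbol_induct) auto

section \<open>Leading terms\<close>

text \<open>Symbols are compared by their underlying words. Two symbols with the same word but different
bars are not comparable, so \<open>e\<close> is required to be the only term of \<open>x\<close> with the smallest word.\<close>

definition leads :: "chain \<Rightarrow> symbol \<Rightarrow> nat set \<Rightarrow> bool"
  where "leads x e S \<longleftrightarrow> e \<in> cells2 S \<and>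
    keys (x - bvec e) \<subseteq> {f \<in> cells2 S. cdim f = cdim e \<and> concat e < concat f}"

lemma cdim_append:
  assumes "e \<in> cells2 S" "f \<in> cells2 T"
  shows "cdim (e @ f) = cdim e + cdim f"
  using length_le_concat[OF assms(1)] length_le_concat[OF assms(2)] by (simp add: cdim_def)

lemma append_less_left:
  fixes u :: "nat list"
  shows "length u = length w \<Longrightarrow> u < w \<Longrightarrow> u @ x < w @ y"
  by (induction u w rule: list_induct2) auto

lemma append_less_right:
  fixes u :: "nat list"
  shows "x < y \<Longrightarrow> u @ x < u @ y"
  by (induction u) auto

lemma leads_conc:
  assumes "leads x e S" "leads y f T" "S \<inter> T = {}"
  shows "leads (conc x y) (e @ f) (S \<union> T)"
proof -
  have e: "e \<in> cells2 S" and f: "f \<in> cells2 T" using assms by (auto simp: leads_def)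
  let ?x = "x - bvec e" and ?y = "y - bvec f"
  have kx: "s \<in> cells2 S" "cdim s = cdim e" "concat e < concat s" if "s \<in> keys ?x" for s
    using assms(1) that by (auto simp: leads_def)
  have ky: "s \<in> cells2 T" "cdim s = cdim f" "concat f < concat s" if "s \<in> keys ?y" for s
    using assms(2) that by (auto simp: leads_def)
  have ky': "s \<in> cells2 T" "cdim s = cdim f" if "s \<in> keys y" for s
  proof -
    have "keys y \<subseteq> keys ?y \<union> {f}" using keys_add[of ?y "bvec f"] by auto
    then show "s \<in> cells2 T" "cdim s = cdim f" using ky f that by auto
  qed
  let ?R = "{g \<in> cells2 (S \<union> T). cdim g = cdim (e @ f) \<and> concat (e @ f) < concat g}"
  have "conc x y - bvec (e @ f) = conc (bvec e) ?y + conc ?x y"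
    using cells2_labels[OF e] cells2_labels[OF f] assms(3) by (simp add: conc_simps)
  then have "keys (conc x y - bvec (e @ f)) \<subseteq> keys (conc (bvec e) ?y) \<union> keys (conc ?x y)"
    using keys_add[of "conc (bvec e) ?y" "conc ?x y"] by simp
  moreover have "keys (conc (bvec e) ?y) \<subseteq> ?R"
  proof
    fix g assume "g \<in> keys (conc (bvec e) ?y)"
    then obtain s where s: "g = e @ s" "s \<in> keys ?y" using keys_conc_subset[of "bvec e" ?y] by auto
    then show "g \<in> ?R"
      using ky[OF s(2)] e f assms(3)
      by (auto simp: cdim_append append_less_right intro: cells2_append_disjoint)
  qed
  moreover have "keys (conc ?x y) \<subseteq> ?R"
  proof
    fix g assume "g \<in> keys (conc ?x y)"
    then obtain s t where s: "g = s @ t" "s \<in> keys ?x" "t \<in> keys y"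
      using keys_conc_subset[of ?x y] by auto
    have "length (concat e) = length (concat s)"
      using cells2_length_concat[OF e] cells2_length_concat[OF kx(1)[OF s(2)]] by simp
    then show "g \<in> ?R"
      using kx[OF s(2)] ky'[OF s(3)] e f assms(3) s(1)
      by (auto simp: cdim_append append_less_left intro: cells2_append_disjoint)
  qed
  ultimately show ?thesis
    using e f assms(3) by (auto simp: leads_def intro: cells2_append_disjoint)
qed

lemma leads_bvec: "e \<in> cells2 S \<Longrightarrow> leads (bvec e) e S"
  by (simp add: leads_def)

lemma leads_PSingle: "leads (z_piece (PSingle a)) [[a]] {a}"
  by (auto simp: leads_def cells2_Cons)

lemma leads_PPair: "a < b \<Longrightarrow> leads (z_piece (PPair a b)) [[a, b]] {a, b}"
  by (auto simp: leads_def cells2_Cons cdim_def)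

text \<open>The smallest of the six words is \<open>a c b\<close>: no other term begins with \<open>a\<close>.\<close>

lemma leads_PTriple:
  assumes "a < b" "b < c"
  shows "leads (z_piece (PTriple a b c)) [[a], [c, b]] {a, b, c}"
proof -
  let ?R = "{f \<in> cells2 {a, b, c}. cdim f = 1 \<and> [a, c, b] < concat f}"
  have k: "keys (bvec f) \<subseteq> ?R" if "f \<in> ?R" for f using that by simp
  have m: "[[b], [c, a]] \<in> ?R" "[[c], [b, a]] \<in> ?R" "[[c, b], [a]] \<in> ?R"
    "[[c, a], [b]] \<in> ?R" "[[b, a], [c]] \<in> ?R"
    using assms by (auto simp: cells2_Cons cdim_def)
  have "z_piece (PTriple a b c) - bvec [[a], [c, b]]
      = bvec [[c], [b, a]] + bvec [[c, b], [a]] + bvec [[b, a], [c]] - bvec [[b], [c, a]] - bvec [[c, a], [b]]"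
    using assms by (subst z_triple) auto
  also have "keys \<dots> \<subseteq> ?R"
    using m by (intro order.trans[OF keys_diff_subset] order.trans[OF keys_add] Un_least k)
  finally show ?thesis
    using assms by (auto simp: leads_def cells2_Cons cdim_def)
qed

text \<open>The terms of the boundary in which the block \<open>b a\<close> survives, and the term \<open>b|a\<close>,
all have words that begin with \<open>b\<close>.\<close>

lemma leads_lower:
  assumes "[a] # [b] # e \<in> cells2 S" "a < b"
  shows "leads (- bd (bvec ([b, a] # e))) ([a] # [b] # e) S"
proof -
  have e: "e \<in> cells2 (S - {a, b})" "{a, b} \<subseteq> S"
    using assms(1) by (auto simp: cells2_Cons insert_commute simp flip: Diff_insert)
  let ?R = "{f \<in> cells2 S. cdim f = cdim ([a] # [b] # e) \<and> concat ([a] # [b] # e) < concat f}"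
  let ?d = "lin_ext (\<lambda>s. bvec ([b, a] # s)) (bd_symbol e)"
  have E: "- bd (bvec ([b, a] # e)) - bvec ([a] # [b] # e) = ?d - bvec ([b] # [a] # e)"
    using assms(2) by (simp add: bd_block_pair lin_ext_diff)
  have "keys ?d \<subseteq> ?R"
  proof (rule keys_lin_ext)
    fix s assume s: "s \<in> keys (bd_symbol e)"
    have s': "s \<in> cells2 (S - {a, b})" "cdim e = Suc (cdim s)"
      using bd_symbol_cell[OF e(1) s] by auto
    have "length e \<le> length (concat e)" using e(1) by (rule length_le_concat)
    then show "keys (bvec ([b, a] # s)) \<subseteq> ?R"
      using assms e(2) s' length_le_concat[OF s'(1)]
      by (auto simp: cells2_Cons insert_commute cdim_def)
  qed
  moreover have "keys (bvec ([b] # [a] # e)) \<subseteq> ?R"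
    using assms e by (auto simp: cells2_Cons cdim_def simp flip: Diff_insert)
  ultimately have "keys (?d - bvec ([b] # [a] # e)) \<subseteq> ?R"
    using keys_diff_subset[of ?d "bvec ([b] # [a] # e)"] by blast
  then show ?thesis unfolding leads_def E using assms(1) by blast
qed

lemma leads_adapted: "e \<in> cells2 S \<Longrightarrow> leads (adapted e) e S"
proof (induction e S rule: symbol_induct)
  case (Nil S)
  then show ?case by (simp add: leads_bvec)
next
  case (Single a S)
  then have "S = {a}" by (auto simp: cells2_Cons)
  then show ?case using leads_PSingle[of a] by simp
next
  case (Singles a b e S)
  show ?case
  proof (cases "a < b")
    case True
    then show ?thesis using leads_lower[OF Singles(1)] by simp
  next
    case False
    then show ?thesis
      using leads_conc[OF leads_PSingle Singles(5), of a] Singles(3) by (simp add: insert_absorb)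
  qed
next
  case (Single_Pair a c b e S)
  have "insert a (insert b (insert c S)) = S" using Single_Pair by auto
  then show ?case
    using leads_conc[OF leads_PTriple Single_Pair(7), of a b c]
      leads_conc[OF leads_PSingle Single_Pair(6), of a] Single_Pair(4)
    by (auto simp: insert_absorb simp del: z_piece.simps adapted.simps(5))
next
  case (Pair a b e S)
  have "insert a (insert b S) = S" using Pair by auto
  then show ?case
    using leads_conc[OF leads_PPair Pair(5), of a b] Pair(1,4) leads_bvec[OF Pair(1)]
    by (auto simp del: z_piece.simps)
qed

section \<open>Boundaries of adapted chains\<close>

text \<open>A piece is a cycle, homogeneous for \<open>grade\<close>, so concatenation with it on the left commutes with the
boundary up to sign. The dichotomy \<open>Q\<close> is carried along for the induction in \<open>bd_adapted\<close>.\<close>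

lemma bd_conc_piece:
  assumes p: "distinct (concat (piece_symbol p))"
    and x: "if Q then bd x = 0 else \<exists>c. c \<noteq> 0 \<and> bd x = pscale c y"
  shows "if Q then bd (conc (z_piece p) x) = 0
    else \<exists>c. c \<noteq> 0 \<and> bd (conc (z_piece p) x) = pscale c (conc (z_piece p) y)"
proof -
  let ?s = "(- 1) ^ length (piece_symbol p)"
  have "grade (z_piece p) = pscale ?s (z_piece p)"
  proof (cases p)
    case (PTriple a b c)
    then have "distinct [a, b, c]" using p by auto
    then show ?thesis
      unfolding PTriple z_triple[OF \<open>distinct [a, b, c]\<close>] by (simp add: grade_def lin_ext_add lin_ext_diff)
  qed (auto simp: grade_def lin_ext_add single_uminus)
  then have bd: "bd (conc (z_piece p) x) = pscale ?s (conc (z_piece p) (bd x))"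
    using bd_z_piece[OF p] by (simp add: bd_conc conc_simps conc_scale)
  show ?thesis
  proof (cases Q)
    case True
    then show ?thesis using x by (simp add: bd conc_simps)
  next
    case False
    then obtain c where "c \<noteq> 0" "bd x = pscale c y" using x by auto
    then show ?thesis using False
      by (intro if_not_P[THEN iffD2] exI[of _ "?s * c"]) (simp_all add: bd conc_scale)
  qed
qed

lemma bd_adapted:
  assumes "e \<in> cells2 S"
  shows "if length (partner e) \<le> length e then bd (adapted e) = 0
    else \<exists>c. c \<noteq> 0 \<and> bd (adapted e) = pscale c (adapted (partner e))"
  using assms
proof (induction e S rule: symbol_induct)
  case (Singles a b e S)
  show ?case
  proof (cases "a < b")
    case True
    then have "[b, a] # e \<in> cells2 S"
      using Singles by (auto simp: cells2_Cons insert_commute simp flip: Diff_insert)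
    then show ?thesis
      using True bd_bd_symbol[of "[b, a] # e" S] by (simp del: bd_symbol.simps)
  next
    case False
    then have "b < a" using Singles by auto
    have "adapted ([a] # partner ([b] # e)) = conc (z_piece (PSingle a)) (adapted (partner ([b] # e)))"
      using partner_single_Cons[OF Singles(2)] \<open>b < a\<close> by auto
    then show ?thesis
      using bd_conc_piece[OF _ Singles(5), of "PSingle a"] False
      by (simp del: z_piece.simps)
  qed
next
  case (Single_Pair a c b e S)
  show ?case
  proof (cases "a < b \<and> b < c")
    case True
    then show ?thesis
      using bd_conc_piece[OF _ Single_Pair(7), of "PTriple a b c"]
      by (simp del: z_piece.simps)
  next
    case False
    have eq: "partner ([a] # [c, b] # e) = [a] # partner ([c, b] # e)"
      "adapted ([a] # [c, b] # e) = conc (z_piece (PSingle a)) (adapted ([c, b] # e))"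
      "adapted ([a] # partner ([c, b] # e)) = conc (z_piece (PSingle a)) (adapted (partner ([c, b] # e)))"
      using False Single_Pair(5) by auto
    show ?thesis
      using bd_conc_piece[OF _ Single_Pair(6), of "PSingle a"] unfolding eq by simp
  qed
next
  case (Pair a b e S)
  show ?case
  proof (cases "b < a")
    case True
    then show ?thesis by (auto intro!: exI[of _ "-1"])
  next
    case False
    then show ?thesis
      using bd_conc_piece[OF _ Pair(5), of "PPair a b"] Pair(4) by (simp del: z_piece.simps)
  qed
qed auto

lemma adapted_critical:
  assumes "e \<in> cells2 S" "partner e = e"
  shows "adapted e = foldr conc (map z_piece (pieces e)) (bvec [])"
  using assms
proof (induction e S rule: symbol_induct)
  case (Singles a b e S)
  then show ?case by (simp split: if_splits del: z_piece.simps)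
next
  case (Single_Pair a c b e S)
  then show ?case by (auto split: if_splits simp del: z_piece.simps)
next
  case (Pair a b e S)
  then show ?case by (auto split: if_splits simp del: z_piece.simps)
qed (auto simp del: z_piece.simps)

section \<open>The basis of homology\<close>

text \<open>Critical symbols on an arbitrary label set, described as the fixed points of the matching.\<close>

definition crit :: "nat set \<Rightarrow> nat \<Rightarrow> symbol set"
  where "crit S k = {e \<in> cells2 S. partner e = e \<and> cdim e = k}"

lemma cdim_card:
  "e \<in> cells2 S \<Longrightarrow> card {i. i < length e \<and> length (e ! i) = 2} = cdim e"
proof -
  assume e: "e \<in> cells2 S"
  then have "length (concat e) = length e + length (filter (\<lambda>g. length g = 2) e)"
  proof (induction e arbitrary: S)
    case (Cons g e)
    then have "length g = 1 \<or> length g = 2" by (cases g; cases "tl g") (auto simp: cells2_Cons)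
    then show ?case using Cons by (auto simp: cells2_Cons)
  qed simp
  then show ?thesis by (simp add: cdim_def length_filter_conv_card)
qed

text \<open>Criticality is a condition on neighboring blocks, except that the first block has no predecessor
that could make it a follower.\<close>

lemma partner_fixed_iff:
  assumes "e \<in> cells2 S"
  shows "partner e = e \<longleftrightarrow>
    successively (\<lambda>g h. (length g = 1 \<and> length h = 1 \<longrightarrow> hd h < hd g) \<and>
      (\<forall>c b. h = [c, b] \<and> b < c \<longrightarrow> length g = 1 \<and> (\<forall>x\<in>set h. hd g < x))) e \<and>
    (\<forall>c b. e \<noteq> [] \<and> hd e = [c, b] \<longrightarrow> c < b)"
  (is "_ \<longleftrightarrow> successively ?R e \<and> ?H e")
  using assms
proof (induction e S rule: symbol_induct)
  case (Singles a b e S)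
  then show ?case by auto
next
  case (Single_Pair a c b e S)
  have c: "successively ?R ([c, b] # e) \<longleftrightarrow> partner e = e"
    unfolding Single_Pair(7) by (cases e) (use Single_Pair(3) in \<open>auto simp: cells2_Cons not_less_iff_gr_or_eq\<close>)
  show ?case
  proof (cases "a < b \<and> b < c")
    case True
    then show ?thesis using c by auto
  next
    case False
    then have "partner ([a] # [c, b] # e) = [a] # [c, b] # e \<longleftrightarrow> partner ([c, b] # e) = [c, b] # e"
      by simp
    also have "\<dots> \<longleftrightarrow> successively ?R ([c, b] # e) \<and> c < b"
      unfolding Single_Pair(6) by auto
    also have "\<dots> \<longleftrightarrow> successively ?R ([a] # [c, b] # e) \<and> ?H ([a] # [c, b] # e)"
      using False Single_Pair(5) by auto
    finally show ?thesis .
  qed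
next
  case (Pair a b e S)
  then show ?case by (cases e) (auto simp: cells2_Cons)
qed auto

lemma critical_crit: "critical n k = crit {1..n} k"
proof -
  have "partner e = e \<longleftrightarrow>
    (\<forall>i. Suc i < length e \<and> length (e ! i) = 1 \<and> length (e ! Suc i) = 1 \<longrightarrow>
      hd (e ! i) > hd (e ! Suc i)) \<and>
    (\<forall>i<length e. \<forall>c b. e ! i = [c, b] \<and> c > b \<longrightarrow> follower e i)" (is "_ \<longleftrightarrow> ?C1 \<and> ?C2")
    if e: "e \<in> cells2 S" for e S
  proof -
    have d: "c \<noteq> b" if "e ! i = [c, b]" "i < length e" for i c b
    proof -
      have "e ! i \<in> set e" using that(2) by simp
      then have "distinct (e ! i)"
        using e by (auto simp: cells2_def cells_def distinct_concat_iff)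
      then show ?thesis using that by auto
    qed
    have "?C2 \<longleftrightarrow> (\<forall>c b. e \<noteq> [] \<and> hd e = [c, b] \<longrightarrow> c < b) \<and>
      (\<forall>i. Suc i < length e \<longrightarrow> (\<forall>c b. e ! Suc i = [c, b] \<and> b < c \<longrightarrow>
        length (e ! i) = 1 \<and> (\<forall>x\<in>set (e ! Suc i). hd (e ! i) < x)))" (is "_ \<longleftrightarrow> ?H \<and> ?T")
    proof (intro iffI conjI)
      assume C: "?C2"
      show ?H
      proof (intro allI impI)
        fix c b assume "e \<noteq> [] \<and> hd e = [c, b]"
        then have *: "0 < length e" "e ! 0 = [c, b]" by (auto simp: hd_conv_nth)
        then have "\<not> b < c" using C by (auto simp: follower_def)
        then show "c < b" using d[of 0 c b] * by auto
      qed
      show ?T using C by (auto simp: follower_def)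
    next
      assume HT: "?H \<and> ?T"
      show ?C2
      proof (intro allI impI)
        fix i c b assume i: "i < length e" "e ! i = [c, b] \<and> c > b"
        show "follower e i"
        proof (cases i)
          case 0
          then have "e \<noteq> []" "hd e = [c, b]" using i by (auto simp: hd_conv_nth)
          then have "c < b" using HT by blast
          then show ?thesis using i by simp
        next
          case (Suc j)
          then show ?thesis using HT i by (fastforce simp: follower_def)
        qed
      qed
    qed
    then show ?thesis
      unfolding partner_fixed_iff[OF e] successively_conv_nth by blast
  qed
  then show ?thesis
    using cdim_card by (auto simp: critical_def crit_def)
qed

lemma finite_crit [simp]: "finite S \<Longrightarrow> finite (crit S k)"
  by (simp add: crit_def finite_cells2)

definition cycles :: "chain set"
  where "cycles = {x \<in> all_chains2. bd x = 0}"

lemma hcls_linear: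
  assumes "x \<in> cycles" "y \<in> cycles"
  shows "hcls (x + y) = hcls x + hcls y" "hcls (x - y) = hcls x - hcls y"
    "hcls (pscale c x) = hscale c (hcls x)"
    "x + y \<in> cycles" "x - y \<in> cycles" "pscale c x \<in> cycles"
proof -
  have xy: "x \<in> all_chains2" "bd x = 0" "y \<in> all_chains2" "bd y = 0"
    using assms by (auto simp: cycles_def)
  show "hcls (x + y) = hcls x + hcls y"
    using xy by transfer (simp add: homologous_refl_iff all_chains2_closed)
  show "hcls (x - y) = hcls x - hcls y"
    using xy by transfer (simp add: homologous_refl_iff all_chains2_closed)
  show "hcls (pscale c x) = hscale c (hcls x)"
    using xy(1,2) by transfer (simp add: homologous_refl_iff all_chains2_closed)
qed (use assms in \<open>auto simp: cycles_def all_chains2_closed\<close>)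

lemma zero_cycles [simp]: "0 \<in> cycles" "hcls 0 = 0"
  by (simp add: cycles_def all_chains2_closed) (transfer, simp add: homologous_refl_iff all_chains2_closed)

lemma hcls_sum:
  assumes "\<And>e. e \<in> E \<Longrightarrow> v e \<in> cycles"
  shows "(\<Sum>e\<in>E. pscale (a e) (v e)) \<in> cycles \<and>
    hcls (\<Sum>e\<in>E. pscale (a e) (v e)) = (\<Sum>e\<in>E. hscale (a e) (hcls (v e)))"
  using assms
  by (induction E rule: infinite_finite_induct) (auto simp: hcls_linear)

lemma hcls_boundary: "x \<in> all_chains2 \<Longrightarrow> hcls (bd x) = 0"
proof -
  assume x: "x \<in> all_chains2"
  have "0 \<in> bd ` all_chains2" by (rule image_eqI[of _ _ 0]) (simp_all add: all_chains2_closed)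
  with x show ?thesis by transfer (auto simp: homologous_def all_chains2_closed)
qed

lemma subspace_homology2: "HV.subspace (homology2 S k)"
proof (rule HV.subspaceI)
  have *: "x \<in> cycles" if "x \<in> cycles2 S k" for x
    using cycles2_all[OF that] by (simp add: cycles_def)
  show "0 \<in> homology2 S k"
    unfolding homology2_def by (rule image_eqI[of _ _ 0]) (auto simp: cycles2_def chains2_def)
  fix x y assume "x \<in> homology2 S k" "y \<in> homology2 S k"
  then obtain u v where uv: "u \<in> cycles2 S k" "v \<in> cycles2 S k" "x = hcls u" "y = hcls v"
    by (auto simp: homology2_def)
  then have "u + v \<in> cycles2 S k"
    using keys_add[of u v] by (auto simp: cycles2_def chains2_def simp del: keys_add)
  then show "x + y \<in> homology2 S k"
    using uv * by (auto simp: homology2_def hcls_linear(1)[symmetric])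
next
  have *: "x \<in> cycles" if "x \<in> cycles2 S k" for x
    using cycles2_all[OF that] by (simp add: cycles_def)
  fix c x assume "x \<in> homology2 S k"
  then obtain u where u: "u \<in> cycles2 S k" "x = hcls u"
    by (auto simp: homology2_def)
  then have "pscale c u \<in> cycles2 S k"
    using keys_pscale[of c u] by (auto simp: cycles2_def chains2_def)
  then show "hscale c x \<in> homology2 S k"
    using u hcls_linear(3)[OF *[OF u(1)] *[OF u(1)], of c] by (metis homology2_def imageI)
qed

lemma adapted_chains2: "e \<in> cells2 S \<Longrightarrow> adapted e \<in> chains2 S (cdim e)"
proof -
  assume e: "e \<in> cells2 S"
  have "keys (adapted e) \<subseteq> keys (adapted e - bvec e) \<union> {e}"
    using keys_add[of "adapted e - bvec e" "bvec e"] by auto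
  then show ?thesis
    using leads_adapted[OF e] e by (auto simp: leads_def chains2_def)
qed

lemma chains2_all: "x \<in> chains2 S k \<Longrightarrow> x \<in> all_chains2"
  by (auto simp: chains2_def all_chains2_def)

lemma adapted_cycles: "e \<in> cells2 S \<Longrightarrow> length (partner e) \<le> length e \<Longrightarrow> adapted e \<in> cycles"
  using bd_adapted[of e S] chains2_all[OF adapted_chains2, of e S] by (simp add: cycles_def)

lemma zclass_crit: "e \<in> crit S k \<Longrightarrow> zclass e = hcls (adapted e)"
  using adapted_critical[of e S] by (simp add: crit_def zclass_def)

lemma adapted_indep: "finite S \<Longrightarrow> FV.indep_family adapted (cells2 S)"
  by (rule triangular_independent[where key = concat])
    (use leads_adapted finite_cells2 in \<open>auto simp: leads_def\<close>)

lemma adapted_zero: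
  "finite S \<Longrightarrow> (\<Sum>f\<in>cells2 S. pscale (g f) (adapted f)) = 0 \<Longrightarrow> \<forall>f\<in>cells2 S. g f = 0"
  using adapted_indep[of S] unfolding FV.indep_family_def by blast

lemma adapted_spanning:
  assumes "finite S" "x \<in> chains2 S k"
  obtains a where "x = (\<Sum>e\<in>{e \<in> cells2 S. cdim e = k}. pscale (a e) (adapted e))"
proof -
  have fin: "finite {e \<in> cells2 S. cdim e = k}" using finite_cells2[OF assms(1)] by simp
  have "x \<in> FV.span (adapted ` {e \<in> cells2 S. cdim e = k})"
    by (rule triangular_spanning[where key = concat])
      (use fin assms leads_adapted in \<open>auto simp: chains2_def leads_def\<close>)
  then show ?thesis using that by (auto simp: FV.span_image_sum[OF fin])
qed

text \<open>In the adapted basis the boundary is diagonal up to the matching: the coefficient at a lower symbol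
is, up to a nonzero factor, the coefficient at its partner.\<close>

lemma bd_combination:
  assumes "finite S"
  obtains c where "\<And>e. e \<in> cells2 S \<Longrightarrow> length (partner e) < length e \<Longrightarrow> c e \<noteq> 0"
    "\<And>E a. E \<subseteq> cells2 S \<Longrightarrow> bd (\<Sum>e\<in>E. pscale (a e) (adapted e)) =
      (\<Sum>f\<in>{f \<in> cells2 S. length (partner f) < length f \<and> partner f \<in> E}.
        pscale (a (partner f) * c f) (adapted f))"
proof -
  have "\<exists>c. c \<noteq> 0 \<and> bd (adapted (partner f)) = pscale c (adapted f)"
    if "f \<in> cells2 S" "length (partner f) < length f" for f
    using bd_adapted[OF partner_cells2[OF that(1)]] that partner_partner[OF that(1)] by auto
  then obtain c where c: "\<And>f. f \<in> cells2 S \<Longrightarrow> length (partner f) < length f \<Longrightarrow>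
      c f \<noteq> 0 \<and> bd (adapted (partner f)) = pscale (c f) (adapted f)"
    by metis
  show ?thesis
  proof (rule that[of c])
    fix e assume "e \<in> cells2 S" "length (partner e) < length e"
    then show "c e \<noteq> 0" using c by blast
  next
    fix E a assume E: "E \<subseteq> cells2 S"
    then have fin: "finite E" using finite_cells2[OF assms] finite_subset by blast
    let ?U = "{e \<in> E. length e < length (partner e)}"
    let ?L = "{f \<in> cells2 S. length (partner f) < length f \<and> partner f \<in> E}"
    have zero: "bd (adapted e) = 0" if "e \<in> E - ?U" for e
      using bd_adapted[of e S] that E by auto
    have bij: "bij_betw partner ?L ?U"
      by (rule bij_betw_byWitness[where f' = partner])
        (use E partner_partner partner_cells2 in \<open>auto simp: subset_iff\<close>)
    have "bd (\<Sum>e\<in>E. pscale (a e) (adapted e)) = (\<Sum>e\<in>E. pscale (a e) (bd (adapted e)))"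
      by (simp add: bd_def lin_ext_sum lin_ext_scale)
    also have "\<dots> = (\<Sum>e\<in>?U. pscale (a e) (bd (adapted e)))"
      using fin zero by (intro sum.mono_neutral_right) auto
    also have "\<dots> = (\<Sum>f\<in>?L. pscale (a (partner f)) (bd (adapted (partner f))))"
      by (rule sum.reindex_bij_betw[OF bij, symmetric])
    also have "\<dots> = (\<Sum>f\<in>?L. pscale (a (partner f) * c f) (adapted f))"
      by (rule sum.cong) (auto simp: c)
    finally show "bd (\<Sum>e\<in>E. pscale (a e) (adapted e)) = \<dots>" .
  qed
qed

text \<open>A relation says that a combination of critical cycles is a boundary, hence a combination of adapted
chains of lower symbols; critical and lower symbols are disjoint parts of a basis.\<close>

lemma zclass_indep:
  assumes "finite S"
  shows "HV.indep_family zclass (crit S k)"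
  unfolding HV.indep_family_def
proof (intro allI impI ballI)
  fix a e assume s: "(\<Sum>e\<in>crit S k. hscale (a e) (zclass e)) = 0" and e: "e \<in> crit S k"
  let ?z = "\<Sum>e\<in>crit S k. pscale (a e) (adapted e)"
  let ?L = "{f \<in> cells2 S. length (partner f) < length f \<and> partner f \<in> {e \<in> cells2 S. cdim e = Suc k}}"
  have "(\<Sum>e\<in>crit S k. hscale (a e) (hcls (adapted e))) = 0"
    using s by (simp add: zclass_crit cong: sum.cong)
  moreover have "adapted e \<in> cycles" if "e \<in> crit S k" for e
    using that adapted_cycles[of e S] by (simp add: crit_def)
  ultimately have z: "?z \<in> cycles" "hcls ?z = 0"
    using hcls_sum[of "crit S k" adapted a] by simp_all
  have "?z \<in> chains2 S k"
  proof -
    have "keys ?z \<subseteq> (\<Union>e\<in>crit S k. keys (pscale (a e) (adapted e)))"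
      by (rule Poly_Mapping.keys_sum)
    also have "\<dots> \<subseteq> {e \<in> cells2 S. cdim e = k}"
      using adapted_chains2 keys_pscale by (fastforce simp: chains2_def crit_def)
    finally show ?thesis by (simp add: chains2_def)
  qed
  then have "?z \<in> cycles2 S k" using z by (simp add: cycles2_def cycles_def)
  then have "?z \<in> boundaries2 S k"
    using z hcls_eq_iff[of ?z S k 0] by (simp add: cycles2_def chains2_def)
  then obtain d where d: "d \<in> chains2 S (Suc k)" "?z = bd d" by (auto simp: boundaries2_def)
  obtain b where b: "d = (\<Sum>e\<in>{e \<in> cells2 S. cdim e = Suc k}. pscale (b e) (adapted e))"
    using adapted_spanning[OF assms d(1)] by blast
  obtain c where c: "\<And>e. e \<in> cells2 S \<Longrightarrow> length (partner e) < length e \<Longrightarrow> c e \<noteq> 0"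
    "\<And>E a. E \<subseteq> cells2 S \<Longrightarrow> bd (\<Sum>e\<in>E. pscale (a e) (adapted e)) =
      (\<Sum>f\<in>{f \<in> cells2 S. length (partner f) < length f \<and> partner f \<in> E}.
        pscale (a (partner f) * c f) (adapted f))"
    using bd_combination[OF assms] by blast
  have bdd: "bd d = (\<Sum>f\<in>?L. pscale (b (partner f) * c f) (adapted f))"
    unfolding b by (rule c(2)) auto
  \<comment> \<open>the coefficients of the cycle minus those of the boundary\<close>
  define g where "g = (\<lambda>f. if f \<in> crit S k then a f else if f \<in> ?L then - (b (partner f) * c f) else 0)"
  have fin: "finite (cells2 S)" using assms by (rule finite_cells2)
  have disj: "crit S k \<inter> ?L = {}" by (auto simp: crit_def)
  have "(\<Sum>f\<in>cells2 S. pscale (g f) (adapted f))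
      = (\<Sum>f\<in>crit S k \<union> ?L. pscale (g f) (adapted f))"
    using fin by (intro sum.mono_neutral_right) (auto simp: crit_def g_def)
  also have "\<dots> = (\<Sum>f\<in>crit S k. pscale (g f) (adapted f)) + (\<Sum>f\<in>?L. pscale (g f) (adapted f))"
    using fin assms disj by (intro sum.union_disjoint) auto
  also have "(\<Sum>f\<in>crit S k. pscale (g f) (adapted f)) = ?z" by (rule sum.cong) (auto simp: g_def)
  also have "(\<Sum>f\<in>?L. pscale (g f) (adapted f)) = - bd d"
    unfolding bdd sum_negf[symmetric] using disj by (intro sum.cong) (auto simp: g_def)
  finally have "(\<Sum>f\<in>cells2 S. pscale (g f) (adapted f)) = 0" using d(2) by simp
  then have "\<forall>f\<in>cells2 S. g f = 0"
    using adapted_zero[OF assms, of g] by simp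
  moreover have "e \<in> cells2 S" using e by (simp add: crit_def)
  ultimately have "g e = 0" by blast
  then show "a e = 0" using e by (simp add: g_def)
qed

lemma zclass_homology: "e \<in> crit S k \<Longrightarrow> zclass e \<in> homology2 S k"
  unfolding zclass_crit homology2_def
  using adapted_chains2[of e S] adapted_cycles[of e S]
  by (auto simp: crit_def cycles2_def cycles_def)

text \<open>A cycle has no upper symbols in its adapted expansion, and the adapted chains of lower symbols are
boundaries.\<close>

lemma zclass_span:
  assumes "finite S"
  shows "homology2 S k = HV.span (zclass ` crit S k)"
proof
  show "HV.span (zclass ` crit S k) \<subseteq> homology2 S k"
    using zclass_homology by (intro HV.span_minimal subspace_homology2) auto
  show "homology2 S k \<subseteq> HV.span (zclass ` crit S k)"
  proof
    fix h assume "h \<in> homology2 S k"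
    then obtain x where x: "h = hcls x" "x \<in> chains2 S k" "bd x = 0"
      by (auto simp: homology2_def cycles2_def)
    let ?E = "{e \<in> cells2 S. cdim e = k}"
    let ?U = "{e \<in> ?E. length e < length (partner e)}"
    let ?L = "{f \<in> cells2 S. length (partner f) < length f \<and> partner f \<in> ?E}"
    have fin: "finite (cells2 S)" using assms by (rule finite_cells2)
    obtain a where a: "x = (\<Sum>e\<in>?E. pscale (a e) (adapted e))"
      using adapted_spanning[OF assms x(2)] by blast
    obtain c where c: "\<And>e. e \<in> cells2 S \<Longrightarrow> length (partner e) < length e \<Longrightarrow> c e \<noteq> 0"
      "\<And>E a. E \<subseteq> cells2 S \<Longrightarrow> bd (\<Sum>e\<in>E. pscale (a e) (adapted e)) =
        (\<Sum>f\<in>{f \<in> cells2 S. length (partner f) < length f \<and> partner f \<in> E}.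
          pscale (a (partner f) * c f) (adapted f))"
      using bd_combination[OF assms] by blast
    define g where "g = (\<lambda>f. if f \<in> ?L then a (partner f) * c f else 0)"
    have "0 = (\<Sum>f\<in>?L. pscale (a (partner f) * c f) (adapted f))"
      using c(2)[of ?E a] x(3) a by auto
    also have "\<dots> = (\<Sum>f\<in>cells2 S. pscale (g f) (adapted f))"
      using fin by (intro sum.mono_neutral_cong_left) (auto simp: g_def)
    finally have "(\<Sum>f\<in>cells2 S. pscale (g f) (adapted f)) = 0" by (rule sym)
    then have g: "\<forall>f\<in>cells2 S. g f = 0"
      using adapted_zero[OF assms, of g] by simp
    have U: "a e = 0" if e: "e \<in> ?U" for e
    proof -
      have "partner e \<in> ?L" using e partner_cells2 partner_partner by auto
      then have "g (partner e) = 0" using g by blast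
      then have "a e * c (partner e) = 0"
        using \<open>partner e \<in> ?L\<close> e partner_partner[of e S] by (simp add: g_def)
      then show ?thesis using c(1)[of "partner e"] \<open>partner e \<in> ?L\<close> by auto
    qed
    have "x = (\<Sum>e\<in>?E - ?U. pscale (a e) (adapted e))"
      unfolding a using fin U by (intro sum.mono_neutral_right) auto
    moreover have "adapted e \<in> cycles" if "e \<in> ?E - ?U" for e
      using that adapted_cycles[of e S] by auto
    ultimately have "h = (\<Sum>e\<in>?E - ?U. hscale (a e) (hcls (adapted e)))"
      unfolding x(1) using hcls_sum[of "?E - ?U" adapted a] by simp
    also have "\<dots> \<in> HV.span (zclass ` crit S k)"
    proof (intro HV.span_sum HV.span_scale)
      fix e assume e: "e \<in> ?E - ?U"
      show "hcls (adapted e) \<in> HV.span (zclass ` crit S k)"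
      proof (cases "partner e = e")
        case True
        then have "e \<in> crit S k" using e by (auto simp: crit_def)
        then show ?thesis using zclass_crit by (metis HV.span_base imageI)
      next
        case False
        then have "length (partner e) < length e" using e partner_length[of e S] by auto
        then obtain r where r: "r \<noteq> 0" "bd (adapted (partner e)) = pscale r (adapted e)"
          using bd_adapted[OF partner_cells2, of e S] partner_partner[of e S] e by auto
        then have "adapted e = bd (pscale (1 / r) (adapted (partner e)))" by simp
        moreover have "adapted (partner e) \<in> all_chains2"
          using chains2_all[OF adapted_chains2[OF partner_cells2]] e by blast
        ultimately have "hcls (adapted e) = 0"
          using hcls_boundary all_chains2_closed(4) by metis
        then show ?thesis by (simp add: HV.span_zero)
      qed
    qed
    finally show "h \<in> HV.span (zclass ` crit S k)" .
  qed
qed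

section \<open>The ring of homology classes\<close>

lemma conc_assoc: "conc (conc x y) z = conc x (conc y z)"
proof -
  let ?P = "\<lambda>e f. if labels e \<inter> labels f = {} then bvec (e @ f) else 0 :: chain"
  have eq: "lin_ext (\<lambda>u. lin_ext (?P u) z) (?P e f) = lin_ext (\<lambda>g. lin_ext (?P e) (?P f g)) z"
    for e f
  proof (cases "labels e \<inter> labels f = {}")
    case True
    then show ?thesis
      by (auto intro!: lin_ext_cong)
  next
    case False
    then have "lin_ext (\<lambda>g. lin_ext (?P e) (?P f g)) z = lin_ext (\<lambda>g. 0) z"
      by (intro lin_ext_cong) auto
    then show ?thesis using False by simp
  qed
  show ?thesis
    unfolding conc_def lin_ext_lin_ext by (intro lin_ext_cong eq)
qed

lemma conc_Nil [simp]: "conc (bvec []) x = x" "conc x (bvec []) = x"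
  by (simp_all add: conc_def)

lemma bvec_cells2_all: "e \<in> cells2 S \<Longrightarrow> bvec e \<in> all_chains2"
  by (auto simp: all_chains2_def)

text \<open>As products of symbols with common labels are zero, concatenation is associative and bilinear on
all chains. The unit is the class of the empty symbol.\<close>

instantiation hclass :: "{ring, monoid_mult}"
begin

lift_definition one_hclass :: hclass is "bvec []"
  using bvec_cells2_all[of "[]" "{}"] by (simp add: homologous_refl_iff)

definition times_hclass :: "hclass \<Rightarrow> hclass \<Rightarrow> hclass"
  where "times_hclass = hconc"

instance
proof
  fix a b c :: hclass
  have closed: "homologous (conc x y) (conc x y)"
    if "homologous x x" "homologous y y" for x y
    using that
    by (auto simp: homologous_refl_iff all_chains2_closed bd_conc conc_simps)
  show "a * b * c = a * (b * c)"
    unfolding times_hclass_def by transfer (simp add: conc_assoc closed)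
  show "(a + b) * c = a * c + b * c"
    unfolding times_hclass_def
    by transfer (simp add: conc_simps closed homologous_refl_iff all_chains2_closed bd_conc)
  show "a * (b + c) = a * b + a * c"
    unfolding times_hclass_def
    by transfer (simp add: conc_simps closed homologous_refl_iff all_chains2_closed bd_conc)
  show "1 * a = a" "a * 1 = a"
    unfolding times_hclass_def by (transfer; simp)+
qed

end

lemma one_hclass: "hcls (bvec []) = (1 :: hclass)"
  by transfer (use bvec_cells2_all[of "[]" "{}"] in \<open>simp add: homologous_refl_iff\<close>)

lemma hscale_mult: "hscale c x * y = hscale c (x * y)" "x * hscale c y = hscale c (x * y)"
  unfolding times_hclass_def
  by (transfer, simp add: conc_scale conc_simps homologous_refl_iff all_chains2_closed bd_conc)+

lemma span_mult:
  assumes "x \<in> HV.span A" "y \<in> HV.span B" "HV.subspace V"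
    and "\<And>a b. a \<in> A \<Longrightarrow> b \<in> B \<Longrightarrow> a * b \<in> V"
  shows "x * y \<in> V"
proof -
  have *: "a * y \<in> V" if a: "a \<in> A" for a
    using assms(2)
  proof (induction rule: HV.span_induct_alt)
    case base
    then show ?case using HV.subspace_0[OF assms(3)] by simp
  next
    case (step c z u)
    then show ?case
      using assms(4)[OF a] HV.subspace_add[OF assms(3)] HV.subspace_scale[OF assms(3)]
      by (simp add: distrib_left hscale_mult)
  qed
  from assms(1) show ?thesis
  proof (induction rule: HV.span_induct_alt)
    case base
    then show ?case using HV.subspace_0[OF assms(3)] by simp
  next
    case (step c z u)
    then show ?case
      using * HV.subspace_add[OF assms(3)] HV.subspace_scale[OF assms(3)]
      by (simp add: distrib_right hscale_mult)
  qed
qed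

lemma hcls_conc:
  assumes "x \<in> cycles" "y \<in> cycles"
  shows "hcls (conc x y) = hcls x * hcls y" "conc x y \<in> cycles"
proof -
  have xy: "x \<in> all_chains2" "bd x = 0" "y \<in> all_chains2" "bd y = 0"
    using assms by (auto simp: cycles_def)
  show "hcls (conc x y) = hcls x * hcls y"
    using xy unfolding times_hclass_def
    by transfer (simp add: homologous_refl_iff all_chains2_closed bd_conc conc_simps)
  show "conc x y \<in> cycles"
    using xy by (simp add: cycles_def all_chains2_closed bd_conc conc_simps)
qed

text \<open>The conventions for zero agree: \<open>f\<close> is injective on the union of two disjoint sets of
labels iff it is injective on each of them and the images are disjoint.\<close>

lemma relabel_conc: "relabel f (conc x y) = conc (relabel f x) (relabel f y)"
proof -
  let ?P = "\<lambda>e g. if labels e \<inter> labels g = {} then bvec (e @ g) else 0 :: chain"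
  let ?R = "\<lambda>e. if inj_on f (labels e) then bvec (map (map f) e) else 0 :: chain"
  have lab: "labels (map (map f) e) = f ` labels e" for e
    by (auto simp: labels_def)
  have eq: "lin_ext ?R (?P e g) = lin_ext (\<lambda>u. lin_ext (?P u) (?R g)) (?R e)" for e g
    by (auto simp: lab inj_on_Un disjoint_iff inj_on_def; blast)
  have swap: "lin_ext (?P u) (lin_ext ?R y) = lin_ext (\<lambda>g. lin_ext (?P u) (?R g)) y" for u
    by (rule lin_ext_lin_ext)
  have "relabel f (conc x y) = lin_ext (\<lambda>e. lin_ext (\<lambda>g. lin_ext ?R (?P e g)) y) x"
    unfolding relabel_def conc_def lin_ext_lin_ext ..
  also have "\<dots> = lin_ext (\<lambda>e. lin_ext (\<lambda>u. lin_ext (?P u) (lin_ext ?R y)) (?R e)) x"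
  proof (rule lin_ext_cong)
    fix e
    show "lin_ext (\<lambda>g. lin_ext ?R (?P e g)) y = lin_ext (\<lambda>u. lin_ext (?P u) (lin_ext ?R y)) (?R e)"
      unfolding eq swap by (cases "inj_on f (labels e)") simp_all
  qed
  also have "\<dots> = conc (relabel f x) (relabel f y)"
    unfolding relabel_def conc_def lin_ext_lin_ext ..
  finally show ?thesis .
qed

lemma relabel_relabel: "relabel f (relabel g x) = relabel (f \<circ> g) x"
proof -
  have lab: "labels (map (map g) e) = g ` labels e" for e
    by (auto simp: labels_def)
  have "inj_on (f \<circ> g) A \<longleftrightarrow> inj_on g A \<and> inj_on f (g ` A)" for A
    by (metis comp_inj_on_iff inj_on_imageI2)
  then show ?thesis
    unfolding relabel_def lin_ext_lin_ext by (auto simp: lab intro!: lin_ext_cong)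
qed

lemma hrelabel_simps [simp]:
  "hrelabel f (x * y) = hrelabel f x * hrelabel f y"
  "hrelabel f (x + y) = hrelabel f x + hrelabel f y"
  "hrelabel f (hscale c x) = hscale c (hrelabel f x)"
  "hrelabel f 0 = 0"
  "hrelabel f 1 = 1"
  "hrelabel f (hrelabel g x) = hrelabel (f \<circ> g) x"
proof -
  have closed: "homologous (relabel f x) (relabel f x)" if "homologous x x" for f x
    using that by (simp add: homologous_refl_iff all_chains2_closed bd_relabel) (simp add: relabel_def)
  have closed2: "homologous (conc x y) (conc x y)"
    if "homologous x x" "homologous y y" for x y
    using that
    by (auto simp: homologous_refl_iff all_chains2_closed bd_conc conc_simps)
  have lin: "relabel f (x + y) = relabel f x + relabel f y"
    "relabel f (pscale c x) = pscale c (relabel f x)" "relabel f 0 = 0" for f c x y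
    by (simp_all add: relabel_def lin_ext_add lin_ext_scale)
  show "hrelabel f (x * y) = hrelabel f x * hrelabel f y"
    unfolding times_hclass_def by transfer (simp add: relabel_conc closed closed2)
  show "hrelabel f (x + y) = hrelabel f x + hrelabel f y"
    by transfer (metis closed homologous_refl_iff lin(1) all_chains2_closed(2) bd_simps(2) add.left_neutral)
  show "hrelabel f (hscale c x) = hscale c (hrelabel f x)"
    by transfer (metis closed homologous_refl_iff lin(2) all_chains2_closed(4) bd_simps(4) FV.scale_zero_right)
  show "hrelabel f 0 = 0" by transfer (simp add: lin homologous_refl_iff all_chains2_closed)
  show "hrelabel f 1 = 1"
    by transfer (use bvec_cells2_all[of "[]" "{}"] in \<open>simp add: relabel_def homologous_refl_iff\<close>)
  show "hrelabel f (hrelabel g x) = hrelabel (f \<circ> g) x"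
    by transfer (simp add: relabel_relabel closed)
qed

lemma hrelabel_hcls: "x \<in> cycles \<Longrightarrow> hrelabel f (hcls x) = hcls (relabel f x)"
proof -
  assume "x \<in> cycles"
  then have x: "x \<in> all_chains2" "bd x = 0" by (auto simp: cycles_def)
  then have "relabel f x \<in> all_chains2" "bd (relabel f x) = 0"
    using all_chains2_closed(6) by (auto simp: bd_relabel) (simp add: relabel_def)
  then show ?thesis using x by transfer (simp add: homologous_refl_iff)
qed

lemma hrelabel_span: "x \<in> HV.span A \<Longrightarrow> hrelabel f x \<in> HV.span (hrelabel f ` A)"
  by (induction rule: HV.span_induct_alt)
    (auto intro!: HV.span_zero HV.span_add HV.span_scale intro: HV.span_base)

lemma homology2_cycle:
  assumes "x \<in> homology2 S k"
  obtains u where "u \<in> cycles" "u \<in> chains2 S k" "x = hcls u"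
proof -
  obtain u where "u \<in> cycles2 S k" "x = hcls u" using assms by (auto simp: homology2_def)
  then show ?thesis using that[of u] cycles2_all[of u S k] by (simp add: cycles_def cycles2_def)
qed

lemma homology2I: "u \<in> cycles \<Longrightarrow> u \<in> chains2 S k \<Longrightarrow> hcls u \<in> homology2 S k"
  by (auto simp: homology2_def cycles_def cycles2_def)

lemma homology2_mult:
  assumes "x \<in> homology2 S k" "y \<in> homology2 T l" "S \<inter> T = {}"
  shows "x * y \<in> homology2 (S \<union> T) (k + l)"
proof -
  obtain u where u: "u \<in> cycles" "u \<in> chains2 S k" "x = hcls u" using homology2_cycle[OF assms(1)] .
  obtain v where v: "v \<in> cycles" "v \<in> chains2 T l" "y = hcls v" using homology2_cycle[OF assms(2)] .
  have "conc u v \<in> chains2 (S \<union> T) (k + l)"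
    unfolding chains2_def
  proof (intro CollectI subsetI)
    fix g assume "g \<in> keys (conc u v)"
    then obtain e f where g: "g = e @ f" "e \<in> keys u" "f \<in> keys v"
      using keys_conc_subset[of u v] by blast
    then have "e \<in> cells2 S" "cdim e = k" "f \<in> cells2 T" "cdim f = l"
      using u(2) v(2) by (auto simp: chains2_def)
    then show "g \<in> cells2 (S \<union> T) \<and> cdim g = k + l"
      using g(1) cells2_append_disjoint[OF _ _ assms(3)] cdim_append by auto
  qed
  then show ?thesis
    using hcls_conc[OF u(1) v(1)] homology2I u(3) v(3) by metis
qed

lemma homology2_hrelabel:
  assumes "x \<in> homology2 S k" "inj_on f S"
  shows "hrelabel f x \<in> homology2 (f ` S) k"
proof -
  obtain u where u: "u \<in> cycles" "u \<in> chains2 S k" "x = hcls u" using homology2_cycle[OF assms(1)] .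
  have "keys (relabel f u) \<subseteq> {e \<in> cells2 (f ` S). cdim e = k}"
    unfolding relabel_def
  proof (rule keys_lin_ext)
    fix e assume "e \<in> keys u"
    then have e: "e \<in> cells2 S" "cdim e = k" using u(2) by (auto simp: chains2_def)
    then have "map (map f) e \<in> cells2 (f ` S)" "cdim (map (map f) e) = k"
      using assms(2)
      by (auto simp: cells2_def cells_def labels_def distinct_map cdim_def simp flip: map_concat)
    then show "keys (if inj_on f (labels e) then bvec (map (map f) e) else 0)
        \<subseteq> {e \<in> cells2 (f ` S). cdim e = k}" by auto
  qed
  moreover have "relabel f u \<in> cycles"
    using u(1) all_chains2_closed(6) by (auto simp: cycles_def bd_relabel) (simp add: relabel_def)
  ultimately show ?thesis
    using homology2I[of "relabel f u"] hrelabel_hcls[OF u(1)] u(3) by (simp add: chains2_def)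
qed

lemma hrelabel_cong:
  assumes "x \<in> homology2 S k" "\<And>i. i \<in> S \<Longrightarrow> f i = g i"
  shows "hrelabel f x = hrelabel g x"
proof -
  obtain u where u: "u \<in> cycles" "u \<in> chains2 S k" "x = hcls u" using homology2_cycle[OF assms(1)] .
  have "relabel f u = relabel g u"
    unfolding relabel_def
  proof (rule lin_ext_cong)
    fix e assume "e \<in> keys u"
    then have "labels e = S" using u(2) cells2_labels by (auto simp: chains2_def)
    then have eq: "map (map f) e = map (map g) e" "inj_on f (labels e) \<longleftrightarrow> inj_on g (labels e)"
      using assms(2) inj_on_cong[of "labels e" f g] by (auto simp: labels_def)
    show "(if inj_on f (labels e) then bvec (map (map f) e) else 0)
      = (if inj_on g (labels e) then bvec (map (map g) e) else 0)" unfolding eq ..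
  qed
  then show ?thesis using hrelabel_hcls[OF u(1)] u(3) by simp
qed

lemma hrelabel_ident:
  assumes "x \<in> homology2 S k" "\<And>i. i \<in> S \<Longrightarrow> f i = i"
  shows "hrelabel f x = x"
proof -
  obtain u where u: "u \<in> cycles" "u \<in> chains2 S k" "x = hcls u" using homology2_cycle[OF assms(1)] .
  have "relabel id u = u" by (simp add: relabel_def)
  then have "hrelabel id x = x" using hrelabel_hcls[OF u(1)] u(3) by simp
  then show ?thesis using hrelabel_cong[OF assms(1), of f id] assms(2) by simp
qed

section \<open>Products of pieces\<close>

definition piece_class :: "piece \<Rightarrow> hclass"
  where "piece_class p = hcls (z_piece p)"

abbreviation sing :: "nat \<Rightarrow> hclass" where "sing a \<equiv> piece_class (PSingle a)"
abbreviation loop :: "nat \<Rightarrow> nat \<Rightarrow> hclass" where "loop a b \<equiv> piece_class (PPair a b)"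

definition sings :: "nat list \<Rightarrow> hclass"
  where "sings us = prod_list (map sing us)"

lemma sings_simps [simp]:
  "sings [] = 1" "sings (a # us) = sing a * sings us" "sings (us @ vs) = sings us * sings vs"
  by (simp_all add: sings_def)

lemma z_piece_cycles:
  assumes "distinct (concat (piece_symbol p))"
  shows "z_piece p \<in> cycles"
proof -
  have "z_piece p \<in> all_chains2"
  proof (cases p)
    case (PSingle a)
    then show ?thesis using bvec_cells2_all[of "[[a]]" "{a}"] by (simp add: cells2_Cons)
  next
    case (PPair a b)
    then show ?thesis
      using assms bvec_cells2_all[of "[[a, b]]" "{a, b}"] bvec_cells2_all[of "[[b, a]]" "{a, b}"]
      by (auto simp: cells2_Cons all_chains2_closed)
  next
    case (PTriple a b c)
    then have d: "distinct [a, b, c]" using assms by auto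
    have "bvec f \<in> all_chains2" if "f \<in> {[[a], [c, b]], [[b], [c, a]], [[c], [b, a]],
      [[c, b], [a]], [[c, a], [b]], [[b, a], [c]]}" for f
      by (rule bvec_cells2_all[of _ "{a, b, c}"]) (use that d in \<open>auto simp: cells2_Cons\<close>)
    then show ?thesis unfolding PTriple z_triple[OF d] by (intro all_chains2_closed) auto
  qed
  then show ?thesis using bd_z_piece[OF assms] by (simp add: cycles_def)
qed

lemma zclass_pieces:
  assumes "e \<in> cells2 S"
  shows "zclass e = prod_list (map piece_class (pieces e))"
proof -
  have "foldr conc (map z_piece (pieces e)) (bvec []) \<in> cycles \<and>
    hcls (foldr conc (map z_piece (pieces e)) (bvec [])) = prod_list (map piece_class (pieces e))"
    using assms
  proof (induction e S rule: symbol_induct)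
    case (Nil S)
    show ?case using bvec_cells2_all[of "[]" "{}"] by (simp add: one_hclass cycles_def)
  next
    case (Single a S)
    show ?case using z_piece_cycles[of "PSingle a"] by (simp add: piece_class_def)
  next
    case (Singles a b e S)
    show ?case
      using z_piece_cycles[of "PSingle a"] Singles(5)
      by (simp add: piece_class_def hcls_conc del: z_piece.simps)
  next
    case (Single_Pair a c b e S)
    show ?case
      using z_piece_cycles[of "PSingle a"] z_piece_cycles[of "PTriple a b c"] Single_Pair(5,6,7)
      by (simp add: piece_class_def hcls_conc del: z_piece.simps)
  next
    case (Pair a b e S)
    show ?case
      using z_piece_cycles[of "PPair a b"] Pair(4,5)
      by (simp add: piece_class_def hcls_conc del: z_piece.simps)
  qed
  then show ?thesis by (simp add: zclass_def)
qed

lemma hrelabel_piece_class: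
  "hrelabel f (sing a) = sing (f a)"
  "a \<noteq> b \<Longrightarrow> f a \<noteq> f b \<Longrightarrow> hrelabel f (loop a b) = loop (f a) (f b)"
  "distinct [a, b, c] \<Longrightarrow> distinct [f a, f b, f c] \<Longrightarrow>
    hrelabel f (piece_class (PTriple a b c)) = piece_class (PTriple (f a) (f b) (f c))"
proof -
  show "hrelabel f (sing a) = sing (f a)"
    using z_piece_cycles[of "PSingle a"] unfolding piece_class_def
    by (subst hrelabel_hcls) (auto simp: relabel_def)
  show "hrelabel f (loop a b) = loop (f a) (f b)" if "a \<noteq> b" "f a \<noteq> f b"
    using z_piece_cycles[of "PPair a b"] that unfolding piece_class_def
    by (subst hrelabel_hcls) (auto simp: relabel_def lin_ext_add inj_on_def)
  show "hrelabel f (piece_class (PTriple a b c)) = piece_class (PTriple (f a) (f b) (f c))"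
    if "distinct [a, b, c]" "distinct [f a, f b, f c]"
    using z_piece_cycles[of "PTriple a b c"] that unfolding piece_class_def
    by (subst hrelabel_hcls)
      (auto simp: z_triple relabel_def lin_ext_add lin_ext_diff inj_on_def simp del: z_piece.simps)
qed

lemma hrelabel_sings: "hrelabel f (sings us) = sings (map f us)"
  by (induction us) (auto simp: hrelabel_piece_class)

text \<open>An order-preserving relabeling respects the decomposition of a symbol into pieces; another one
need not.\<close>

lemma hrelabel_zclass:
  assumes "e \<in> cells2 S" "strict_mono_on S f"
  shows "hrelabel f (zclass e) = zclass (map (map f) e)"
proof -
  have inj: "inj_on f S" using assms(2) strict_mono_on_imp_inj_on by blast
  have "hrelabel f (prod_list (map piece_class (pieces e)))
      = prod_list (map piece_class (pieces (map (map f) e)))"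
    using assms
  proof (induction e S rule: symbol_induct)
    case (Singles a b e S)
    have "strict_mono_on (S - {a}) f" using Singles(6) by (rule monotone_on_subset) auto
    then show ?case using Singles(5) by (simp add: hrelabel_piece_class)
  next
    case (Single_Pair a c b e S)
    have m: "strict_mono_on (S - {a}) f" "strict_mono_on (S - {a, b, c}) f"
      using Single_Pair(8) by (auto intro: monotone_on_subset)
    have "distinct [f a, f b, f c]"
      using Single_Pair(4,5) strict_mono_on_imp_inj_on[OF Single_Pair(8)] by (auto simp: inj_on_def)
    moreover have "f b < f c \<longleftrightarrow> b < c"
      using Single_Pair(4,8) by (simp add: strict_mono_on_less)
    ultimately show ?case
      using Single_Pair(5) Single_Pair(6)[OF m(1)] Single_Pair(7)[OF m(2)]
      by (simp add: hrelabel_piece_class)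
  next
    case (Pair a b e S)
    have m: "strict_mono_on (S - {a, b}) f"
      using Pair(6) by (auto intro: monotone_on_subset)
    have "f a \<noteq> f b"
      using Pair(3,4) strict_mono_on_imp_inj_on[OF Pair(6)] by (auto simp: inj_on_def)
    then show ?case
      using Pair(4) Pair(5)[OF m] by (simp add: hrelabel_piece_class)
  qed (auto simp: hrelabel_piece_class)
  moreover have "map (map f) e \<in> cells2 (f ` S)"
    using assms(1) inj
    by (auto simp: cells2_def cells_def labels_def distinct_map simp flip: map_concat)
  ultimately show ?thesis using zclass_pieces assms(1) by metis
qed

text \<open>The difference is the boundary of the block \<open>a b\<close>.\<close>

lemma sing_commute: "sing a * sing b = sing b * sing a"
proof (cases "a = b")
  case False
  have cyc: "z_piece (PSingle a) \<in> cycles" for a by (rule z_piece_cycles) simp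
  have all: "bvec [[a, b]] \<in> all_chains2"
    using bvec_cells2_all[of "[[a, b]]" "{a, b}"] False by (simp add: cells2_Cons)
  have c: "conc (z_piece (PSingle a)) (z_piece (PSingle b)) \<in> cycles" for a b
    using hcls_conc(2)[OF cyc cyc] .
  have "sing a * sing b - sing b * sing a = hcls (conc (z_piece (PSingle a)) (z_piece (PSingle b))
      - conc (z_piece (PSingle b)) (z_piece (PSingle a)))"
    unfolding piece_class_def hcls_conc(1)[OF cyc cyc, symmetric] by (rule hcls_linear(2)[OF c c, symmetric])
  also have "\<dots> = hcls (bd (bvec [[a, b]]))"
    using False by (simp add: bd_block_pair)
  also have "\<dots> = 0" using hcls_boundary[OF all] .
  finally show ?thesis by simp
qed simp

lemma sing_sings: "sing a * sings us = sings us * sing a"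
  by (induction us) (auto simp: mult.assoc, metis mult.assoc sing_commute)

lemma sings_perm: "mset us = mset vs \<Longrightarrow> sings us = sings vs"
proof (induction us arbitrary: vs)
  case (Cons a us)
  then have "a \<in> set vs" by (metis list.set_intros(1) mset_eq_setD)
  then obtain v1 v2 where v: "vs = v1 @ a # v2" by (meson split_list)
  then have "sings us = sings (v1 @ v2)" using Cons.prems by (intro Cons.IH) simp
  moreover have "sings vs = sing a * sings (v1 @ v2)"
    using v sing_sings[of a v1] by (simp add: mult.assoc[symmetric])
  ultimately show ?case by simp
qed simp

lemma sings_set: "distinct us \<Longrightarrow> distinct vs \<Longrightarrow> set us = set vs \<Longrightarrow> sings us = sings vs"
  by (intro sings_perm) (simp add: set_eq_iff_mset_eq_distinct)

lemma loop_commute: "loop a b = loop b a"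
  by (simp add: piece_class_def add.commute)

lemma sing_homology: "sing a \<in> homology2 {a} 0"
  unfolding piece_class_def
  by (rule homology2I[OF z_piece_cycles]) (auto simp: chains2_def cells2_Cons cdim_def)

lemma loop_homology: "a \<noteq> b \<Longrightarrow> loop a b \<in> homology2 {a, b} 1"
proof -
  assume "a \<noteq> b"
  then show ?thesis
    unfolding piece_class_def
    using keys_add[of "bvec [[a, b]]" "bvec [[b, a]]"]
    by (intro homology2I[OF z_piece_cycles]) (auto simp: chains2_def cells2_Cons cdim_def)
qed

lemma one_homology: "1 \<in> homology2 {} 0"
  unfolding one_hclass[symmetric]
  by (rule homology2I) (auto simp: cycles_def chains2_def cdim_def all_chains2_def)

lemma sings_homology: "distinct us \<Longrightarrow> sings us \<in> homology2 (set us) 0"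
proof (induction us)
  case (Cons a us)
  then show ?case using homology2_mult[OF sing_homology, of "sings us" "set us" 0 a] by simp
qed (simp add: one_homology)

section \<open>Splitting off the first barrier\<close>

lemma singletons_simps [simp]:
  "singletons [] = []" "singletons (a # us) = [a] # singletons us"
  "singletons (us @ vs) = singletons us @ singletons vs"
  "singletons us = [] \<longleftrightarrow> us = []" "length (singletons us) = length us"
  "concat (singletons us) = us" "labels (singletons us) = set us"
  "map (map f) (singletons us) = singletons (map f us)"
  by (auto simp: singletons_def labels_def)

lemma cells2_singletons_append:
  "singletons us @ e \<in> cells2 S \<longleftrightarrow> distinct us \<and> set us \<subseteq> S \<and> e \<in> cells2 (S - set us)"
proof (induction us arbitrary: S)
  case (Cons a us)
  have "S - set (a # us) = S - {a} - set us" by auto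
  then show ?case using Cons by (auto simp: cells2_Cons)
qed simp

lemma cells2_head:
  "singletons us @ [p, q] # r \<in> cells2 S \<longleftrightarrow>
    distinct (us @ [p, q]) \<and> set (us @ [p, q]) \<subseteq> S \<and> r \<in> cells2 (S - set (us @ [p, q]))"
proof -
  have "S - set us - set [p, q] = S - set (us @ [p, q])" by auto
  then show ?thesis by (auto simp: cells2_singletons_append cells2_Cons)
qed

lemma symbol_split:
  assumes "e \<in> cells2 S"
  obtains us where "e = singletons us" | us p q r where "e = singletons us @ [p, q] # r"
proof -
  have "(\<exists>us. e = singletons us) \<or> (\<exists>us p q r. e = singletons us @ [p, q] # r)"
    using assms
  proof (induction e arbitrary: S)
    case Nil
    then show ?case using singletons_simps(1) by metis
  next
    case (Cons g e)
    then have "(\<exists>a. g = [a]) \<or> (\<exists>a b. g = [a, b])"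
      by (cases g; cases "tl g"; cases "tl (tl g)") (auto simp: cells2_Cons)
    then show ?case
    proof (elim disjE exE)
      fix a assume a: "g = [a]"
      have "(\<exists>us. e = singletons us) \<or> (\<exists>us p q r. e = singletons us @ [p, q] # r)"
        using Cons by (auto simp: cells2_Cons)
      then show ?thesis
      proof (elim disjE exE)
        fix us assume "e = singletons us"
        then have "g # e = singletons (a # us)" using a by simp
        then show ?thesis by blast
      next
        fix us p q r assume "e = singletons us @ [p, q] # r"
        then have "g # e = singletons (a # us) @ [p, q] # r" using a by simp
        then show ?thesis by blast
      qed
    next
      fix a b assume "g = [a, b]"
      then have "g # e = singletons [] @ [a, b] # e" by simp
      then show ?thesis by blast
    qed
  qed
  then show ?thesis using that by blast
qed

lemma partner_singletons:
  "distinct us \<Longrightarrow> partner (singletons us) = singletons us \<longleftrightarrow> sorted_wrt (>) us"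
  by (induction us rule: induct_list012) (auto simp: sorted_wrt2 sorted_wrt1 simp del: sorted_wrt.simps(2))

lemma partner_head:
  "distinct (us @ [p, q]) \<Longrightarrow> partner (singletons us @ [p, q] # r) = singletons us @ [p, q] # r \<longleftrightarrow>
    sorted_wrt (>) us \<and> (p < q \<or> us \<noteq> [] \<and> last us < q \<and> q < p) \<and> partner r = r"
proof (induction us rule: induct_list012)
  case (3 a b us)
  then show ?case by (auto simp: sorted_wrt2 simp del: sorted_wrt.simps(2))
qed auto

lemma pieces_singletons [simp]: "pieces (singletons us) = map PSingle us"
  by (induction us rule: induct_list012) auto

lemma pieces_head:
  "pieces (singletons us @ [p, q] # r) = pieces (singletons us @ [[p, q]]) @ pieces r"
  by (induction us rule: induct_list012) auto

lemma pieces_head_barrier: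
  "\<exists>ps b. pieces (singletons us @ [[p, q]]) = ps @ [b] \<and> is_barrier b \<and> (\<forall>x\<in>set ps. \<not> is_barrier x)"
proof (induction us rule: induct_list012)
  case (2 a)
  have "pieces (singletons [a] @ [[p, q]]) = [] @ [PTriple a q p] \<or>
    pieces (singletons [a] @ [[p, q]]) = [PSingle a] @ [PPair p q]" by auto
  then show ?case by force
next
  case (3 a b us)
  then obtain ps x where "pieces (singletons (b # us) @ [[p, q]]) = ps @ [x]" "is_barrier x"
    "\<forall>y\<in>set ps. \<not> is_barrier y" by auto
  then show ?case by (intro exI[of _ "PSingle a # ps"] exI[of _ x]) auto
qed auto

lemma pieces_increasing_head:
  "p < q \<Longrightarrow> pieces (singletons us @ [[p, q]]) = map PSingle us @ [PPair p q]"
  by (induction us rule: induct_list012) auto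

lemma concat_pieces: "e \<in> cells2 S \<Longrightarrow> concat (map piece_symbol (pieces e)) = e"
  by (induction e S rule: symbol_induct) auto

lemma zclass_singletons: "distinct us \<Longrightarrow> zclass (singletons us) = sings us"
  using zclass_pieces[of "singletons us" "set us"] cells2_singletons_append[of us "[]" "set us"]
  by (simp add: sings_def comp_def)

lemma zclass_head:
  assumes "singletons us @ [p, q] # r \<in> cells2 S"
  shows "zclass (singletons us @ [p, q] # r) = zclass (singletons us @ [[p, q]]) * zclass r"
proof -
  have "singletons us @ [[p, q]] \<in> cells2 (set (us @ [p, q]))"
    using assms unfolding cells2_head by simp
  moreover have "r \<in> cells2 (S - set (us @ [p, q]))" using assms unfolding cells2_head by simp
  ultimately show ?thesis
    using zclass_pieces[OF assms] zclass_pieces pieces_head[of us p q r] by simp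
qed

lemma zclass_increasing_head:
  assumes "p < q" "distinct (us @ [p, q])"
  shows "zclass (singletons us @ [[p, q]]) = sings us * loop p q"
proof -
  have "singletons us @ [[p, q]] \<in> cells2 (set (us @ [p, q]))"
    using assms unfolding cells2_head by simp
  then show ?thesis
    using zclass_pieces pieces_increasing_head[OF assms(1)] by (simp add: sings_def comp_def)
qed

text \<open>A head is a critical symbol with one barrier, at its end.\<close>

definition heads :: "nat set \<Rightarrow> symbol set"
  where "heads T = {singletons us @ [[p, q]] | us p q. distinct (us @ [p, q]) \<and> set (us @ [p, q]) = T \<and>
    sorted_wrt (>) us \<and> (p < q \<or> us \<noteq> [] \<and> last us < q \<and> q < p)}"

lemma heads_iff:
  "singletons us @ [[p, q]] \<in> heads T \<longleftrightarrow> distinct (us @ [p, q]) \<and> set (us @ [p, q]) = T \<and>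
    sorted_wrt (>) us \<and> (p < q \<or> us \<noteq> [] \<and> last us < q \<and> q < p)" (is "?L \<longleftrightarrow> ?R us p q")
proof
  assume ?L
  then obtain us' p' q' where e: "singletons us @ [[p, q]] = singletons us' @ [[p', q']]"
    and c: "?R us' p' q'" unfolding heads_def by blast
  then have "[p', q'] = [p, q]" "singletons us' = singletons us" by auto
  then have "us' = us \<and> p' = p \<and> q' = q" by (metis list.inject singletons_simps(6))
  then show "?R us p q" using c by simp
next
  assume "?R us p q"
  then show ?L unfolding heads_def by (intro CollectI exI[of _ us] exI[of _ p] exI[of _ q]) simp
qed

lemma crit_0_iff:
  "e \<in> crit S 0 \<longleftrightarrow> (\<exists>us. e = singletons us \<and> distinct us \<and> set us = S \<and> sorted_wrt (>) us)"
proof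
  assume e: "e \<in> crit S 0"
  then have e2: "e \<in> cells2 S" "partner e = e" "cdim e = 0" by (auto simp: crit_def)
  from e2(1) show "\<exists>us. e = singletons us \<and> distinct us \<and> set us = S \<and> sorted_wrt (>) us"
  proof (cases rule: symbol_split)
    case (1 us)
    then have "distinct us" "set us = S"
      using e2 cells2_singletons_append[of us "[]" S] by auto
    then show ?thesis using 1 e2(2) partner_singletons by auto
  next
    case (2 us p q r)
    have "length r \<le> length (concat r)"
      using e2(1) length_le_concat unfolding 2 cells2_head by blast
    then show ?thesis using e2(3) 2 by (simp add: cdim_def)
  qed
next
  assume "\<exists>us. e = singletons us \<and> distinct us \<and> set us = S \<and> sorted_wrt (>) us"
  then show "e \<in> crit S 0"
    using cells2_singletons_append[of _ "[]" S] partner_singletons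
    by (auto simp: crit_def cdim_def)
qed

text \<open>After a two-element block no singleton can interact with what follows, so the parts
of a symbol before and after its first such block are critical independently of each other.\<close>

lemma crit_head_iff:
  "singletons us @ [p, q] # r \<in> crit S (Suc k) \<longleftrightarrow>
    singletons us @ [[p, q]] \<in> heads (set (us @ [p, q])) \<and> set (us @ [p, q]) \<subseteq> S \<and>
    r \<in> crit (S - set (us @ [p, q])) k" (is "?L \<longleftrightarrow> ?R")
proof -
  have cd: "cdim (singletons us @ [p, q] # r) = Suc k \<longleftrightarrow> cdim r = k"
    if "r \<in> cells2 T" for T
    using length_le_concat[OF that] by (auto simp: cdim_def)
  have hd: "singletons us @ [[p, q]] \<in> heads (set (us @ [p, q])) \<longleftrightarrow> distinct (us @ [p, q]) \<and>
    sorted_wrt (>) us \<and> (p < q \<or> us \<noteq> [] \<and> last us < q \<and> q < p)"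
    by (simp add: heads_iff)
  show ?thesis
  proof
    assume ?L
    then have *: "singletons us @ [p, q] # r \<in> cells2 S"
      "partner (singletons us @ [p, q] # r) = singletons us @ [p, q] # r"
      "cdim (singletons us @ [p, q] # r) = Suc k"
      by (auto simp: crit_def)
    note c = *(1)[unfolded cells2_head]
    show ?R using c *(2) *(3) partner_head[of us p q r] cd hd by (auto simp: crit_def)
  next
    assume R: ?R
    then have c: "singletons us @ [p, q] # r \<in> cells2 S"
      unfolding cells2_head hd by (simp add: crit_def)
    show ?L using R c partner_head[of us p q r] cd hd unfolding crit_def by blast
  qed
qed

lemma crit_Suc_iff:
  "e \<in> crit S (Suc k) \<longleftrightarrow> (\<exists>T h r. T \<subseteq> S \<and> h \<in> heads T \<and> r \<in> crit (S - T) k \<and> e = h @ r)"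
proof
  assume e: "e \<in> crit S (Suc k)"
  then have "e \<in> cells2 S" by (simp add: crit_def)
  then show "\<exists>T h r. T \<subseteq> S \<and> h \<in> heads T \<and> r \<in> crit (S - T) k \<and> e = h @ r"
  proof (cases rule: symbol_split)
    case (1 us)
    then show ?thesis using e by (simp add: crit_def cdim_def)
  next
    case (2 us p q r)
    then have "set (us @ [p, q]) \<subseteq> S \<and> singletons us @ [[p, q]] \<in> heads (set (us @ [p, q])) \<and>
      r \<in> crit (S - set (us @ [p, q])) k \<and> e = (singletons us @ [[p, q]]) @ r"
      using e crit_head_iff[of us p q r S k] by simp
    then show ?thesis by blast
  qed
next
  assume "\<exists>T h r. T \<subseteq> S \<and> h \<in> heads T \<and> r \<in> crit (S - T) k \<and> e = h @ r"
  then obtain T h r where *: "T \<subseteq> S" "h \<in> heads T" "r \<in> crit (S - T) k" "e = h @ r" by blast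
  then obtain us p q where h: "h = singletons us @ [[p, q]]" "T = set (us @ [p, q])"
    unfolding heads_def by blast
  then show "e \<in> crit S (Suc k)" using * crit_head_iff[of us p q r S k] by simp
qed

lemma heads_crit: "h \<in> heads T \<Longrightarrow> h \<in> crit T 1"
proof -
  assume h: "h \<in> heads T"
  then obtain us p q where u: "h = singletons us @ [[p, q]]" "T = set (us @ [p, q])"
    unfolding heads_def by blast
  have "[] \<in> crit {} 0" by (simp add: crit_def cdim_def)
  then show ?thesis using crit_head_iff[of us p q "[]" T 0] h unfolding u by simp
qed

lemma heads_homology: "h \<in> heads T \<Longrightarrow> zclass h \<in> homology2 T 1"
  by (rule zclass_homology[OF heads_crit])

lemma heads_mult_homology:
  assumes "h \<in> heads T" "T \<subseteq> S" "y \<in> homology2 (S - T) k"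
  shows "zclass h * y \<in> homology2 S (Suc k)"
proof -
  have "T \<inter> (S - T) = {}" "T \<union> (S - T) = S" using assms(2) by auto
  then show ?thesis using homology2_mult[OF heads_homology[OF assms(1)] assms(3)] by simp
qed

lemma zclass_heads_append:
  assumes "h \<in> heads T" "r \<in> cells2 (S - T)" "T \<subseteq> S"
  shows "zclass (h @ r) = zclass h * zclass r"
proof -
  obtain us p q where h: "h = singletons us @ [[p, q]]" "T = set (us @ [p, q])" "distinct (us @ [p, q])"
    using assms(1) unfolding heads_def by blast
  have "singletons us @ [p, q] # r \<in> cells2 S" unfolding cells2_head using h assms by simp
  then show ?thesis using zclass_head h by simp
qed

lemma homology2_0_span:
  assumes "finite S" "x \<in> homology2 S 0"
  shows "x \<in> HV.span {sings us | us. distinct us \<and> set us = S}"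
proof -
  have "zclass ` crit S 0 \<subseteq> {sings us | us. distinct us \<and> set us = S}"
  proof
    fix z assume "z \<in> zclass ` crit S 0"
    then obtain us where "z = zclass (singletons us)" "distinct us" "set us = S"
      using crit_0_iff by auto
    then show "z \<in> {sings us | us. distinct us \<and> set us = S}"
      using zclass_singletons by blast
  qed
  from HV.span_mono[OF this] show ?thesis using assms zclass_span by blast
qed

text \<open>A recursive form of the basis theorem, by which linear identities are proved by induction on the number
of barriers.\<close>

lemma homology2_Suc_span:
  assumes "finite S" "x \<in> homology2 S (Suc k)"
  shows "x \<in> HV.span {zclass h * y | T h y. T \<subseteq> S \<and> h \<in> heads T \<and> y \<in> homology2 (S - T) k}"
proof -
  have "zclass ` crit S (Suc k) \<subseteq> {zclass h * y | T h y. T \<subseteq> S \<and> h \<in> heads T \<and> y \<in> homology2 (S - T) k}"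
  proof
    fix z assume "z \<in> zclass ` crit S (Suc k)"
    then obtain T h r where *: "T \<subseteq> S" "h \<in> heads T" "r \<in> crit (S - T) k" "z = zclass (h @ r)"
      using crit_Suc_iff by auto
    then have "z = zclass h * zclass r" using zclass_heads_append[of h T r S] by (simp add: crit_def)
    then show "z \<in> {zclass h * y | T h y. T \<subseteq> S \<and> h \<in> heads T \<and> y \<in> homology2 (S - T) k}"
      using * zclass_homology by blast
  qed
  from HV.span_mono[OF this] show ?thesis using assms zclass_span by blast
qed

section \<open>High insertion and products\<close>

lemma lin_on_eq_span:
  assumes "lin_on hscale hscale V f" "lin_on hscale hscale V g" "HV.subspace V"
    and "A \<subseteq> V" "\<And>a. a \<in> A \<Longrightarrow> f a = g a" "x \<in> HV.span A"
  shows "f x = g x"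
proof -
  have lin: "f (u + v) = f u + f v" "f (hscale c u) = hscale c (f u)"
    "g (u + v) = g u + g v" "g (hscale c u) = hscale c (g u)" if "u \<in> V" "v \<in> V" for u v c
    using assms(1,2) that by (auto simp: lin_on_def)
  note z = HV.subspace_0[OF assms(3)]
  have "HV.subspace {x \<in> V. f x = g x}"
  proof (rule HV.subspaceI)
    show "0 \<in> {x \<in> V. f x = g x}"
      using lin(2)[OF z z, of 0] lin(4)[OF z z, of 0] z by simp
  qed (use lin HV.subspace_add[OF assms(3)] HV.subspace_scale[OF assms(3)] in auto)
  then have "HV.span A \<subseteq> {x \<in> V. f x = g x}"
    using assms(4,5) by (intro HV.span_minimal) auto
  then show ?thesis using assms(6) by auto
qed

lemma lin_on_span_image:
  assumes "lin_on hscale hscale V f" "HV.subspace V" "A \<subseteq> V"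
    and "\<And>a. a \<in> A \<Longrightarrow> f a \<in> HV.span B" "x \<in> HV.span A"
  shows "f x \<in> HV.span B"
proof -
  have lin: "f (u + v) = f u + f v" "f (hscale c u) = hscale c (f u)" if "u \<in> V" "v \<in> V" for u v c
    using assms(1) that by (auto simp: lin_on_def)
  note z = HV.subspace_0[OF assms(2)]
  have "HV.subspace {x \<in> V. f x \<in> HV.span B}"
  proof (rule HV.subspaceI)
    show "0 \<in> {x \<in> V. f x \<in> HV.span B}"
      using lin(2)[OF z z, of 0] z by (simp add: HV.span_zero)
  qed (use lin HV.subspace_add[OF assms(2)] HV.subspace_scale[OF assms(2)] in
      \<open>auto simp: HV.span_add HV.span_scale\<close>)
  then have "HV.span A \<subseteq> {x \<in> V. f x \<in> HV.span B}"
    using assms(3,4) by (intro HV.span_minimal) auto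
  then show ?thesis using assms(5) by auto
qed

text \<open>The map \<open>hiota k n j\<close> for an arbitrary label set \<open>S\<close>. Inductions that split off the first factor
of a product need it on the complement of the labels of that factor.\<close>

definition hins :: "nat set \<Rightarrow> nat \<Rightarrow> nat \<Rightarrow> nat \<Rightarrow> hclass \<Rightarrow> hclass"
  where "hins S k n j x = (\<Sum>e\<in>crit S k.
    hscale (HV.representation (zclass ` crit S k) x (zclass e)) (zclass (iota n j e)))"

lemma hiota_hins: "hiota k n j = hins {1..n} k n j"
  by (rule ext) (simp add: hiota_def hins_def critical_crit)

lemma hins_zclass:
  assumes "finite S" "e \<in> crit S k"
  shows "hins S k n j (zclass e) = zclass (iota n j e)"
proof -
  have B: "HV.independent (zclass ` crit S k)" "inj_on zclass (crit S k)"
    using HV.indep_family_independent[OF finite_crit zclass_indep]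
      HV.indep_family_inj[OF finite_crit zclass_indep] assms(1) by simp_all
  have "hins S k n j (zclass e) = (\<Sum>f\<in>crit S k. if f = e then zclass (iota n j f) else 0)"
    unfolding hins_def
  proof (rule sum.cong)
    fix f assume f: "f \<in> crit S k"
    have "HV.representation (zclass ` crit S k) (zclass e) (zclass f) = (if f = e then 1 else 0)"
      using HV.representation_basis[OF B(1), of "zclass e"] assms(2) f inj_onD[OF B(2), of f e] by auto
    then show "hscale (HV.representation (zclass ` crit S k) (zclass e) (zclass f)) (zclass (iota n j f))
      = (if f = e then zclass (iota n j f) else 0)" by simp
  qed simp
  then show ?thesis using assms by simp
qed

lemma hins_lin:
  assumes "finite S"
  shows "lin_on hscale hscale (homology2 S k) (hins S k n j)"
proof -
  have B: "HV.independent (zclass ` crit S k)"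
    using HV.indep_family_independent[OF finite_crit zclass_indep] assms by simp
  show ?thesis
    unfolding lin_on_def zclass_span[OF assms] hins_def
    by (auto simp: HV.representation_add[OF B] HV.representation_scale[OF B] HV.scale_left_distrib
        sum.distrib HV.scale_sum_right)
qed

lemma lin_on_mult:
  assumes "lin_on hscale hscale V f" "\<And>x. x \<in> U \<Longrightarrow> x * y \<in> V"
  shows "lin_on hscale hscale U (\<lambda>x. f (x * y))"
  using assms unfolding lin_on_def by (simp add: distrib_right hscale_mult)

lemma lin_on_mult':
  assumes "lin_on hscale hscale V f" "\<And>y. y \<in> U \<Longrightarrow> x * y \<in> V"
  shows "lin_on hscale hscale U (\<lambda>y. f (x * y))"
  using assms unfolding lin_on_def by (simp add: distrib_left hscale_mult)

lemma lin_on_mult_left: "lin_on hscale hscale V f \<Longrightarrow> lin_on hscale hscale V (\<lambda>y. x * f y)"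
  unfolding lin_on_def by (simp add: distrib_left hscale_mult)

lemma lin_on_mult_right: "lin_on hscale hscale V (\<lambda>x. x * y)"
  unfolding lin_on_def by (simp add: distrib_right hscale_mult)

lemma insert_after_barrier_split:
  "\<exists>ps1 ps2. ps = ps1 @ ps2 \<and> insert_after_barrier j x ps = ps1 @ x # ps2"
proof (induction j x ps rule: insert_after_barrier.induct)
  case (1 x ps)
  show ?case by (intro exI[of _ "[]"] exI[of _ ps]) simp
next
  case (2 j x)
  show ?case by simp
next
  case (3 j x p ps)
  then obtain ps1 ps2 where "ps = ps1 @ ps2"
    "insert_after_barrier (if is_barrier p then j else Suc j) x ps = ps1 @ x # ps2" by blast
  then show ?case by (intro exI[of _ "p # ps1"] exI[of _ ps2]) simp
qed

lemma iota_cells2: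
  assumes "e \<in> cells2 S" "Suc n \<notin> S"
  shows "iota n j e \<in> cells2 (insert (Suc n) S)"
proof -
  obtain ps1 ps2 where ps: "pieces e = ps1 @ ps2"
    "insert_after_barrier j (PSingle (Suc n)) (pieces e) = ps1 @ PSingle (Suc n) # ps2"
    using insert_after_barrier_split by blast
  let ?e1 = "concat (map piece_symbol ps1)" and ?e2 = "concat (map piece_symbol ps2)"
  have "e = ?e1 @ ?e2" using concat_pieces[OF assms(1)] ps(1) by simp
  moreover have "iota n j e = ?e1 @ [[Suc n]] @ ?e2" using ps by (simp add: iota_def)
  ultimately show ?thesis
    using assms by (auto simp: cells2_def cells_def labels_def)
qed

lemma insert_after_barrier_append:
  "\<forall>p\<in>set ps. \<not> is_barrier p \<Longrightarrow> is_barrier b \<Longrightarrow>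
    insert_after_barrier (Suc j) x (ps @ b # qs) = ps @ b # insert_after_barrier j x qs"
  by (induction ps) auto

lemma iota_Suc:
  assumes "h \<in> heads T"
  shows "iota n (Suc j) (h @ r) = h @ iota n j r"
proof -
  obtain us p q where h: "h = singletons us @ [[p, q]]"
    using assms unfolding heads_def by blast
  obtain ps b where ps: "pieces h = ps @ [b]" "is_barrier b" "\<forall>x\<in>set ps. \<not> is_barrier x"
    unfolding h using pieces_head_barrier by blast
  have "pieces (h @ r) = ps @ b # pieces r" using pieces_head[of us p q r] h ps(1) by simp
  moreover have "concat (map piece_symbol (ps @ [b])) = h"
    using concat_pieces[of h T] heads_crit[OF assms] ps(1) by (simp add: crit_def)
  ultimately show ?thesis
    using insert_after_barrier_append[OF ps(3,2)] by (simp add: iota_def)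
qed

lemma iota_0: "e \<in> cells2 S \<Longrightarrow> iota n 0 e = [Suc n] # e"
  by (simp add: iota_def concat_pieces)

lemma zclass_sing_Cons:
  assumes "e \<in> crit S k" "c \<notin> S"
  shows "zclass ([c] # e) = sing c * zclass e"
proof -
  have e: "e \<in> cells2 S" "partner e = e" using assms(1) by (auto simp: crit_def)
  have "[c] # e \<in> cells2 (insert c S)" using e(1) assms(2) by (simp add: cells2_Cons)
  moreover have "pieces ([c] # e) = PSingle c # pieces e"
    using e by (induction rule: symbol_induct) (auto split: if_splits)
  ultimately show ?thesis using zclass_pieces e(1) by simp
qed

text \<open>A new singleton at the far left forms no piece with what follows, because a critical symbol
does not begin with a decreasing block.\<close>

lemma hins_0:
  assumes "finite S" "Suc n \<notin> S" "x \<in> homology2 S k"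
  shows "hins S k n 0 x = sing (Suc n) * x"
proof (rule lin_on_eq_span[OF hins_lin[OF assms(1)] _ subspace_homology2])
  show "lin_on hscale hscale (homology2 S k) (\<lambda>x. sing (Suc n) * x)"
    unfolding lin_on_def by (simp add: distrib_left hscale_mult)
  show "x \<in> HV.span (zclass ` crit S k)" using assms zclass_span by blast
  fix a assume "a \<in> zclass ` crit S k"
  then show "hins S k n 0 a = sing (Suc n) * a"
    using assms(1,2) iota_0 zclass_sing_Cons by (force simp: hins_zclass crit_def)
qed (use zclass_homology in auto)

lemma hins_heads:
  assumes "finite S" "Suc n \<notin> S" "h \<in> heads T" "T \<subseteq> S" "y \<in> homology2 (S - T) k"
  shows "hins S (Suc k) n (Suc j) (zclass h * y) = zclass h * hins (S - T) k n j y"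
proof (rule lin_on_eq_span[where V = "homology2 (S - T) k" and A = "zclass ` crit (S - T) k" and x = y
      and f = "\<lambda>y. hins S (Suc k) n (Suc j) (zclass h * y)"
      and g = "\<lambda>y. zclass h * hins (S - T) k n j y"])
  have fin: "finite (S - T)" using assms(1) by simp
  show "lin_on hscale hscale (homology2 (S - T) k) (\<lambda>y. hins S (Suc k) n (Suc j) (zclass h * y))"
    by (rule lin_on_mult'[OF hins_lin[OF assms(1)]]) (rule heads_mult_homology[OF assms(3,4)])
  show "lin_on hscale hscale (homology2 (S - T) k) (\<lambda>y. zclass h * hins (S - T) k n j y)"
    by (intro lin_on_mult_left hins_lin fin)
  show "y \<in> HV.span (zclass ` crit (S - T) k)" using assms zclass_span[OF fin] by blast
  show "zclass ` crit (S - T) k \<subseteq> homology2 (S - T) k" using zclass_homology by blast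
  fix a assume "a \<in> zclass ` crit (S - T) k"
  then obtain r where r: "r \<in> crit (S - T) k" "a = zclass r" by blast
  then have r2: "r \<in> cells2 (S - T)" by (simp add: crit_def)
  have "h @ r \<in> crit S (Suc k)" using crit_Suc_iff r assms by blast
  then have "hins S (Suc k) n (Suc j) (zclass (h @ r)) = zclass (h @ iota n j r)"
    using hins_zclass[OF assms(1)] iota_Suc[OF assms(3)] by simp
  also have "\<dots> = zclass h * zclass (iota n j r)"
  proof (rule zclass_heads_append[OF assms(3)])
    have "insert (Suc n) S - T = insert (Suc n) (S - T)" using assms(2,4) by auto
    then show "iota n j r \<in> cells2 (insert (Suc n) S - T)" using iota_cells2[OF r2] assms(2) by simp
  qed (use assms(4) in auto)
  finally show "hins S (Suc k) n (Suc j) (zclass h * a) = zclass h * hins (S - T) k n j a"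
    using r zclass_heads_append[OF assms(3) r2 assms(4)] hins_zclass[OF fin r(1)] by simp
qed (rule subspace_homology2)

lemma sing_commute_homology:
  assumes "finite T" "x \<in> homology2 T 0"
  shows "sing a * x = x * sing a"
  using homology2_0_span[OF assms]
proof (induction rule: HV.span_induct_alt)
  case (step c x y)
  then show ?case using sing_sings by (auto simp: distrib_left distrib_right hscale_mult)
qed simp

text \<open>By linearity \<open>x\<close> is a head times a class \<open>x'\<close> without barriers. Passing the head lowers \<open>j\<close> by one,
and then \<open>x'\<close> is passed by the assumption.\<close>

lemma hins_mult_1_aux:
  assumes IH: "\<And>T S k x y. finite (T \<union> S) \<Longrightarrow> T \<inter> S = {} \<Longrightarrow> Suc n \<notin> T \<union> S \<Longrightarrow> j \<le> k \<Longrightarrow>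
      x \<in> homology2 T 0 \<Longrightarrow> y \<in> homology2 S k \<Longrightarrow> hins (T \<union> S) k n j (x * y) = x * hins S k n j y"
    and "finite (T \<union> S)" "T \<inter> S = {}" "Suc n \<notin> T \<union> S" "j \<le> k"
    and x: "x \<in> homology2 T 1" and y: "y \<in> homology2 S k"
  shows "hins (T \<union> S) (Suc k) n (Suc j) (x * y) = x * hins S k n j y"
proof -
  let ?A = "{zclass h * x' | U h x'. U \<subseteq> T \<and> h \<in> heads U \<and> x' \<in> homology2 (T - U) 0}"
  have fin: "finite T" "finite S" using assms(2) by auto
  have A: "?A \<subseteq> homology2 T 1"
  proof
    fix a assume "a \<in> ?A"
    then obtain U h x' where *: "U \<subseteq> T" "h \<in> heads U" "x' \<in> homology2 (T - U) 0" "a = zclass h * x'"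
      by blast
    then show "a \<in> homology2 T 1" using heads_mult_homology[of h U T x' 0] by simp
  qed
  show ?thesis
  proof (rule lin_on_eq_span[OF _ lin_on_mult_right subspace_homology2 A])
    show "lin_on hscale hscale (homology2 T 1) (\<lambda>x. hins (T \<union> S) (Suc k) n (Suc j) (x * y))"
      by (rule lin_on_mult[OF hins_lin[OF assms(2)]])
        (use homology2_mult[OF _ y assms(3), of _ 1] in simp)
    show "x \<in> HV.span ?A" using homology2_Suc_span[of T x 0] fin x by simp
    fix a assume "a \<in> ?A"
    then obtain U h x' where *: "U \<subseteq> T" "h \<in> heads U" "x' \<in> homology2 (T - U) 0" "a = zclass h * x'"
      by blast
    have eq: "T \<union> S - U = (T - U) \<union> S" using *(1) assms(3) by auto
    have "(T - U) \<inter> S = {}" using assms(3) by auto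
    from homology2_mult[OF *(3) y this] have m: "x' * y \<in> homology2 (T \<union> S - U) k" using eq by simp
    have "hins (T \<union> S) (Suc k) n (Suc j) (zclass h * (x' * y))
        = zclass h * hins (T \<union> S - U) k n j (x' * y)"
      by (rule hins_heads) (use assms(2,4) * m in auto)
    also have "hins (T \<union> S - U) k n j (x' * y) = x' * hins S k n j y"
      unfolding eq by (rule IH) (use assms(2-5) * y in auto)
    finally show "hins (T \<union> S) (Suc k) n (Suc j) (a * y) = a * hins S k n j y"
      using *(4) by (simp add: mult.assoc)
  qed
qed

text \<open>Multiplication by singletons can change the pieces of \<open>y\<close>, so this is not visible on symbols. For
\<open>j = 0\<close> it holds since singletons commute. For larger \<open>j\<close> the factor \<open>y\<close> is a head times \<open>y'\<close>, the
product of \<open>x\<close> with that head is again a class with one barrier, and \<open>hins_mult_1_aux\<close> applies with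
the smaller index.\<close>

lemma hins_mult_0:
  assumes "finite (T \<union> S)" "T \<inter> S = {}" "Suc n \<notin> T \<union> S" "j \<le> k"
    and "x \<in> homology2 T 0" "y \<in> homology2 S k"
  shows "hins (T \<union> S) k n j (x * y) = x * hins S k n j y"
  using assms
proof (induction j arbitrary: T S k x y)
  case 0
  have "x * y \<in> homology2 (T \<union> S) k" using homology2_mult[OF 0(5,6,2)] by simp
  then show ?case
    using 0 sing_commute_homology[of T x "Suc n"] by (simp add: hins_0 mult.assoc[symmetric])
next
  case (Suc j)
  obtain k' where k: "k = Suc k'" "j \<le> k'" using Suc.prems(4) by (cases k) auto
  have fin: "finite T" "finite S" using Suc.prems(1) by auto
  let ?A = "{zclass h * y' | U h y'. U \<subseteq> S \<and> h \<in> heads U \<and> y' \<in> homology2 (S - U) k'}"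
  have A: "?A \<subseteq> homology2 S k"
  proof
    fix a assume "a \<in> ?A"
    then obtain U h y' where *: "U \<subseteq> S" "h \<in> heads U" "y' \<in> homology2 (S - U) k'" "a = zclass h * y'"
      by blast
    then show "a \<in> homology2 S k" using heads_mult_homology[of h U S y' k'] k by simp
  qed
  show ?case
  proof (rule lin_on_eq_span[OF _ lin_on_mult_left[OF hins_lin[OF fin(2)]] subspace_homology2 A])
    show "lin_on hscale hscale (homology2 S k) (\<lambda>y. hins (T \<union> S) k n (Suc j) (x * y))"
      by (rule lin_on_mult'[OF hins_lin[OF Suc.prems(1)]])
        (use homology2_mult[OF Suc.prems(5) _ Suc.prems(2)] in simp)
    show "y \<in> HV.span ?A" using homology2_Suc_span[OF fin(2)] Suc.prems(6) k by simp
    fix a assume "a \<in> ?A"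
    then obtain U h y' where *: "U \<subseteq> S" "h \<in> heads U" "y' \<in> homology2 (S - U) k'" "a = zclass h * y'"
      by blast
    have eq: "T \<union> S = (T \<union> U) \<union> (S - U)" using *(1) by auto
    have "T \<inter> U = {}" using Suc.prems(2) *(1) by auto
    from homology2_mult[OF Suc.prems(5) heads_homology[OF *(2)] this]
    have xh: "x * zclass h \<in> homology2 (T \<union> U) 1" by simp
    have "hins ((T \<union> U) \<union> (S - U)) (Suc k') n (Suc j) ((x * zclass h) * y')
        = (x * zclass h) * hins (S - U) k' n j y'"
      by (rule hins_mult_1_aux[OF Suc.IH]) (use xh * k(2) Suc.prems finite_subset[OF *(1) fin(2)] in auto)
    moreover have "hins S (Suc k') n (Suc j) (zclass h * y') = zclass h * hins (S - U) k' n j y'"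
      by (rule hins_heads) (use * Suc.prems fin in auto)
    ultimately show "hins (T \<union> S) k n (Suc j) (x * a) = x * hins S k n (Suc j) a"
      using *(4) k eq by (simp add: mult.assoc)
  qed
qed

lemmas hins_mult_1 = hins_mult_1_aux[OF hins_mult_0]

section \<open>Order-preserving enumeration of a finite set\<close>

text \<open>The increasing bijection from \<open>{1..card T}\<close> to \<open>T\<close>, with inverse \<open>rank T\<close>.\<close>

definition enum :: "nat set \<Rightarrow> nat \<Rightarrow> nat"
  where "enum T i = sorted_list_of_set T ! (i - 1)"

definition rank :: "nat set \<Rightarrow> nat \<Rightarrow> nat"
  where "rank T = inv_into {1..card T} (enum T)"

lemma strict_mono_enum:
  assumes "strict_mono_on {1..r} f" "i \<in> {1..r}"
  shows "f i = enum (f ` {1..r}) i"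
proof -
  have "sorted_wrt (<) (map f [1..<Suc r])"
    unfolding sorted_wrt_map
    by (rule sorted_wrt_mono_rel[OF _ sorted_wrt_upt])
      (use assms(1) in \<open>auto simp: strict_mono_on_def\<close>)
  then have "sorted_list_of_set (set (map f [1..<Suc r])) = map f [1..<Suc r]"
    by (metis sorted_list_of_set.idem_if_sorted_distinct strict_sorted_iff)
  moreover have "set (map f [1..<Suc r]) = f ` {1..r}" by auto
  ultimately have "sorted_list_of_set (f ` {1..r}) = map f [1..<Suc r]" by simp
  moreover have "map f [1..<Suc r] ! (i - 1) = f (1 + (i - 1))"
    by (rule nth_map_upt) (use assms(2) in auto)
  ultimately show ?thesis using assms(2) by (simp add: enum_def del: upt_Suc)
qed

lemma enum:
  assumes "finite T"
  shows "strict_mono_on {1..card T} (enum T)" "enum T ` {1..card T} = T"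
proof -
  let ?xs = "sorted_list_of_set T"
  show "strict_mono_on {1..card T} (enum T)"
  proof (rule strict_mono_onI)
    fix i j assume "i \<in> {1..card T}" "j \<in> {1..card T}" "i < j"
    then show "enum T i < enum T j"
      unfolding enum_def using sorted_wrt_nth_less[OF strict_sorted_list_of_set[of T], of "i - 1" "j - 1"]
      by auto
  qed
  have "T = set ?xs" using assms by simp
  also have "\<dots> = (!) ?xs ` {0..<card T}"
    by (metis length_sorted_list_of_set list.set_map map_nth set_upt)
  also have "{0..<card T} = (\<lambda>i. i - 1) ` {1..card T}"
    by (auto simp: image_iff intro!: bexI[of _ "Suc _"])
  finally show "enum T ` {1..card T} = T" by (simp add: enum_def image_image)
qed

lemma rank:
  assumes "finite T"
  shows "strict_mono_on T (rank T)" "rank T ` T = {1..card T}"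
    "i \<in> {1..card T} \<Longrightarrow> rank T (enum T i) = i" "x \<in> T \<Longrightarrow> enum T (rank T x) = x"
proof -
  note e = enum[OF assms]
  have inj: "inj_on (enum T) {1..card T}" using e(1) by (rule strict_mono_on_imp_inj_on)
  show 1: "rank T (enum T i) = i" if "i \<in> {1..card T}" for i
    using inj that by (simp add: rank_def)
  show 2: "enum T (rank T x) = x" if "x \<in> T" for x
    using that e(2) by (simp add: rank_def f_inv_into_f)
  show im: "rank T ` T = {1..card T}"
  proof -
    have "rank T ` enum T ` {1..card T} = {1..card T}"
      unfolding image_image using 1 by simp
    then show ?thesis using e(2) by simp
  qed
  show "strict_mono_on T (rank T)"
  proof (rule strict_mono_onI)
    fix x y assume xy: "x \<in> T" "y \<in> T" "x < y"
    have r: "rank T x \<in> {1..card T}" "rank T y \<in> {1..card T}" using im xy by auto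
    show "rank T x < rank T y"
      using strict_mono_on_less[OF e(1) r] 2 xy by simp
  qed
qed

section \<open>Kinds of heads\<close>

text \<open>The index of \<open>KindA\<close> is the number of singletons before the last block.\<close>

definition head_kind :: "symbol \<Rightarrow> kind"
  where "head_kind h = (if last h ! 0 < last h ! 1 then KindB else KindA (length h - 1))"

lemma head_kind_simp [simp]:
  "head_kind (singletons us @ [[p, q]]) = (if p < q then KindB else KindA (length us))"
  by (simp add: head_kind_def)

lemma heads_map:
  assumes "h \<in> heads S" "strict_mono_on S f"
  shows "map (map f) h \<in> heads (f ` S)" "head_kind (map (map f) h) = head_kind h"
proof -
  obtain us p q where h: "h = singletons us @ [[p, q]]" "distinct (us @ [p, q])" "set (us @ [p, q]) = S"
    "sorted_wrt (>) us" "p < q \<or> us \<noteq> [] \<and> last us < q \<and> q < p"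
    using assms(1) unfolding heads_def by blast
  have m: "map (map f) h = singletons (map f us) @ [[f p, f q]]" using h(1) by simp
  have less: "f a < f b \<longleftrightarrow> a < b" if "a \<in> S" "b \<in> S" for a b
    using assms(2) that by (rule strict_mono_on_less)
  have inj: "inj_on f S" using assms(2) by (rule strict_mono_on_imp_inj_on)
  have S: "p \<in> S" "q \<in> S" "set us \<subseteq> S" using h(3) by auto
  have "sorted_wrt (>) (map f us)"
    unfolding sorted_wrt_map
    by (rule sorted_wrt_mono_rel[OF _ h(4)]) (use less S in auto)
  moreover have "distinct (map f us @ [f p, f q])"
    using h(2,3) inj distinct_map[of f "us @ [p, q]"] by simp
  moreover have "set (map f us @ [f p, f q]) = f ` S" using h(3) by auto
  moreover have "f p < f q \<or> map f us \<noteq> [] \<and> last (map f us) < f q \<and> f q < f p"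
  proof (cases "p < q")
    case False
    then have "us \<noteq> []" "last us < q" "q < p" using h(5) by auto
    moreover have "last us \<in> S" using \<open>us \<noteq> []\<close> S(3) by auto
    ultimately show ?thesis using less S by (simp add: last_map)
  qed (use less S in simp)
  ultimately show "map (map f) h \<in> heads (f ` S)" unfolding m heads_iff by blast
  show "head_kind (map (map f) h) = head_kind h" unfolding m using h(1) less S by simp
qed

lemma heads_kind_card:
  "h \<in> heads T \<Longrightarrow> head_kind h = KindA m \<Longrightarrow> card T = m + 2 \<and> 1 \<le> m"
proof -
  assume h: "h \<in> heads T" "head_kind h = KindA m"
  then obtain us p q where u: "h = singletons us @ [[p, q]]" "distinct (us @ [p, q])" "set (us @ [p, q]) = T"
    "p < q \<or> us \<noteq> [] \<and> last us < q \<and> q < p" unfolding heads_def by blast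
  then have "length us = m" "\<not> p < q" using h(2) by (auto split: if_splits)
  moreover have "card T = length us + 2" using distinct_card[OF u(2)] u(3) by simp
  ultimately show ?thesis using u(4) by (cases us) auto
qed

lemma A_set_heads:
  assumes "1 \<le> m"
  shows "A_set (m + 2) m = zclass ` {h \<in> heads {1..m + 2}. head_kind h = KindA m}"
proof (intro equalityI subsetI)
  fix z assume "z \<in> A_set (m + 2) m"
  then obtain us p q vs where z: "z = zclass (singletons us @ [[p, q]] @ singletons vs)" "length us = m"
    "distinct (us @ [p, q] @ vs)" "set (us @ [p, q] @ vs) = {1..m + 2}"
    "sorted_wrt (>) us" "p > q" "q > last us"
    unfolding A_set_def by blast
  have "length (us @ [p, q] @ vs) = m + 2" using distinct_card[OF z(3)] z(4) by simp
  then have vs: "vs = []" using z(2) by simp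
  have "us \<noteq> []" using z(2) assms by auto
  then have "singletons us @ [[p, q]] \<in> {h \<in> heads {1..m + 2}. head_kind h = KindA m}"
    using z vs by (simp add: heads_iff)
  then show "z \<in> zclass ` {h \<in> heads {1..m + 2}. head_kind h = KindA m}" using z(1) vs by simp
next
  fix z assume "z \<in> zclass ` {h \<in> heads {1..m + 2}. head_kind h = KindA m}"
  then obtain h where h: "h \<in> heads {1..m + 2}" "head_kind h = KindA m" "z = zclass h" by blast
  then obtain us p q where u: "h = singletons us @ [[p, q]]" "distinct (us @ [p, q])"
    "set (us @ [p, q]) = {1..m + 2}" "sorted_wrt (>) us" "p < q \<or> us \<noteq> [] \<and> last us < q \<and> q < p"
    unfolding heads_def by blast
  then have "length us = m" "\<not> p < q" using h(2) by (auto split: if_splits)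
  then show "z \<in> A_set (m + 2) m"
    unfolding A_set_def using h(3) u
    by (intro CollectI exI[of _ us] exI[of _ p] exI[of _ q] exI[of _ "[]"]) simp
qed

definition first_head :: "symbol \<Rightarrow> symbol"
  where "first_head e = takeWhile (\<lambda>g. length g = 1) e @ [hd (dropWhile (\<lambda>g. length g = 1) e)]"

definition rest_head :: "symbol \<Rightarrow> symbol"
  where "rest_head e = tl (dropWhile (\<lambda>g. length g = 1) e)"

lemma first_rest_head:
  assumes "h \<in> heads T"
  shows "first_head (h @ r) = h" "rest_head (h @ r) = r"
proof -
  obtain us p q where h: "h = singletons us @ [[p, q]]" using assms unfolding heads_def by blast
  have "takeWhile (\<lambda>g. length g = 1) (singletons us @ [p, q] # r) = singletons us \<and>
    dropWhile (\<lambda>g. length g = 1) (singletons us @ [p, q] # r) = [p, q] # r"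
    by (induction us) auto
  then show "first_head (h @ r) = h" "rest_head (h @ r) = r"
    unfolding h by (auto simp: first_head_def rest_head_def)
qed

fun tuple_of :: "nat \<Rightarrow> symbol \<Rightarrow> kind list"
  where
    "tuple_of 0 e = []"
  | "tuple_of (Suc k) e = head_kind (first_head e) # tuple_of k (rest_head e)"

lemma B_set_2: "B_set 2 0 = {loop 1 2}"
proof -
  have l: "zclass [[1, 2]] = loop 1 2" using zclass_increasing_head[of 1 2 "[]"] by simp
  show ?thesis
  proof (intro equalityI subsetI)
    fix z assume "z \<in> B_set 2 0"
    then obtain p q vs where z: "z = zclass ([[p, q]] @ singletons vs)"
      "distinct ([p, q] @ vs)" "set ([p, q] @ vs) = {1..2}" "q > p"
      unfolding B_set_def by auto
    have "length ([p, q] @ vs) = 2" using distinct_card[OF z(2)] z(3) by simp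
    then have vs: "vs = []" by simp
    have "p \<in> {1..2}" "q \<in> {1..2}" using z(3) by auto
    then have "p = 1" "q = 2" using z(4) by auto
    then show "z \<in> {loop 1 2}" using z(1) vs l by simp
  next
    fix z assume "z \<in> {loop 1 2}"
    then have "z = zclass (singletons [] @ [[1, 2]] @ singletons [])" using l by simp
    moreover have "{1, 2} = {1..2 :: nat}" by auto
    ultimately show "z \<in> B_set 2 0"
      unfolding B_set_def
      by (intro CollectI exI[of _ "[]"] exI[of _ 1] exI[of _ 2] exI[of _ "[]"]) simp
  qed
qed

text \<open>The indices of the insertion maps that belong to a tuple: the free runs of singletons are those
before a barrier of kind \<open>KindB\<close> and the one after the last barrier.\<close>

definition slot :: "kind list \<Rightarrow> nat \<Rightarrow> bool"
  where "slot t j \<longleftrightarrow> j = length t \<or> (j < length t \<and> t ! j = KindB)"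

lemma slot_simps [simp]:
  "slot [] j \<longleftrightarrow> j = 0" "slot (kd # t) 0 \<longleftrightarrow> kd = KindB" "slot (kd # t) (Suc j) \<longleftrightarrow> slot t j"
  by (auto simp: slot_def)

lemma slot_le: "slot t j \<Longrightarrow> j \<le> length t"
  by (auto simp: slot_def)

lemma set_barrier_maps: "set (barrier_maps t) = {j. slot t j}"
  by (auto simp: barrier_maps_def slot_def)

section \<open>Internal direct sums\<close>

text \<open>A partition of a basis decomposes the space.\<close>

lemma internal_direct_sum_family:
  assumes fin: "finite I" and indep: "HV.indep_family w I" and c: "c ` I \<subseteq> Ts"
  shows "internal_direct_sum Ts (\<lambda>t. HV.span (w ` {e \<in> I. c e = t})) (HV.span (w ` I))"
  unfolding internal_direct_sum_def
proof (intro conjI ballI allI impI)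
  show "HV.subspace (HV.span (w ` {e \<in> I. c e = t}))" for t
    by (rule HV.subspace_span)
  show "HV.span (w ` I) = HV.span (\<Union>t\<in>Ts. HV.span (w ` {e \<in> I. c e = t}))"
  proof (intro equalityI HV.span_minimal HV.subspace_span)
    show "w ` I \<subseteq> HV.span (\<Union>t\<in>Ts. HV.span (w ` {e \<in> I. c e = t}))"
    proof
      fix z assume "z \<in> w ` I"
      then obtain e where e: "e \<in> I" "z = w e" by blast
      then have "z \<in> HV.span (w ` {f \<in> I. c f = c e})" by (intro HV.span_base) auto
      moreover have "c e \<in> Ts" using c e(1) by auto
      ultimately show "z \<in> HV.span (\<Union>t\<in>Ts. HV.span (w ` {e \<in> I. c e = t}))"
        by (intro HV.span_base) auto
    qed
    show "(\<Union>t\<in>Ts. HV.span (w ` {e \<in> I. c e = t})) \<subseteq> HV.span (w ` I)"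
      by (intro UN_least HV.span_mono) auto
  qed
next
  fix J x t
  assume *: "finite J \<and> J \<subseteq> Ts \<and> (\<forall>i\<in>J. x i \<in> HV.span (w ` {e \<in> I. c e = i})) \<and> sum x J = 0"
    and t: "t \<in> J"
  have "\<exists>a. x i = (\<Sum>e\<in>{e \<in> I. c e = i}. hscale (a e) (w e))" if "i \<in> J" for i
    using * that fin HV.span_image_sum[of "{e \<in> I. c e = i}" w] by auto
  then obtain a where a: "\<And>i. i \<in> J \<Longrightarrow> x i = (\<Sum>e\<in>{e \<in> I. c e = i}. hscale (a i e) (w e))"
    by metis
  define b where "b = (\<lambda>e. if c e \<in> J then a (c e) e else 0)"
  have "(\<Sum>e\<in>I. hscale (b e) (w e)) = (\<Sum>e\<in>{e \<in> I. c e \<in> J}. hscale (b e) (w e))"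
    using fin by (intro sum.mono_neutral_right) (auto simp: b_def)
  also have "\<dots> = (\<Sum>i\<in>J. \<Sum>e\<in>{e \<in> {e \<in> I. c e \<in> J}. c e = i}. hscale (b e) (w e))"
    using fin * by (intro sum.group[symmetric]) auto
  also have "\<dots> = (\<Sum>i\<in>J. x i)"
  proof (rule sum.cong)
    fix i assume i: "i \<in> J"
    then have "{e \<in> {e \<in> I. c e \<in> J}. c e = i} = {e \<in> I. c e = i}" by auto
    then show "(\<Sum>e\<in>{e \<in> {e \<in> I. c e \<in> J}. c e = i}. hscale (b e) (w e)) = x i"
      using a[OF i] i by (simp add: b_def)
  qed simp
  finally have "(\<Sum>e\<in>I. hscale (b e) (w e)) = 0" using * by simp
  then have b0: "\<And>e. e \<in> I \<Longrightarrow> b e = 0" using indep unfolding HV.indep_family_def by blast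
  show "x t = 0"
    unfolding a[OF t]
  proof (rule sum.neutral, rule ballI)
    fix e assume "e \<in> {e \<in> I. c e = t}"
    then show "hscale (a t e) (w e) = 0" using b0[of e] t by (simp add: b_def)
  qed
qed

lemma internal_direct_sum_cong:
  assumes "internal_direct_sum I W' V" "\<And>i. i \<in> I \<Longrightarrow> W i = W' i"
  shows "internal_direct_sum I W V"
  unfolding internal_direct_sum_def
proof (intro conjI allI impI ballI)
  show "HV.subspace (W i)" if "i \<in> I" for i
    using assms that unfolding internal_direct_sum_def by simp
  have "(\<Union>i\<in>I. W i) = (\<Union>i\<in>I. W' i)" using assms(2) by simp
  then show "V = HV.span (\<Union>i\<in>I. W i)"
    using assms(1) unfolding internal_direct_sum_def by simp
  fix J x i
  assume "finite J \<and> J \<subseteq> I \<and> (\<forall>i\<in>J. x i \<in> W i) \<and> sum x J = 0" "i \<in> J"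
  moreover from this have "\<forall>i\<in>J. x i \<in> W' i" using assms(2) by blast
  ultimately show "x i = 0" using assms(1) unfolding internal_direct_sum_def by blast
qed

section \<open>Products of generators\<close>

locale admissible_family =
  fixes A' :: "nat \<Rightarrow> nat \<Rightarrow> hclass set"
  assumes admissible: "admissible A'"
begin

lemma A'_facts:
  assumes "1 \<le> m"
  shows "finite (A' (m + 2) m)" "A' (m + 2) m \<subseteq> Hk 1 (m + 2)"
    "card (A' (m + 2) m) = card (A_set (m + 2) m)"
    "HV.span (A' (m + 2) m) = generated 1 [1] (m + 2) (HV.span (A' (m + 2) m)) (m + 2)"
proof -
  have "3 \<le> m + 2 \<and> 1 \<le> m \<and> m \<le> m + 2 - 2" using assms by simp
  note * = admissible[unfolded admissible_def, THEN spec[of _ "m + 2"], THEN spec[of _ m], THEN mp, OF this]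
  show "finite (A' (m + 2) m)" using * by (elim conjE)
  show "A' (m + 2) m \<subseteq> Hk 1 (m + 2)" using * by (elim conjE)
  show "card (A' (m + 2) m) = card (A_set (m + 2) m)" using * by (elim conjE)
  show "HV.span (A' (m + 2) m) = generated 1 [1] (m + 2) (HV.span (A' (m + 2) m)) (m + 2)"
    using * by (elim conjE)
qed

lemma A'_span:
  assumes "3 \<le> n" "1 \<le> m" "m \<le> n - 2"
  shows "HV.span (B_set n 0 \<union> (\<Union>l\<in>{1..m}. A' n l \<union> B_set n l)) =
      HV.span (B_set n 0 \<union> (\<Union>l\<in>{1..m}. A_set n l \<union> B_set n l))"
proof -
  have "3 \<le> n \<and> 1 \<le> m \<and> m \<le> n - 2" using assms by simp
  from admissible[unfolded admissible_def, THEN spec[of _ n], THEN spec[of _ m], THEN mp, OF this]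
  show ?thesis by (elim conjE)
qed

lemma generated_invariant:
  assumes "x \<in> generated k js N G n" "\<tau> permutes {1..n}"
  shows "hrelabel \<tau> x \<in> generated k js N G n"
  unfolding generated_def
proof (rule InterI, clarify)
  fix W assume W: "\<forall>i. subrep k i (W i)" "G \<subseteq> W N"
    "\<forall>i. \<forall>j\<in>set js. hiota k i j ` W i \<subseteq> W (Suc i)"
  then have "x \<in> W n" using assms(1) unfolding generated_def by blast
  then show "hrelabel \<tau> x \<in> W n" using W(1) assms(2) unfolding subrep_def by blast
qed

text \<open>The span is a term of a generated submodule, hence a subrepresentation.\<close>

lemma A'_invariant:
  assumes "1 \<le> m" "x \<in> A' (m + 2) m" "\<tau> permutes {1..m + 2}"
  shows "hrelabel \<tau> x \<in> HV.span (A' (m + 2) m)"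
proof -
  have "x \<in> generated 1 [1] (m + 2) (HV.span (A' (m + 2) m)) (m + 2)"
    using A'_facts(4)[OF assms(1)] HV.span_base[OF assms(2)] by simp
  then have "hrelabel \<tau> x \<in> generated 1 [1] (m + 2) (HV.span (A' (m + 2) m)) (m + 2)"
    using generated_invariant assms(3) by blast
  then show ?thesis using A'_facts(4)[OF assms(1)] by simp
qed

text \<open>The classes that one barrier of the given kind contributes on the label set \<open>T\<close>. A factor of kind
\<open>KindB\<close> includes the free run of singletons before its barrier, of any length; for
\<open>KindA m\<close> the number of labels is determined.\<close>

fun factors :: "kind \<Rightarrow> nat set \<Rightarrow> hclass set"
  where
    "factors KindB T = {sings us * loop a b | us a b. distinct (us @ [a, b]) \<and> set (us @ [a, b]) = T}"
  | "factors (KindA m) T = {hrelabel f x | f x. x \<in> A' (m + 2) m \<and>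
      strict_mono_on {1..m + 2} f \<and> f ` {1..m + 2} = T}"

fun products :: "kind list \<Rightarrow> nat set \<Rightarrow> hclass set"
  where
    "products [] S = {sings us | us. distinct us \<and> set us = S}"
  | "products (kd # t) S = {x * y | x y T. T \<subseteq> S \<and> x \<in> factors kd T \<and> y \<in> products t (S - T)}"

lemma products_ConsI:
  "T \<subseteq> S \<Longrightarrow> x \<in> factors kd T \<Longrightarrow> y \<in> products t (S - T) \<Longrightarrow> x * y \<in> products (kd # t) S"
  unfolding products.simps by blast

definition valid :: "kind list \<Rightarrow> bool"
  where "valid t \<longleftrightarrow> KindA 0 \<notin> set t"

lemma valid_simps [simp]: "valid []" "valid (kd # t) \<longleftrightarrow> kd \<noteq> KindA 0 \<and> valid t"
  by (auto simp: valid_def)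

lemma barrier_tuples_valid: "t \<in> barrier_tuples k \<longleftrightarrow> length t = k \<and> valid t"
  by (auto simp: barrier_tuples_def valid_def) (metis Suc_leI neq0_conv)

lemma factors_homology:
  assumes "x \<in> factors kd T" "kd \<noteq> KindA 0"
  shows "x \<in> homology2 T 1"
proof (cases kd)
  case KindB
  then obtain us a b where x: "x = sings us * loop a b" "distinct (us @ [a, b])" "set (us @ [a, b]) = T"
    using assms(1) by auto
  have "set us \<inter> {a, b} = {}" using x(2) by auto
  with homology2_mult[OF sings_homology loop_homology, of us a b] x
  have "x \<in> homology2 (set us \<union> {a, b}) 1" by simp
  moreover have "set us \<union> {a, b} = T" using x(3) by auto
  ultimately show ?thesis by simp
next
  case (KindA m)
  then obtain f y where x: "x = hrelabel f y" "y \<in> A' (m + 2) m" "strict_mono_on {1..m + 2} f"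
    "f ` {1..m + 2} = T" using assms(1) by auto
  have "y \<in> Hk 1 (m + 2)" using A'_facts(2)[of m] x(2) assms(2) KindA by (cases m) auto
  then show ?thesis
    using homology2_hrelabel[OF _ strict_mono_on_imp_inj_on[OF x(3)]] x by blast
qed

lemma products_homology:
  "x \<in> products t S \<Longrightarrow> valid t \<Longrightarrow> x \<in> homology2 S (length t)"
proof (induction t arbitrary: x S)
  case Nil
  then show ?case using sings_homology by auto
next
  case (Cons kd t)
  then obtain a y T where x: "x = a * y" "T \<subseteq> S" "a \<in> factors kd T" "y \<in> products t (S - T)" by auto
  have "a * y \<in> homology2 (T \<union> (S - T)) (1 + length t)"
    using Cons x by (intro homology2_mult factors_homology) auto
  then show ?case using x(1,2) by (simp add: Un_absorb1)
qed

lemma factors_card: "x \<in> factors kd T \<Longrightarrow> finite T \<and> kind_degree kd \<le> card T"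
proof (cases kd)
  case KindB
  assume "x \<in> factors kd T"
  then obtain us a b where x: "distinct (us @ [a, b])" "set (us @ [a, b]) = T" using KindB by auto
  have "card T = length us + 2" using distinct_card[OF x(1)] x(2) by simp
  then show ?thesis using KindB x(2) by auto
next
  case (KindA m)
  assume "x \<in> factors kd T"
  then obtain f where f: "strict_mono_on {1..m + 2} f" "f ` {1..m + 2} = T" using KindA by auto
  then have "card T = m + 2" using card_image[OF strict_mono_on_imp_inj_on[OF f(1)]] by simp
  then show ?thesis using KindA f(2) by auto
qed

lemma products_card: "x \<in> products t S \<Longrightarrow> finite S \<and> tuple_degree t \<le> card S"
proof (induction t arbitrary: x S)
  case Nil
  then show ?case by (auto simp: tuple_degree_def)
next
  case (Cons kd t)
  then obtain a y T where x: "T \<subseteq> S" "a \<in> factors kd T" "y \<in> products t (S - T)" by auto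
  have 1: "finite T" "kind_degree kd \<le> card T" using factors_card[OF x(2)] by auto
  have 2: "finite (S - T)" "tuple_degree t \<le> card (S - T)" using Cons.IH[OF x(3)] by auto
  have "finite S" using 1 2 by simp
  moreover have "card S = card T + card (S - T)"
    using x(1) \<open>finite S\<close> by (simp add: card_Diff_subset 1 card_mono)
  ultimately show ?case using 1 2 by (simp add: tuple_degree_def)
qed

lemma span_products_mult:
  assumes "T \<subseteq> S" "x \<in> HV.span (factors kd T)" "y \<in> HV.span (products t (S - T))"
  shows "x * y \<in> HV.span (products (kd # t) S)"
  using assms(2,3) HV.subspace_span
proof (rule span_mult)
  fix a b assume "a \<in> factors kd T" "b \<in> products t (S - T)"
  then show "a * b \<in> HV.span (products (kd # t) S)" using assms(1) by (intro HV.span_base) auto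
qed

text \<open>The relabeling \<open>\<sigma> \<circ> f\<close> is the increasing enumeration of its image after a permutation,
and the span of the admissible set is invariant under permutations.\<close>

lemma factors_relabel:
  assumes "x \<in> factors kd T" "kd \<noteq> KindA 0" "inj_on \<sigma> T"
  shows "hrelabel \<sigma> x \<in> HV.span (factors kd (\<sigma> ` T))"
proof (cases kd)
  case KindB
  then obtain us a b where x: "x = sings us * loop a b" "distinct (us @ [a, b])" "set (us @ [a, b]) = T"
    using assms(1) by auto
  have "\<sigma> a \<noteq> \<sigma> b" using x(2,3) assms(3) by (auto simp: inj_on_def)
  then have "hrelabel \<sigma> x = sings (map \<sigma> us) * loop (\<sigma> a) (\<sigma> b)"
    using x(1,2) by (simp add: hrelabel_sings hrelabel_piece_class)
  moreover have "distinct (map \<sigma> us @ [\<sigma> a, \<sigma> b])"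
    using x(2,3) assms(3) distinct_map[of \<sigma> "us @ [a, b]"] by simp
  moreover have "set (map \<sigma> us @ [\<sigma> a, \<sigma> b]) = \<sigma> ` T" using x(3) by auto
  ultimately have "hrelabel \<sigma> x \<in> factors kd (\<sigma> ` T)"
    unfolding KindB factors.simps by blast
  then show ?thesis by (rule HV.span_base)
next
  case (KindA m)
  then obtain f y where x: "x = hrelabel f y" "y \<in> A' (m + 2) m" "strict_mono_on {1..m + 2} f"
    "f ` {1..m + 2} = T" using assms(1) by auto
  have m: "1 \<le> m" using assms(2) KindA by (cases m) auto
  have y: "y \<in> Hk 1 (m + 2)" using A'_facts(2)[OF m] x(2) by auto
  have fT: "finite T" "card T = m + 2"
    using x(4) card_image[OF strict_mono_on_imp_inj_on[OF x(3)]] by auto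
  let ?R = "\<sigma> ` T"
  have R: "finite ?R" "card ?R = m + 2" using fT card_image[OF assms(3)] by auto
  note e = enum[OF R(1), unfolded R(2)] and r = rank[OF R(1), unfolded R(2)]
  let ?N = "{1..m + 2}"
  \<comment> \<open>the permutation with \<open>\<sigma> \<circ> f = enum (\<sigma> ` T) \<circ> \<tau>\<close> on \<open>{1..m + 2}\<close>\<close>
  define \<tau> where "\<tau> i = (if i \<in> ?N then rank ?R (\<sigma> (f i)) else i)" for i
  have "bij_betw \<tau> ?N ?N"
  proof -
    have "bij_betw f ?N T" using x(3,4) strict_mono_on_imp_inj_on by (auto simp: bij_betw_def)
    moreover have "bij_betw \<sigma> T ?R" using assms(3) by (simp add: bij_betw_def)
    moreover have "bij_betw (rank ?R) ?R ?N"
      using r(1,2) strict_mono_on_imp_inj_on by (auto simp: bij_betw_def)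
    ultimately have "bij_betw (rank ?R \<circ> (\<sigma> \<circ> f)) ?N ?N" by (meson bij_betw_trans)
    then show ?thesis by (rule bij_betw_cong[THEN iffD1, rotated]) (simp add: \<tau>_def)
  qed
  then have perm: "\<tau> permutes ?N" by (rule bij_imp_permutes) (auto simp: \<tau>_def)
  have "hrelabel \<sigma> x = hrelabel (\<sigma> \<circ> f) y" using x(1) by simp
  also have "\<dots> = hrelabel (enum ?R \<circ> \<tau>) y"
  proof (rule hrelabel_cong[OF y])
    fix i assume i: "i \<in> ?N"
    then have "\<sigma> (f i) \<in> ?R" using x(4) by auto
    then show "(\<sigma> \<circ> f) i = (enum ?R \<circ> \<tau>) i" using i r(4) by (simp add: \<tau>_def)
  qed
  also have "\<dots> = hrelabel (enum ?R) (hrelabel \<tau> y)" by simp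
  also have "\<dots> \<in> HV.span (hrelabel (enum ?R) ` A' (m + 2) m)"
    by (rule hrelabel_span[OF A'_invariant[OF m x(2) perm]])
  also have "\<dots> \<subseteq> HV.span (factors kd ?R)"
    using e KindA by (intro HV.span_mono) auto
  finally show ?thesis .
qed

lemma products_relabel:
  assumes "x \<in> products t S" "valid t" "inj_on \<sigma> S"
  shows "hrelabel \<sigma> x \<in> HV.span (products t (\<sigma> ` S))"
  using assms
proof (induction t arbitrary: x S)
  case Nil
  then obtain us where us: "x = sings us" "distinct us" "set us = S" by auto
  then have "distinct (map \<sigma> us)" "set (map \<sigma> us) = \<sigma> ` S" using Nil.prems(3) by (auto simp: distinct_map)
  then have "hrelabel \<sigma> x \<in> products [] (\<sigma> ` S)" using us by (auto simp: hrelabel_sings)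
  then show ?case by (rule HV.span_base)
next
  case (Cons kd t)
  then obtain a y T where x: "x = a * y" "T \<subseteq> S" "a \<in> factors kd T" "y \<in> products t (S - T)" by auto
  have inj: "inj_on \<sigma> T" "inj_on \<sigma> (S - T)" using Cons.prems(3) x(2) by (auto intro: inj_on_subset)
  have "\<sigma> ` (S - T) = \<sigma> ` S - \<sigma> ` T" using inj_on_image_set_diff[OF Cons.prems(3)] x(2) by blast
  then have "hrelabel \<sigma> y \<in> HV.span (products t (\<sigma> ` S - \<sigma> ` T))"
    using Cons.IH[OF x(4) _ inj(2)] Cons.prems(2) by simp
  moreover have "hrelabel \<sigma> a \<in> HV.span (factors kd (\<sigma> ` T))"
    using factors_relabel[OF x(3) _ inj(1)] Cons.prems(2) by simp
  ultimately show ?case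
    using span_products_mult[of "\<sigma> ` T" "\<sigma> ` S"] x(1,2) by (simp add: image_mono)
qed

section \<open>A second basis\<close>

lemma ex_bij_A': "1 \<le> m \<Longrightarrow> \<exists>\<phi>. bij_betw \<phi> (A_set (m + 2) m) (A' (m + 2) m)"
proof -
  assume m: "1 \<le> m"
  have "{h \<in> heads {1..m + 2}. head_kind h = KindA m} \<subseteq> crit {1..m + 2} 1"
    using heads_crit by blast
  then have "finite (A_set (m + 2) m)"
    unfolding A_set_heads[OF m] using finite_subset finite_crit by blast
  then show ?thesis using finite_same_card_bij A'_facts(1,3)[OF m] by metis
qed

text \<open>An arbitrary bijection suffices: only the number of elements and the spans of the two families are
compared.\<close>

definition match :: "nat \<Rightarrow> hclass \<Rightarrow> hclass"
  where "match m = (SOME \<phi>. bij_betw \<phi> (A_set (m + 2) m) (A' (m + 2) m))"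

lemma match: "1 \<le> m \<Longrightarrow> bij_betw (match m) (A_set (m + 2) m) (A' (m + 2) m)"
  unfolding match_def by (rule someI_ex[OF ex_bij_A'])

text \<open>The class of a head, with the elements of type \<open>A\<close> exchanged for those of the admissible family.\<close>

definition head_class :: "symbol \<Rightarrow> hclass"
  where "head_class h = (case head_kind h of KindB \<Rightarrow> zclass h
    | KindA m \<Rightarrow> hrelabel (enum (labels h)) (match m (zclass (map (map (rank (labels h))) h))))"

fun product_class :: "nat \<Rightarrow> symbol \<Rightarrow> hclass"
  where
    "product_class 0 e = zclass e"
  | "product_class (Suc k) e = head_class (first_head e) * product_class k (rest_head e)"

lemma heads_labels: "h \<in> heads T \<Longrightarrow> labels h = T"
  using heads_crit[of h T] cells2_labels[of h T] by (simp add: crit_def)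

text \<open>Every factor comes from a head: two orders of the singletons or of the two labels of a barrier
give the same class, so they can be chosen as in a head.\<close>

lemma factors_heads:
  assumes "finite T" "kd \<noteq> KindA 0"
  shows "factors kd T = head_class ` {h \<in> heads T. head_kind h = kd}"
proof (cases kd)
  case KindB
  show ?thesis
  proof (intro equalityI subsetI)
    fix x assume "x \<in> factors kd T"
    then obtain us a b where x: "x = sings us * loop a b" "distinct (us @ [a, b])" "set (us @ [a, b]) = T"
      using KindB by auto
    define vs where "vs = rev (sorted_list_of_set (set us))"
    have vs: "set vs = set us" "distinct vs" "sorted_wrt (>) vs"
      using strict_sorted_list_of_set[of "set us"] by (auto simp: vs_def sorted_wrt_rev)
    define p q where "p = min a b" and "q = max a b"
    have pq: "p < q" "loop p q = loop a b" "{p, q} = {a, b}"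
      using x(2) loop_commute[of a b] by (auto simp: p_def q_def min_def max_def)
    have d: "distinct (vs @ [p, q])" "set (vs @ [p, q]) = T" using vs x(2,3) pq(1,3) by auto
    let ?h = "singletons vs @ [[p, q]]"
    have h: "?h \<in> heads T" "head_kind ?h = KindB" unfolding heads_iff using d vs pq(1) by auto
    have "head_class ?h = sings vs * loop p q"
      unfolding head_class_def h(2) using zclass_increasing_head[OF pq(1) d(1)] by simp
    also have "\<dots> = x" using x(1,2) pq(2) sings_set[of vs us] vs by simp
    finally show "x \<in> head_class ` {h \<in> heads T. head_kind h = kd}" using h KindB by blast
  next
    fix x assume "x \<in> head_class ` {h \<in> heads T. head_kind h = kd}"
    then obtain h where h: "h \<in> heads T" "head_kind h = KindB" "x = head_class h" using KindB by blast
    then obtain us p q where u: "h = singletons us @ [[p, q]]" "distinct (us @ [p, q])"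
      "set (us @ [p, q]) = T" unfolding heads_def by blast
    then have "p < q" using h(2) by (auto split: if_splits)
    then have "x = sings us * loop p q"
      unfolding h(3) head_class_def h(2) using zclass_increasing_head u by simp
    then show "x \<in> factors kd T" using u(2,3) KindB by auto
  qed
next
  case (KindA m)
  have m: "1 \<le> m" using assms(2) KindA by (cases m) auto
  show ?thesis
  proof (intro equalityI subsetI)
    fix x assume "x \<in> factors kd T"
    then obtain f y where x: "x = hrelabel f y" "y \<in> A' (m + 2) m" "strict_mono_on {1..m + 2} f"
      "f ` {1..m + 2} = T" using KindA by auto
    have T: "card T = m + 2" using x(4) card_image[OF strict_mono_on_imp_inj_on[OF x(3)]] by auto
    note e = enum[OF assms(1), unfolded T] and r = rank[OF assms(1), unfolded T]
    obtain z where z: "z \<in> A_set (m + 2) m" "y = match m z"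
      using x(2) match[OF m] by (auto simp: bij_betw_def)
    obtain h0 where h0: "h0 \<in> heads {1..m + 2}" "head_kind h0 = KindA m" "z = zclass h0"
      using z(1) unfolding A_set_heads[OF m] by blast
    let ?h = "map (map (enum T)) h0"
    have h: "?h \<in> heads T" "head_kind ?h = KindA m" using heads_map[OF h0(1) e(1)] e(2) h0(2) by auto
    have "map (map (rank T)) ?h = h0"
    proof -
      have "rank T (enum T i) = i" if "i \<in> set g" "g \<in> set h0" for i g
      proof -
        have "i \<in> labels h0" using that by (auto simp: labels_def)
        then show ?thesis using r(3) heads_labels[OF h0(1)] by simp
      qed
      then show ?thesis by (auto simp: map_idI comp_def)
    qed
    then have "head_class ?h = hrelabel (enum T) y"
      unfolding head_class_def h(2) heads_labels[OF h(1)] using z(2) h0(3) by simp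
    also have "\<dots> = x"
      unfolding x(1)
      by (rule hrelabel_cong[of _ "{1..m + 2}" 1])
        (use A'_facts(2)[OF m] x(2) strict_mono_enum[OF x(3)] x(4) in auto)
    finally show "x \<in> head_class ` {h \<in> heads T. head_kind h = kd}" using h KindA by blast
  next
    fix x assume "x \<in> head_class ` {h \<in> heads T. head_kind h = kd}"
    then obtain h where h: "h \<in> heads T" "head_kind h = KindA m" "x = head_class h" using KindA by blast
    then have T: "card T = m + 2" using heads_kind_card by blast
    note e = enum[OF assms(1), unfolded T] and r = rank[OF assms(1), unfolded T]
    have "zclass (map (map (rank T)) h) \<in> A_set (m + 2) m"
      unfolding A_set_heads[OF m] using heads_map[OF h(1) r(1)] r(2) h(2) by auto
    then have "match m (zclass (map (map (rank T)) h)) \<in> A' (m + 2) m"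
      using match[OF m] by (auto simp: bij_betw_def)
    then show "x \<in> factors kd T"
      unfolding h(3) head_class_def h(2) heads_labels[OF h(1)] using e KindA by auto
  qed
qed

lemma heads_kind_valid: "h \<in> heads T \<Longrightarrow> head_kind h \<noteq> KindA 0"
  using heads_kind_card[of h T 0] by auto

lemma products_crit:
  assumes "finite S" "valid t"
  shows "products t S = product_class (length t) ` {e \<in> crit S (length t). tuple_of (length t) e = t}"
  using assms
proof (induction t arbitrary: S)
  case Nil
  show ?case
  proof (intro equalityI subsetI)
    fix x assume "x \<in> products [] S"
    then obtain us where us: "x = sings us" "distinct us" "set us = S" by auto
    define vs where "vs = rev (sorted_list_of_set S)"
    have vs: "set vs = S" "distinct vs" "sorted_wrt (>) vs"
      using strict_sorted_list_of_set[of S] Nil by (auto simp: vs_def sorted_wrt_rev)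
    then have "singletons vs \<in> crit S 0" unfolding crit_0_iff by blast
    moreover have "x = zclass (singletons vs)"
      using us vs sings_set[of us vs] zclass_singletons by simp
    ultimately show "x \<in> product_class (length []) ` {e \<in> crit S (length []). tuple_of (length []) e = []}"
      by auto
  next
    fix x assume "x \<in> product_class (length []) ` {e \<in> crit S (length []). tuple_of (length []) e = []}"
    then obtain e where "e \<in> crit S 0" "x = zclass e" by auto
    then show "x \<in> products [] S" unfolding crit_0_iff using zclass_singletons by auto
  qed
next
  case (Cons kd t)
  have kd: "kd \<noteq> KindA 0" and t: "valid t" using Cons.prems by auto
  show ?case
  proof (intro equalityI subsetI)
    fix x assume "x \<in> products (kd # t) S"
    then obtain a y T where x: "x = a * y" "T \<subseteq> S" "a \<in> factors kd T" "y \<in> products t (S - T)" by auto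
    have fin: "finite T" "finite (S - T)" using Cons.prems(1) x(2) finite_subset by auto
    obtain h where h: "h \<in> heads T" "head_kind h = kd" "a = head_class h"
      using x(3) unfolding factors_heads[OF fin(1) kd] by blast
    obtain r where r: "r \<in> crit (S - T) (length t)" "tuple_of (length t) r = t"
      "y = product_class (length t) r"
      using x(4) unfolding Cons.IH[OF fin(2) t] by blast
    have "h @ r \<in> crit S (length (kd # t))" using crit_Suc_iff h(1) r(1) x(2) by auto
    moreover have "tuple_of (length (kd # t)) (h @ r) = kd # t"
      "product_class (length (kd # t)) (h @ r) = x"
      using first_rest_head[OF h(1)] h r x(1) by auto
    ultimately show "x \<in> product_class (length (kd # t)) `
        {e \<in> crit S (length (kd # t)). tuple_of (length (kd # t)) e = kd # t}"
      by blast
  next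
    fix x assume "x \<in> product_class (length (kd # t)) `
        {e \<in> crit S (length (kd # t)). tuple_of (length (kd # t)) e = kd # t}"
    then obtain e where e: "e \<in> crit S (Suc (length t))" "tuple_of (Suc (length t)) e = kd # t"
      "x = product_class (Suc (length t)) e" by auto
    then obtain T h r where h: "T \<subseteq> S" "h \<in> heads T" "r \<in> crit (S - T) (length t)" "e = h @ r"
      using crit_Suc_iff by blast
    have fin: "finite T" "finite (S - T)" using Cons.prems(1) h(1) finite_subset by auto
    have k: "head_kind h = kd" "tuple_of (length t) r = t" "x = head_class h * product_class (length t) r"
      using e(2,3) first_rest_head[OF h(2)] h(4) by auto
    have "head_class h \<in> factors kd T" unfolding factors_heads[OF fin(1) kd] using h(2) k(1) by blast
    moreover have "product_class (length t) r \<in> products t (S - T)"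
      unfolding Cons.IH[OF fin(2) t] using h(3) k(2) by blast
    ultimately show "x \<in> products (kd # t) S" using h(1) k(3) by auto
  qed
qed

lemma tuple_of_valid: "e \<in> crit S k \<Longrightarrow> tuple_of k e \<in> barrier_tuples k"
  unfolding barrier_tuples_valid
proof (induction k arbitrary: e S)
  case (Suc k)
  then obtain T h r where h: "T \<subseteq> S" "h \<in> heads T" "r \<in> crit (S - T) k" "e = h @ r"
    unfolding crit_Suc_iff by blast
  then show ?case using Suc.IH[OF h(3)] first_rest_head[OF h(2)] heads_kind_valid[OF h(2)] by simp
qed simp

definition all_products :: "nat \<Rightarrow> nat set \<Rightarrow> hclass set"
  where "all_products k S = (\<Union>t\<in>barrier_tuples k. products t S)"

lemma all_products_crit: "finite S \<Longrightarrow> all_products k S = product_class k ` crit S k"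
  unfolding all_products_def using products_crit tuple_of_valid
  by (fastforce simp: barrier_tuples_valid)

lemma all_products_mult:
  assumes "x \<in> factors kd T" "kd \<noteq> KindA 0" "T \<subseteq> S" "y \<in> HV.span (all_products k (S - T))"
  shows "x * y \<in> HV.span (all_products (Suc k) S)"
  using HV.span_base[of x "{x}"] assms(4) HV.subspace_span
proof (rule span_mult)
  fix a b assume "a \<in> {x}" "b \<in> all_products k (S - T)"
  then obtain t where t: "a = x" "length t = k" "valid t" "b \<in> products t (S - T)"
    by (auto simp: all_products_def barrier_tuples_valid)
  then have "a * b \<in> products (kd # t) S" "kd # t \<in> barrier_tuples (Suc k)"
    using assms by (auto simp: barrier_tuples_valid)
  then have "a * b \<in> all_products (Suc k) S" unfolding all_products_def by blast
  then show "a * b \<in> HV.span (all_products (Suc k) S)" by (rule HV.span_base)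
qed simp

text \<open>The classes on \<open>m + 2\<close> labels whose run before the barrier has fewer than \<open>m\<close> singletons.\<close>

definition shorter_runs :: "nat \<Rightarrow> hclass set"
  where "shorter_runs m = B_set (m + 2) 0 \<union> (\<Union>l\<in>{1..m - 1}. A_set (m + 2) l \<union> B_set (m + 2) l)"

text \<open>The equality of spans is used for \<open>m\<close> and for \<open>m - 1\<close>: the latter exchanges the elements of the
admissible family with shorter runs for elements of \<open>A_set\<close>. For \<open>m = 1\<close> both sides of the latter
are \<open>B_set 3 0\<close>.\<close>

lemma A_set_span:
  assumes "1 \<le> m"
  shows "A_set (m + 2) m \<subseteq> HV.span (A' (m + 2) m \<union> B_set (m + 2) m \<union> shorter_runs m)"
proof -
  let ?n = "m + 2"
  let ?Q = "\<lambda>l. B_set ?n 0 \<union> (\<Union>i\<in>{1..l}. A' ?n i \<union> B_set ?n i)"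
  let ?R = "\<lambda>l. B_set ?n 0 \<union> (\<Union>i\<in>{1..l}. A_set ?n i \<union> B_set ?n i)"
  let ?V = "HV.span (A' ?n m \<union> B_set ?n m \<union> shorter_runs m)"
  have "HV.span (?Q (m - 1)) = HV.span (?R (m - 1))"
  proof (cases "m = 1")
    case False
    then show ?thesis using assms by (intro A'_span) auto
  qed simp
  then have low: "?Q (m - 1) \<subseteq> HV.span (shorter_runs m)"
    using HV.span_superset[of "?Q (m - 1)"] by (simp only: shorter_runs_def)
  have "{1..m} = insert m {1..m - 1}" using assms by auto
  then have "?Q m = ?Q (m - 1) \<union> A' ?n m \<union> B_set ?n m" by auto
  also have "\<dots> \<subseteq> ?V"
  proof -
    have "HV.span (shorter_runs m) \<subseteq> ?V" by (rule HV.span_mono) auto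
    moreover have "A' ?n m \<union> B_set ?n m \<subseteq> ?V"
      using HV.span_superset[of "A' ?n m \<union> B_set ?n m \<union> shorter_runs m"] by blast
    ultimately show ?thesis using low by blast
  qed
  finally have "HV.span (?Q m) \<subseteq> ?V" by (intro HV.span_minimal HV.subspace_span)
  moreover have "HV.span (?Q m) = HV.span (?R m)" using assms by (intro A'_span) auto
  moreover have "A_set ?n m \<subseteq> HV.span (?R m)"
  proof -
    have "m \<in> {1..m}" using assms by simp
    then have "A_set ?n m \<subseteq> ?R m" by blast
    also have "\<dots> \<subseteq> HV.span (?R m)" by (rule HV.span_superset)
    finally show ?thesis .
  qed
  ultimately show ?thesis by blast
qed

lemma shorter_runs_cases:
  assumes "1 \<le> m" "z \<in> shorter_runs m"
  obtains us p q vs where "z = zclass (singletons us @ [p, q] # singletons vs)"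
    "singletons us @ [[p, q]] \<in> heads (set (us @ [p, q]))"
    "distinct (us @ [p, q] @ vs)" "set (us @ [p, q] @ vs) = {1..m + 2}" "length us < m"
proof -
  from assms(2) consider l where "l < m" "z \<in> B_set (m + 2) l" | l where "1 \<le> l" "l < m" "z \<in> A_set (m + 2) l"
  proof -
    from assms(2) have "z \<in> B_set (m + 2) 0 \<or> (\<exists>l\<in>{1..m - 1}. z \<in> A_set (m + 2) l \<or> z \<in> B_set (m + 2) l)"
      unfolding shorter_runs_def by blast
    then show ?thesis
    proof (elim disjE bexE)
      assume "z \<in> B_set (m + 2) 0"
      then show ?thesis using assms(1) that(1)[of 0] by simp
    next
      fix l assume "l \<in> {1..m - 1}" "z \<in> A_set (m + 2) l"
      then show ?thesis using assms(1) by (intro that(2)[of l]) auto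
    next
      fix l assume "l \<in> {1..m - 1}" "z \<in> B_set (m + 2) l"
      then show ?thesis using assms(1) by (intro that(1)[of l]) auto
    qed
  qed
  then show ?thesis
  proof cases
    case 1
    then obtain us p q vs where "z = zclass (singletons us @ [[p, q]] @ singletons vs)" "length us = l"
      "distinct (us @ [p, q] @ vs)" "set (us @ [p, q] @ vs) = {1..m + 2}"
      "sorted_wrt (>) us" "q > p" unfolding B_set_def by blast
    then show ?thesis using 1(1) that[of us p q vs] by (simp add: heads_iff)
  next
    case 2
    then obtain us p q vs where z: "z = zclass (singletons us @ [[p, q]] @ singletons vs)" "length us = l"
      "distinct (us @ [p, q] @ vs)" "set (us @ [p, q] @ vs) = {1..m + 2}"
      "sorted_wrt (>) us" "p > q" "q > last us" unfolding A_set_def by blast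
    then have "us \<noteq> []" using 2(1) by auto
    then show ?thesis using 2(2) z that[of us p q vs] by (simp add: heads_iff)
  qed
qed

lemma B_set_top:
  assumes "z \<in> B_set (m + 2) m"
  obtains h where "h \<in> heads {1..m + 2}" "head_kind h = KindB" "z = zclass h"
proof -
  obtain us p q vs where z: "z = zclass (singletons us @ [[p, q]] @ singletons vs)" "length us = m"
    "distinct (us @ [p, q] @ vs)" "set (us @ [p, q] @ vs) = {1..m + 2}"
    "sorted_wrt (>) us" "q > p" using assms unfolding B_set_def by blast
  have "length (us @ [p, q] @ vs) = m + 2" using distinct_card[OF z(3)] z(4) by simp
  then have "vs = []" using z(2) by simp
  then show ?thesis using z that[of "singletons us @ [[p, q]]"] by (simp add: heads_iff)
qed

text \<open>Induction on the size of the head. A head of type \<open>A\<close> is replaced by means of \<open>A_set_span\<close>; in the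
terms from \<open>shorter_runs m\<close> the head has fewer labels, and the singletons that come after it are
multiplied into \<open>y\<close>.\<close>

lemma zclass_mult_all_products:
  assumes "finite S" "T \<subseteq> S" "h \<in> heads T" "y \<in> homology2 (S - T) k"
    and IH: "\<And>S. finite S \<Longrightarrow> homology2 S k \<subseteq> HV.span (all_products k S)"
  shows "zclass h * y \<in> HV.span (all_products (Suc k) S)"
  using assms(2-4)
proof (induction "card T" arbitrary: T h y rule: less_induct)
  case less
  have fin: "finite T" "finite (S - T)" using assms(1) less.prems(1) finite_subset by auto
  have y: "y \<in> HV.span (all_products k (S - T))" using IH[OF fin(2)] less.prems(3) by blast
  have B: "zclass g * y \<in> HV.span (all_products (Suc k) S)" if "g \<in> heads T" "head_kind g = KindB" for g
  proof -
    have "head_class g = zclass g" using that(2) by (simp add: head_class_def)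
    then have "zclass g \<in> factors KindB T"
      unfolding factors_heads[OF fin(1) kind.distinct(1)] using that by force
    from all_products_mult[OF this _ less.prems(1) y] show ?thesis by simp
  qed
  show ?case
  proof (cases "head_kind h")
    case KindB
    then show ?thesis using B less.prems(2) by blast
  next
    case (KindA m)
    have T: "card T = m + 2" and m: "1 \<le> m" using heads_kind_card[OF less.prems(2) KindA] by auto
    note e = enum[OF fin(1), unfolded T] and r = rank[OF fin(1), unfolded T]
    let ?N = "{1..m + 2}" and ?f = "enum T"
    have inj: "inj_on ?f ?N" using e(1) by (rule strict_mono_on_imp_inj_on)
    let ?h0 = "map (map (rank T)) h"
    have h0: "?h0 \<in> heads ?N" "head_kind ?h0 = KindA m"
      using heads_map[OF less.prems(2) r(1)] r(2) KindA by auto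
    have "map (map ?f) ?h0 = h"
    proof -
      have "?f (rank T i) = i" if "i \<in> set g" "g \<in> set h" for i g
      proof -
        have "i \<in> labels h" using that by (auto simp: labels_def)
        then show ?thesis using r(4) heads_labels[OF less.prems(2)] by simp
      qed
      then show ?thesis by (auto simp: map_idI comp_def)
    qed
    moreover have "?h0 \<in> cells2 ?N" using heads_crit[OF h0(1)] by (simp add: crit_def)
    ultimately have "zclass h = hrelabel ?f (zclass ?h0)" using hrelabel_zclass e(1) by metis
    also have "\<dots> \<in> HV.span (hrelabel ?f ` (A' (m + 2) m \<union> B_set (m + 2) m \<union> shorter_runs m))"
    proof (rule hrelabel_span)
      have "zclass ?h0 \<in> A_set (m + 2) m" unfolding A_set_heads[OF m] using h0 by blast
      then show "zclass ?h0 \<in> HV.span (A' (m + 2) m \<union> B_set (m + 2) m \<union> shorter_runs m)"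
        using A_set_span[OF m] by blast
    qed
    finally show ?thesis
    proof (rule span_mult[OF _ HV.span_base[of y "{y}"] HV.subspace_span])
      fix a b assume "a \<in> hrelabel ?f ` (A' (m + 2) m \<union> B_set (m + 2) m \<union> shorter_runs m)" "b \<in> {y}"
      then obtain z where z: "a = hrelabel ?f z" "b = y"
        "z \<in> A' (m + 2) m \<or> z \<in> B_set (m + 2) m \<or> z \<in> shorter_runs m" by blast
      from z(3) show "a * b \<in> HV.span (all_products (Suc k) S)"
      proof (elim disjE)
        assume "z \<in> A' (m + 2) m"
        then have "a \<in> factors (KindA m) T" using z(1) e by auto
        from all_products_mult[OF this _ less.prems(1) y] show ?thesis unfolding z(2) using m by simp
      next
        assume "z \<in> B_set (m + 2) m"
        then obtain g where g: "g \<in> heads ?N" "head_kind g = KindB" "z = zclass g"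
          using B_set_top by blast
        have "g \<in> cells2 ?N" using heads_crit[OF g(1)] by (simp add: crit_def)
        then have "a = zclass (map (map ?f) g)" using z(1) g(3) hrelabel_zclass e(1) by blast
        then show ?thesis using B heads_map[OF g(1) e(1)] e(2) g(2) z(2) by simp
      next
        assume "z \<in> shorter_runs m"
        then obtain us p q vs where l: "z = zclass (singletons us @ [p, q] # singletons vs)"
          "singletons us @ [[p, q]] \<in> heads (set (us @ [p, q]))"
          "distinct (us @ [p, q] @ vs)" "set (us @ [p, q] @ vs) = ?N" "length us < m"
          using shorter_runs_cases[OF m] by blast
        let ?U = "set (us @ [p, q])" and ?g = "singletons us @ [[p, q]]"
        have U: "?U \<subseteq> ?N" using l(4) by auto
        have V: "?N - ?U = set vs" using l(3,4) by auto
        have gv: "?g @ singletons vs \<in> cells2 ?N"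
        proof -
          have "singletons vs \<in> cells2 (?N - ?U)"
            unfolding V using cells2_singletons_append[of vs "[]" "set vs"] l(3) by simp
          then show ?thesis using cells2_head[of us p q "singletons vs" ?N] l(3) U by simp
        qed
        then have "a = zclass (map (map ?f) (?g @ singletons vs))"
          using z(1) l(1) hrelabel_zclass e(1) by simp
        also have "map (map ?f) (?g @ singletons vs) = map (map ?f) ?g @ singletons (map ?f vs)"
          by simp
        also have "zclass \<dots> = zclass (map (map ?f) ?g) * zclass (singletons (map ?f vs))"
        proof (rule zclass_heads_append)
          show "map (map ?f) ?g \<in> heads (?f ` ?U)"
            by (rule heads_map(1)[OF l(2)]) (rule monotone_on_subset[OF e(1) U])
          have "?f ` ?N - ?f ` ?U = ?f ` set vs" using inj_on_image_set_diff[OF inj _ U] V by auto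
          then show "singletons (map ?f vs) \<in> cells2 (?f ` ?N - ?f ` ?U)"
            using cells2_singletons_append[of "map ?f vs" "[]"] l(3,4) inj
            by (auto simp: distinct_map intro: inj_on_subset)
        qed (use U in auto)
        also have "zclass (singletons (map ?f vs)) = sings (map ?f vs)"
          using l(3,4) inj by (intro zclass_singletons) (auto simp: distinct_map intro: inj_on_subset)
        finally have a: "a = zclass (map (map ?f) ?g) * sings (map ?f vs)" .
        have gU: "map (map ?f) ?g \<in> heads (?f ` ?U)"
          by (rule heads_map(1)[OF l(2)]) (rule monotone_on_subset[OF e(1) U])
        have fU: "?f ` ?U \<subseteq> T" using U e(2) by blast
        have dv: "distinct (map ?f vs)"
          using l(3,4) inj by (auto simp: distinct_map intro: inj_on_subset)
        have Tv: "set (map ?f vs) = T - ?f ` ?U"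
        proof -
          have "?f ` (?N - ?U) = ?f ` ?N - ?f ` ?U"
            by (rule inj_on_image_set_diff[OF inj _ U]) blast
          then show ?thesis unfolding V e(2) by simp
        qed
        have "set (map ?f vs) \<inter> (S - T) = {}" unfolding Tv by blast
        then have sy: "sings (map ?f vs) * y \<in> homology2 (S - ?f ` ?U) k"
        proof -
          have "set (map ?f vs) \<union> (S - T) = S - ?f ` ?U" unfolding Tv using fU less.prems(1) by blast
          then show ?thesis
            using homology2_mult[OF sings_homology[OF dv] less.prems(3) \<open>set (map ?f vs) \<inter> (S - T) = {}\<close>]
            by simp
        qed
        have "card (?f ` ?U) < card T"
        proof -
          have "card ?U = length us + 2" using distinct_card[of "us @ [p, q]"] l(3) by simp
          then show ?thesis using card_image_le[of ?U ?f] T l(5) by simp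
        qed
        from less.hyps[OF this _ gU sy] fU less.prems(1)
        show ?thesis unfolding a z(2) mult.assoc by auto
      qed
    qed simp
  qed
qed

lemma homology2_all_products: "finite S \<Longrightarrow> homology2 S k \<subseteq> HV.span (all_products k S)"
proof (induction k arbitrary: S)
  case 0
  have "barrier_tuples 0 = {[]}" by (auto simp: barrier_tuples_def)
  then show ?case using homology2_0_span[OF 0] by (auto simp: all_products_def)
next
  case (Suc k)
  show ?case
  proof
    fix x assume "x \<in> homology2 S (Suc k)"
    with homology2_Suc_span[OF Suc.prems]
    have "x \<in> HV.span {zclass h * y | T h y. T \<subseteq> S \<and> h \<in> heads T \<and> y \<in> homology2 (S - T) k}"
      by blast
    also have "\<dots> \<subseteq> HV.span (all_products (Suc k) S)"
      using zclass_mult_all_products[OF Suc.prems _ _ _ Suc.IH]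
      by (intro HV.span_minimal HV.subspace_span) blast
    finally show "x \<in> HV.span (all_products (Suc k) S)" .
  qed
qed

lemma all_products_homology: "all_products k S \<subseteq> homology2 S k"
proof
  fix x assume "x \<in> all_products k S"
  then obtain t where "t \<in> barrier_tuples k" "x \<in> products t S"
    unfolding all_products_def by blast
  then show "x \<in> homology2 S k"
    using products_homology[of x t S] by (simp add: barrier_tuples_valid)
qed

lemma homology2_eq_span:
  assumes "finite S"
  shows "homology2 S k = HV.span (product_class k ` crit S k)"
  unfolding all_products_crit[OF assms, symmetric]
  by (intro equalityI homology2_all_products HV.span_minimal all_products_homology
      subspace_homology2 assms)

text \<open>The products span a space that has a basis indexed by the same set.\<close>

lemma product_class_indep:
  assumes "finite S"
  shows "HV.indep_family (product_class k) (crit S k)"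
proof (rule HV.spanning_family_indep[OF _ _ zclass_indep[OF assms]])
  show "zclass ` crit S k \<subseteq> HV.span (product_class k ` crit S k)"
    using homology2_eq_span[OF assms] zclass_homology by blast
  show "product_class k ` crit S k \<subseteq> HV.span (zclass ` crit S k)"
    using zclass_span[OF assms] all_products_homology[of k S] all_products_crit[OF assms] by blast
qed (use assms in auto)

section \<open>The generated modules\<close>

lemma products_hins:
  assumes "x \<in> products t S" "valid t" "slot t j" "Suc n \<notin> S"
  shows "hins S (length t) n j x \<in> products t (insert (Suc n) S)"
  using assms
proof (induction t arbitrary: x S j)
  case Nil
  then obtain us where us: "x = sings us" "distinct us" "set us = S" by auto
  have "hins S 0 n 0 x = sing (Suc n) * x"
    using Nil us sings_homology by (intro hins_0) auto
  then have "hins S 0 n 0 x = sings (Suc n # us)" using us by simp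
  moreover have "distinct (Suc n # us)" "set (Suc n # us) = insert (Suc n) S" using us Nil by auto
  moreover have "j = 0" using Nil(3) by simp
  ultimately show ?case
    unfolding products.simps by (intro CollectI exI[of _ "Suc n # us"]) simp
next
  case (Cons kd t)
  then obtain a y T where x: "x = a * y" "T \<subseteq> S" "a \<in> factors kd T" "y \<in> products t (S - T)" by auto
  have fin: "finite S" using products_card[OF Cons.prems(1)] by blast
  have v: "kd \<noteq> KindA 0" "valid t" using Cons.prems(2) by auto
  show ?case
  proof (cases j)
    case 0
    then have kd: "kd = KindB" using Cons.prems(3) by simp
    then obtain us p q where a: "a = sings us * loop p q" "distinct (us @ [p, q])" "set (us @ [p, q]) = T"
      using x(3) by auto
    have "hins S (length (kd # t)) n 0 x = sing (Suc n) * x"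
      using products_homology[OF Cons.prems(1,2)] fin Cons.prems(4) by (intro hins_0)
    also have "\<dots> = (sings (Suc n # us) * loop p q) * y" using x(1) a(1) by (simp add: mult.assoc)
    finally have eq: "hins S (length (kd # t)) n 0 x = (sings (Suc n # us) * loop p q) * y" .
    have "Suc n \<notin> T" using Cons.prems(4) x(2) by auto
    then have "distinct ((Suc n # us) @ [p, q])" "set ((Suc n # us) @ [p, q]) = insert (Suc n) T"
      using a(2,3) by auto
    then have "sings (Suc n # us) * loop p q \<in> factors kd (insert (Suc n) T)"
      unfolding kd factors.simps by blast
    moreover have "insert (Suc n) S - insert (Suc n) T = S - T" using Cons.prems(4) by auto
    then have "y \<in> products t (insert (Suc n) S - insert (Suc n) T)" using x(4) by simp
    ultimately show ?thesis unfolding 0 eq using x(2) by (intro products_ConsI) auto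
  next
    case (Suc i)
    then have i: "slot t i" using Cons.prems(3) by simp
    have TS: "T \<union> (S - T) = S" using x(2) by auto
    have "hins (T \<union> (S - T)) (Suc (length t)) n (Suc i) (a * y) = a * hins (S - T) (length t) n i y"
    proof (rule hins_mult_1)
      show "finite (T \<union> (S - T))" "Suc n \<notin> T \<union> (S - T)" unfolding TS using fin Cons.prems(4) by auto
    qed (use slot_le[OF i] factors_homology[OF x(3) v(1)] products_homology[OF x(4) v(2)] in auto)
    then have eq: "hins S (length (kd # t)) n j x = a * hins (S - T) (length t) n i y"
      using Suc x(1) TS by simp
    have "hins (S - T) (length t) n i y \<in> products t (insert (Suc n) (S - T))"
      using Cons.IH[OF x(4) v(2) i] Cons.prems(4) by simp
    moreover have "insert (Suc n) (S - T) = insert (Suc n) S - T" using Cons.prems(4) x(2) by auto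
    ultimately have "hins (S - T) (length t) n i y \<in> products t (insert (Suc n) S - T)" by simp
    then show ?thesis unfolding eq using x(2,3) by (intro products_ConsI) auto
  qed
qed

lemma not_in_image_Diff: "inj_on \<sigma> S \<Longrightarrow> b \<in> S \<Longrightarrow> \<sigma> b \<notin> \<sigma> ` (S - {b})"
  by (auto simp: inj_on_def)

text \<open>A product with more labels than the tuple requires has a singleton \<open>b\<close> in a free run. If a
relabeling sends \<open>b\<close> to \<open>Suc n\<close>, the relabeled product is the insertion of that label
into the relabeled product without \<open>b\<close>.\<close>

lemma products_slack:
  assumes "x \<in> products t S" "valid t" "tuple_degree t < card S"
  shows "\<exists>b\<in>S. \<exists>j x'. slot t j \<and> x' \<in> products t (S - {b}) \<and>
    (\<forall>\<sigma> n. inj_on \<sigma> S \<and> \<sigma> b = Suc n \<longrightarrow>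
      hrelabel \<sigma> x = hins (\<sigma> ` (S - {b})) (length t) n j (hrelabel \<sigma> x'))"
  using assms
proof (induction t arbitrary: x S)
  case Nil
  then obtain us where us: "x = sings us" "distinct us" "set us = S" by auto
  then obtain b vs where b: "us = b # vs" using Nil(3) by (cases us) auto
  have S: "S - {b} = set vs" "distinct vs" "b \<in> S" using us b by auto
  have "hrelabel \<sigma> x = hins (\<sigma> ` (S - {b})) (length []) n 0 (hrelabel \<sigma> (sings vs))"
    if \<sigma>: "inj_on \<sigma> S" "\<sigma> b = Suc n" for \<sigma> n
  proof -
    have "hrelabel \<sigma> (sings vs) \<in> homology2 (\<sigma> ` (S - {b})) 0"
      unfolding S(1) using \<sigma>(1) us(3) b
      by (intro homology2_hrelabel sings_homology S(2)) (auto intro: inj_on_subset)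
    moreover have "Suc n \<notin> \<sigma> ` (S - {b})" using not_in_image_Diff[OF \<sigma>(1) S(3)] \<sigma>(2) by simp
    ultimately have "hins (\<sigma> ` (S - {b})) 0 n 0 (hrelabel \<sigma> (sings vs)) = sing (Suc n) * hrelabel \<sigma> (sings vs)"
      using S(1) by (intro hins_0) auto
    then show ?thesis using us(1) b \<sigma>(2) by (simp add: hrelabel_piece_class)
  qed
  moreover have "sings vs \<in> products [] (S - {b})" using S by auto
  ultimately show ?case using S(3) by (intro bexI[of _ b] exI[of _ 0] exI[of _ "sings vs"]) auto
next
  case (Cons kd t)
  then obtain a y T where x: "x = a * y" "T \<subseteq> S" "a \<in> factors kd T" "y \<in> products t (S - T)" by auto
  have fin: "finite S" using products_card[OF Cons.prems(1)] by blast
  have finT: "finite T" using x(2) fin finite_subset by blast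
  have v: "kd \<noteq> KindA 0" "valid t" using Cons.prems(2) by auto
  show ?case
  proof (cases "kind_degree kd < card T")
    case True
    have kd: "kd = KindB"
    proof (cases kd)
      case (KindA m)
      then obtain f where f: "strict_mono_on {1..m + 2} f" "f ` {1..m + 2} = T" using x(3) by auto
      then have "card T = m + 2" using card_image[OF strict_mono_on_imp_inj_on[OF f(1)]] by simp
      then show ?thesis using True KindA by simp
    qed
    then obtain us p q where a: "a = sings us * loop p q" "distinct (us @ [p, q])" "set (us @ [p, q]) = T"
      using x(3) by auto
    have "card T = length us + 2" using distinct_card[OF a(2)] a(3) by simp
    then obtain b vs where b: "us = b # vs" using True kd by (cases us) auto
    let ?x = "(sings vs * loop p q) * y"
    have bT: "b \<in> T" "b \<in> S" using a(3) b x(2) by auto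
    have "distinct (vs @ [p, q])" "set (vs @ [p, q]) = T - {b}" using a(2,3) b by auto
    then have "sings vs * loop p q \<in> factors kd (T - {b})" unfolding kd factors.simps by blast
    moreover have "S - {b} - (T - {b}) = S - T" using bT by auto
    ultimately have x': "?x \<in> products (kd # t) (S - {b})"
      using x(2,4) by (intro products_ConsI) auto
    have "hrelabel \<sigma> x = hins (\<sigma> ` (S - {b})) (length (kd # t)) n 0 (hrelabel \<sigma> ?x)"
      if \<sigma>: "inj_on \<sigma> S" "\<sigma> b = Suc n" for \<sigma> n
    proof -
      have "hrelabel \<sigma> ?x \<in> homology2 (\<sigma> ` (S - {b})) (length (kd # t))"
        using products_homology[OF x' Cons.prems(2)] \<sigma>(1)
        by (intro homology2_hrelabel) (auto intro: inj_on_subset)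
      moreover have "Suc n \<notin> \<sigma> ` (S - {b})" using not_in_image_Diff[OF \<sigma>(1) bT(2)] \<sigma>(2) by simp
      ultimately have "hins (\<sigma> ` (S - {b})) (length (kd # t)) n 0 (hrelabel \<sigma> ?x)
          = sing (Suc n) * hrelabel \<sigma> ?x"
        using fin by (intro hins_0) auto
      then show ?thesis using x(1) a(1) b \<sigma>(2) by (simp add: hrelabel_piece_class mult.assoc)
    qed
    then show ?thesis
      using bT(2) kd x' by (intro bexI[of _ b] exI[of _ 0] exI[of _ ?x]) auto
  next
    case False
    have "card S = card T + card (S - T)"
      using x(2) fin finT by (simp add: card_Diff_subset card_mono)
    then have "tuple_degree t < card (S - T)"
      using Cons.prems(3) False by (simp add: tuple_degree_def)
    from Cons.IH[OF x(4) v(2) this] obtain b j y' where b: "b \<in> S - T" "slot t j"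
      "y' \<in> products t (S - T - {b})"
      "\<And>\<sigma> n. inj_on \<sigma> (S - T) \<Longrightarrow> \<sigma> b = Suc n \<Longrightarrow>
        hrelabel \<sigma> y = hins (\<sigma> ` (S - T - {b})) (length t) n j (hrelabel \<sigma> y')"
      by blast
    have sd: "S - {b} - T = S - T - {b}" by auto
    have x': "a * y' \<in> products (kd # t) (S - {b})"
      using x(2,3) b(1,3) sd by (intro products_ConsI) auto
    have "hrelabel \<sigma> x = hins (\<sigma> ` (S - {b})) (length (kd # t)) n (Suc j) (hrelabel \<sigma> (a * y'))"
      if \<sigma>: "inj_on \<sigma> S" "\<sigma> b = Suc n" for \<sigma> n
    proof -
      have inj: "inj_on \<sigma> T" "inj_on \<sigma> (S - T)" "inj_on \<sigma> (S - T - {b})"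
        using \<sigma>(1) x(2) by (auto intro: inj_on_subset)
      have im: "\<sigma> ` (S - {b}) = \<sigma> ` T \<union> \<sigma> ` (S - T - {b})" using x(2) b(1) by auto
      have "hins (\<sigma> ` T \<union> \<sigma> ` (S - T - {b})) (Suc (length t)) n (Suc j) (hrelabel \<sigma> a * hrelabel \<sigma> y')
          = hrelabel \<sigma> a * hins (\<sigma> ` (S - T - {b})) (length t) n j (hrelabel \<sigma> y')"
      proof (rule hins_mult_1)
        show "finite (\<sigma> ` T \<union> \<sigma> ` (S - T - {b}))" using fin finT by simp
        show "\<sigma> ` T \<inter> \<sigma> ` (S - T - {b}) = {}"
          using inj_on_image_Int[OF \<sigma>(1) x(2), of "S - T - {b}"] by blast
        show "Suc n \<notin> \<sigma> ` T \<union> \<sigma> ` (S - T - {b})"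
          unfolding im[symmetric] using not_in_image_Diff[OF \<sigma>(1), of b] \<sigma>(2) b(1) by simp
        show "j \<le> length t" using b(2) by (rule slot_le)
        show "hrelabel \<sigma> a \<in> homology2 (\<sigma> ` T) 1"
          using factors_homology[OF x(3) v(1)] inj(1) by (rule homology2_hrelabel)
        show "hrelabel \<sigma> y' \<in> homology2 (\<sigma> ` (S - T - {b})) (length t)"
          using products_homology[OF b(3) v(2)] inj(3) by (rule homology2_hrelabel)
      qed
      then show ?thesis using b(4)[OF inj(2) \<sigma>(2)] x(1) im by simp
    qed
    then show ?thesis
      using b(1,2) x' by (intro bexI[of _ b] exI[of _ "Suc j"] exI[of _ "a * y'"]) auto
  qed
qed

text \<open>The data that define an element of \<open>barrier_set\<close>, for an arbitrary label set, so that the first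
factor can be split off.\<close>

definition placed :: "(nat \<Rightarrow> nat) list \<Rightarrow> hclass list \<Rightarrow> kind list \<Rightarrow> nat set \<Rightarrow> bool"
  where "placed fs xs t S \<longleftrightarrow> length fs = length t \<and> length xs = length t \<and>
    (\<forall>j<length t. xs ! j \<in> kind_set A' (t ! j) \<and>
      strict_mono_on {1..kind_degree (t ! j)} (fs ! j)) \<and>
    disjoint_family_on (\<lambda>j. (fs ! j) ` {1..kind_degree (t ! j)}) {..<length t} \<and>
    (\<Union>j<length t. (fs ! j) ` {1..kind_degree (t ! j)}) = S"

lemma placed_Cons:
  "placed (f # fs) (x # xs) (kd # t) S \<longleftrightarrow> x \<in> kind_set A' kd \<and> strict_mono_on {1..kind_degree kd} f \<and>
    f ` {1..kind_degree kd} \<subseteq> S \<and> placed fs xs t (S - f ` {1..kind_degree kd})"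
proof -
  let ?I = "\<lambda>j. (fs ! j) ` {1..kind_degree (t ! j)}" and ?F = "f ` {1..kind_degree kd}"
  let ?J = "\<lambda>j. ((f # fs) ! j) ` {1..kind_degree ((kd # t) ! j)}"
  have all: "(\<forall>j<length (kd # t). P j) \<longleftrightarrow> P 0 \<and> (\<forall>j<length t. P (Suc j))" for P
    by (simp add: All_less_Suc2)
  have D: "disjoint_family_on ?J {..<length (kd # t)} \<longleftrightarrow>
      disjoint_family_on ?I {..<length t} \<and> ?F \<inter> (\<Union>j<length t. ?I j) = {}"
    (is "?L \<longleftrightarrow> ?R")
  proof
    assume d: ?L
    have "?I i \<inter> ?I j = {}" if "i < length t" "j < length t" "i \<noteq> j" for i j
      using d that unfolding disjoint_family_on_def
      by (metis Suc_inject Suc_less_eq length_Cons lessThan_iff nth_Cons_Suc)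
    moreover have "?F \<inter> ?I j = {}" if "j < length t" for j
      using d that unfolding disjoint_family_on_def
      by (metis Suc_less_eq length_Cons lessThan_iff nth_Cons_0 nth_Cons_Suc zero_less_Suc nat.distinct(1))
    ultimately show ?R unfolding disjoint_family_on_def by blast
  next
    assume r: ?R
    have I: "?I a \<inter> ?I b = {}" if "a < length t" "b < length t" "a \<noteq> b" for a b
      using r that unfolding disjoint_family_on_def by blast
    have F: "?F \<inter> ?I a = {}" "?I a \<inter> ?F = {}" if "a < length t" for a
      using r that by blast+
    show ?L
      unfolding disjoint_family_on_def
    proof (intro ballI impI)
      fix i j assume ij: "i \<in> {..<length (kd # t)}" "j \<in> {..<length (kd # t)}" "i \<noteq> j"
      then show "?J i \<inter> ?J j = {}"
        using I F by (cases i; cases j) simp_all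
    qed
  qed
  have U: "(\<Union>j<length (kd # t). ?J j) = ?F \<union> (\<Union>j<length t. ?I j)"
    by (simp add: lessThan_Suc_eq_insert_0 image_image)
  have set: "?F \<inter> (\<Union>j<length t. ?I j) = {} \<and> ?F \<union> (\<Union>j<length t. ?I j) = S \<longleftrightarrow>
      ?F \<subseteq> S \<and> (\<Union>j<length t. ?I j) = S - ?F" by blast
  show ?thesis
    unfolding placed_def all D U
    unfolding nth_Cons_0 nth_Cons_Suc length_Cons nat.inject
    using set by argo
qed

lemma barrier_set_placed:
  "barrier_set A' t = {prod_list (map2 hrelabel fs xs) | fs xs. placed fs xs t {1..tuple_degree t}}"
proof -
  have "foldr hconc ys (hcls (bvec [])) = prod_list ys" for ys
    by (induction ys) (simp_all add: one_hclass times_hclass_def)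
  then show ?thesis by (simp add: barrier_set_def placed_def)
qed

lemma factor_kind_set:
  assumes "x \<in> kind_set A' kd" "strict_mono_on {1..kind_degree kd} f"
  shows "hrelabel f x \<in> factors kd (f ` {1..kind_degree kd})"
proof (cases kd)
  case KindB
  have "f 1 < f 2" using assms(2) KindB by (simp add: strict_mono_on_def)
  then have "hrelabel f x = sings [] * loop (f 1) (f 2)"
    using assms(1) KindB by (simp add: B_set_2 hrelabel_piece_class)
  moreover have "{1..2 :: nat} = {1, 2}" by auto
  ultimately show ?thesis
    unfolding KindB factors.simps using \<open>f 1 < f 2\<close>
    by (intro CollectI exI[of _ "[]"] exI[of _ "f 1"] exI[of _ "f 2"]) auto
qed (use assms in auto)

lemma placed_products: "placed fs xs t S \<Longrightarrow> prod_list (map2 hrelabel fs xs) \<in> products t S"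
proof (induction t arbitrary: fs xs S)
  case Nil
  then show ?case by (auto simp: placed_def intro!: exI[of _ "[]"])
next
  case (Cons kd t)
  then obtain f fs' x xs' where l: "fs = f # fs'" "xs = x # xs'"
    by (cases fs; cases xs) (auto simp: placed_def)
  then have p: "x \<in> kind_set A' kd" "strict_mono_on {1..kind_degree kd} f"
    "f ` {1..kind_degree kd} \<subseteq> S" "placed fs' xs' t (S - f ` {1..kind_degree kd})"
    using Cons.prems placed_Cons by auto
  then show ?case
    using Cons.IH[OF p(4)] factor_kind_set[OF p(1,2)] l by auto
qed

lemma factors_tight:
  assumes "x \<in> factors kd T" "card T = kind_degree kd"
  obtains f y where "x = hrelabel f y" "y \<in> kind_set A' kd" "strict_mono_on {1..kind_degree kd} f"
    "f ` {1..kind_degree kd} = T"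
proof (cases kd)
  case KindB
  then obtain us a b where x: "x = sings us * loop a b" "distinct (us @ [a, b])" "set (us @ [a, b]) = T"
    using assms(1) by auto
  have "card T = length us + 2" using distinct_card[OF x(2)] x(3) by simp
  then have us: "us = []" using assms(2) KindB by simp
  have two: "{1..2 :: nat} = {1, 2}" by auto
  define p q where "p = min a b" and "q = max a b"
  have pq: "p < q" "loop p q = loop a b" "{p, q} = {a, b}"
    using x(2) loop_commute[of a b] by (auto simp: p_def q_def min_def max_def)
  let ?f = "\<lambda>i. if i = 1 then p else q"
  have "hrelabel ?f (loop 1 2) = loop p q" using pq(1) by (simp add: hrelabel_piece_class)
  then show ?thesis
    using that[of ?f "loop 1 2"] KindB x us pq two
    by (auto simp: B_set_2 strict_mono_on_def)
next
  case (KindA m)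
  then show ?thesis using assms(1) that by auto
qed

lemma products_tight:
  assumes "x \<in> products t S" "card S = tuple_degree t"
  shows "\<exists>fs xs. placed fs xs t S \<and> x = prod_list (map2 hrelabel fs xs)"
  using assms
proof (induction t arbitrary: x S)
  case Nil
  then obtain us where us: "x = sings us" "distinct us" "set us = S" by auto
  then have "us = []" using Nil(2) distinct_card[of us] by (simp add: tuple_degree_def)
  then show ?case using us by (intro exI[of _ "[]"]) (auto simp: placed_def disjoint_family_on_def)
next
  case (Cons kd t)
  then obtain a y T where x: "x = a * y" "T \<subseteq> S" "a \<in> factors kd T" "y \<in> products t (S - T)" by auto
  have fin: "finite S" using products_card[OF Cons.prems(1)] by blast
  have "card S = card T + card (S - T)"
    using x(2) fin finite_subset[OF x(2) fin] by (simp add: card_Diff_subset card_mono)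
  then have c: "card T = kind_degree kd" "card (S - T) = tuple_degree t"
    using Cons.prems(2) factors_card[OF x(3)] products_card[OF x(4)] by (auto simp: tuple_degree_def)
  obtain f z where f: "a = hrelabel f z" "z \<in> kind_set A' kd" "strict_mono_on {1..kind_degree kd} f"
    "f ` {1..kind_degree kd} = T" using factors_tight[OF x(3) c(1)] .
  obtain fs xs where "placed fs xs t (S - T)" "y = prod_list (map2 hrelabel fs xs)"
    using Cons.IH[OF x(4) c(2)] by blast
  then have "placed (f # fs) (z # xs) (kd # t) S \<and> x = prod_list (map2 hrelabel (f # fs) (z # xs))"
    using f x(1,2) placed_Cons by simp
  then show ?case by blast
qed

lemma barrier_set_products: "barrier_set A' t \<subseteq> products t {1..tuple_degree t}"
  unfolding barrier_set_placed using placed_products by blast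

lemma products_barrier_set: "products t {1..tuple_degree t} \<subseteq> barrier_set A' t"
proof
  fix x assume "x \<in> products t {1..tuple_degree t}"
  from products_tight[OF this] have
    "\<exists>fs xs. placed fs xs t {1..tuple_degree t} \<and> x = prod_list (map2 hrelabel fs xs)" by simp
  then show "x \<in> barrier_set A' t" unfolding barrier_set_placed by blast
qed

lemma subrep_products:
  assumes "valid t"
  shows "subrep (length t) n (HV.span (products t {1..n}))"
  unfolding subrep_def
proof (intro conjI allI impI)
  show "HV.subspace (HV.span (products t {1..n}))" by (rule HV.subspace_span)
  show "HV.span (products t {1..n}) \<subseteq> Hk (length t) n"
    using products_homology assms by (intro HV.span_minimal subspace_homology2) auto
  fix \<sigma> assume \<sigma>: "\<sigma> permutes {1..n}"
  have "hrelabel \<sigma> ` products t {1..n} \<subseteq> HV.span (products t {1..n})"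
    using products_relabel[OF _ assms permutes_inj_on[OF \<sigma>]] permutes_image[OF \<sigma>] by fastforce
  then have "HV.span (hrelabel \<sigma> ` products t {1..n}) \<subseteq> HV.span (products t {1..n})"
    by (intro HV.span_minimal HV.subspace_span)
  then show "hrelabel \<sigma> ` HV.span (products t {1..n}) \<subseteq> HV.span (products t {1..n})"
    using hrelabel_span by blast
qed

text \<open>The spans of products form one of the sequences that are intersected in \<open>generated\<close>.
Any other such sequence contains all products, by induction on the number of labels: a
transposition moves a free singleton to the largest label.\<close>

lemma barrier_module_products:
  assumes "valid t"
  shows "barrier_module A' t n = HV.span (products t {1..n})"
proof
  let ?W = "\<lambda>i. HV.span (products t {1..i})"
  have "hiota (length t) i j ` ?W i \<subseteq> ?W (Suc i)" if "j \<in> set (barrier_maps t)" for i j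
  proof
    fix z assume "z \<in> hiota (length t) i j ` ?W i"
    then obtain x where x: "x \<in> ?W i" "z = hins {1..i} (length t) i j x" by (auto simp: hiota_hins)
    have j: "slot t j" using that by (simp add: set_barrier_maps)
    have ins: "insert (Suc i) {1..i} = {1..Suc i}" by auto
    show "z \<in> ?W (Suc i)"
      unfolding x(2)
    proof (rule lin_on_span_image[OF hins_lin subspace_homology2 _ _ x(1)])
      show "products t {1..i} \<subseteq> homology2 {1..i} (length t)" using products_homology assms by auto
      fix a assume "a \<in> products t {1..i}"
      then show "hins {1..i} (length t) i j a \<in> ?W (Suc i)"
        using products_hins[OF _ assms j, of a "{1..i}" i] ins by (auto intro: HV.span_base)
    qed simp
  qed
  moreover have "HV.span (barrier_set A' t) \<subseteq> ?W (tuple_degree t)"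
    by (intro HV.span_mono barrier_set_products)
  ultimately show "barrier_module A' t n \<subseteq> ?W n"
    unfolding barrier_module_def generated_def using subrep_products[OF assms]
    by (intro Inter_lower CollectI exI[of _ ?W]) simp
  show "?W n \<subseteq> barrier_module A' t n"
    unfolding barrier_module_def generated_def
  proof (rule Inter_greatest, clarify)
    fix W x
    assume W: "\<forall>i. subrep (length t) i (W i)" "HV.span (barrier_set A' t) \<subseteq> W (tuple_degree t)"
      "\<forall>i. \<forall>j\<in>set (barrier_maps t). hiota (length t) i j ` W i \<subseteq> W (Suc i)"
      and x: "x \<in> ?W n"
    have "products t {1..n} \<subseteq> W n" for n
    proof (induction n rule: less_induct)
      case (less n)
      show ?case
      proof
        fix x assume x: "x \<in> products t {1..n}"
        show "x \<in> W n"
        proof (cases "tuple_degree t = n")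
          case True
          then have "x \<in> barrier_set A' t" using x products_barrier_set by blast
          then show ?thesis using W(2) HV.span_base True by blast
        next
          case False
          then have "tuple_degree t < card {1..n}" using products_card[OF x] by simp
          from products_slack[OF x assms this] obtain b j x' where b: "b \<in> {1..n}" "slot t j"
            "x' \<in> products t ({1..n} - {b})"
            "\<And>\<sigma> n'. inj_on \<sigma> {1..n} \<Longrightarrow> \<sigma> b = Suc n' \<Longrightarrow>
              hrelabel \<sigma> x = hins (\<sigma> ` ({1..n} - {b})) (length t) n' j (hrelabel \<sigma> x')" by blast
          obtain n' where n': "n = Suc n'" using b(1) by (cases n) auto
          \<comment> \<open>an involution, so that \<open>x\<close> is recovered by relabeling twice\<close>
          let ?\<sigma> = "transpose b (Suc n')"
          have perm: "?\<sigma> permutes {1..n}" using b(1) n' by (intro permutes_swap_id) auto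
          have inj: "inj_on ?\<sigma> S" for S using permutes_inj_on[OF perm] .
          have im: "?\<sigma> ` ({1..n} - {b}) = {1..n'}"
          proof -
            have "?\<sigma> ` ({1..n} - {b}) = ?\<sigma> ` {1..n} - ?\<sigma> ` {b}"
              by (rule inj_on_image_set_diff[OF inj]) (use b(1) in auto)
            also have "\<dots> = {1..n} - {Suc n'}" using permutes_image[OF perm] by simp
            also have "\<dots> = {1..n'}" using n' by auto
            finally show ?thesis .
          qed
          have sub: "HV.subspace (W i)" "\<And>\<tau>. \<tau> permutes {1..i} \<Longrightarrow> hrelabel \<tau> ` W i \<subseteq> W i" for i
            using W(1) unfolding subrep_def by auto
          have "hrelabel ?\<sigma> x' \<in> HV.span (products t {1..n'})"
            using products_relabel[OF b(3) assms inj] im by simp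
          also have "\<dots> \<subseteq> W n'" using less.IH[of n'] n' sub(1) by (intro HV.span_minimal) auto
          finally have "hiota (length t) n' j (hrelabel ?\<sigma> x') \<in> W n"
            using W(3) b(2) n' by (auto simp: set_barrier_maps)
          then have "hrelabel ?\<sigma> x \<in> W n" using b(4)[OF inj, of n'] im by (simp add: hiota_hins)
          then have "hrelabel ?\<sigma> (hrelabel ?\<sigma> x) \<in> W n" using sub(2)[OF perm] by blast
          moreover have "hrelabel ?\<sigma> (hrelabel ?\<sigma> x) = x"
            using products_homology[OF x assms] by (simp add: hrelabel_ident)
          ultimately show ?thesis by simp
        qed
      qed
    qed
    moreover have "HV.subspace (W n)" using W(1) unfolding subrep_def by blast
    ultimately show "x \<in> W n" using x HV.span_minimal by blast
  qed
qed

lemma barrier_decomposition: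
  "(\<forall>t\<in>barrier_tuples k. subrep k n (barrier_module A' t n)) \<and>
    internal_direct_sum (barrier_tuples k) (\<lambda>t. barrier_module A' t n) (Hk k n)"
proof
  show "\<forall>t\<in>barrier_tuples k. subrep k n (barrier_module A' t n)"
    using subrep_products barrier_module_products by (auto simp: barrier_tuples_valid)
  have "internal_direct_sum (barrier_tuples k)
      (\<lambda>t. HV.span (product_class k ` {e \<in> crit {1..n} k. tuple_of k e = t}))
      (HV.span (product_class k ` crit {1..n} k))"
    by (rule internal_direct_sum_family)
      (use product_class_indep tuple_of_valid in auto)
  then have "internal_direct_sum (barrier_tuples k)
      (\<lambda>t. HV.span (product_class k ` {e \<in> crit {1..n} k. tuple_of k e = t})) (Hk k n)"
    using homology2_eq_span[of "{1..n}" k] by simp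
  then show "internal_direct_sum (barrier_tuples k) (\<lambda>t. barrier_module A' t n) (Hk k n)"
  proof (rule internal_direct_sum_cong)
    fix t assume "t \<in> barrier_tuples k"
    then show "barrier_module A' t n = HV.span (product_class k ` {e \<in> crit {1..n} k. tuple_of k e = t})"
      using barrier_module_products[of t n] products_crit[of "{1..n}" t]
      by (simp add: barrier_tuples_valid)
  qed
qed

end

theorem theorem6p2:
  fixes A' :: "nat \<Rightarrow> nat \<Rightarrow> hclass set" and k :: nat
  assumes "admissible A'"
  shows "\<forall>n. (\<forall>t\<in>barrier_tuples k. subrep k n (barrier_module A' t n)) \<and>
    internal_direct_sum (barrier_tuples k) (\<lambda>t. barrier_module A' t n) (Hk k n)"
proof -
  interpret admissible_family A' using assms by unfold_locales
  show ?thesis using barrier_decomposition by blast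
qed

end
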